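(* Let $\mathcal{T}$ be a locally finite face-to-face tiling of $\mathbb{E}^d$ by convex $d$-polytopes such that $N_j(\mathcal{T})$ is finite for every $j\ge 0$. Then $\mathcal{T}$ is combinatorially multihedral if and only if there exists a positive integer $k$ such that: (1) $N_k(\mathcal{T})$ is finite and $N_{k-1}(\mathcal{T}) = N_k(\mathcal{T})$; (2) $\Gamma^i_{k-1} = \Gamma^i_k$ for all $i=1,\dots,N_k(\mathcal{T})$. Moreover, if $k$ satisfies (1) and (2), then for every tile $P$ of $\mathcal{T}$ one has $\Gamma(\mathcal{C}_k(P)) = \Gamma_P(\mathcal{T})$, and the number of orbits of $\Gamma(\mathcal{T})$ on the tiles equals $N_k(\mathcal{T})$. In particular, for a positive integer $n$, $\mathcal{T}$ is combinatorially tile-$n$-transitive if and only if for some positive integer $k$ conditions (1) and (2) hold with $N_k(\mathcal{T}) = n$.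
   Context: A tiling $\mathcal{T}$ of $\mathbb{E}^d$ is a countable family of convex $d$-polytopes (tiles) covering $\mathbb{E}^d$ with pairwise disjoint interiors; it is locally finite if each point has a neighborhood meeting only finitely many tiles, and face-to-face if the intersection of any two tiles is a face (possibly empty) of each. The face-lattice of $\mathcal{T}$ is the set of all faces of all tiles (with $\mathcal{T}$ adjoined as a greatest element) ordered by inclusion; $\Gamma(\mathcal{T})$ is its automorphism group (combinatorial automorphism group), and $\Gamma_P(\mathcal{T})$ is the stabilizer of a tile $P$ in $\Gamma(\mathcal{T})$. $\mathcal{T}$ is combinatorially multihedral if $\Gamma(\mathcal{T})$ has finitely many orbits on the tiles, and combinatorially tile-$n$-transitive if it has exactly $n$ such orbits. The distance $d(P,Q)$ between tiles $P,Q$ is the minimum $n$ such that there is a sequence of tiles $P=P_0,P_1,\dots,P_n=Q$ with $P_{j-1}\cap P_j$ a face of both of dimension at least $d-2$ for $j=1,\dots,n$. For an integer $k\ge 0$, the $k^{th}$ corona $\mathcal{C}_k(P)$ of a tile $P$ is the subcomplex consisting of all tiles $Q$ with $d(P,Q)\le k$ together with all their faces; the centered $k^{th}$ corona is the pair $(P,\mathcal{C}_k(P))$. Two centered $k^{th}$ coronas $(P,\mathcal{C}_k(P))$, $(P',\mathcal{C}_k(P'))$ are isomorphic if there is an isomorphism of complexes $\alpha:\mathcal{C}_k(P)\to\mathcal{C}_k(P')$ with $\alpha(P)=P'$. $\Gamma(\mathcal{C}_k(P))$ is the group of automorphisms of the complex $\mathcal{C}_k(P)$ that fix $P$. $N_k(\mathcal{T})$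 is the number of isomorphism classes of centered $k^{th}$ coronas of tiles of $\mathcal{T}$. Given $k$ with $N_k(\mathcal{T})<\infty$, choose tiles $P_1,\dots,P_{N_k}$ whose centered $k^{th}$ coronas represent all isomorphism classes, and for $j\le k$ set $\Gamma^i_j := \Gamma(\mathcal{C}_j(P_i))$ (up to isomorphism independent of the choice of representative; equality $\Gamma^i_{k-1}=\Gamma^i_k$ means $\Gamma(\mathcal{C}_{k-1}(P_i))=\Gamma(\mathcal{C}_k(P_i))$, where restriction identifies $\Gamma(\mathcal{C}_k(P_i))$ with a subgroup of $\Gamma(\mathcal{C}_{k-1}(P_i))$). *)

theory Defs
  imports "HOL-Analysis.Analysis"
begin

definition tiling :: "'a::euclidean_space set set \<Rightarrow> bool" where
  "tiling T \<longleftrightarrow> countable T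
     \<and> (\<forall>P\<in>T. polytope P \<and> aff_dim P = int DIM('a))
     \<and> \<Union>T = UNIV
     \<and> (\<forall>P\<in>T. \<forall>Q\<in>T. P \<noteq> Q \<longrightarrow> interior P \<inter> interior Q = {})"

definition locally_finite_tiling :: "'a::euclidean_space set set \<Rightarrow> bool" where
  "locally_finite_tiling T \<longleftrightarrow>
     (\<forall>x. \<exists>U. open U \<and> x \<in> U \<and> finite {P\<in>T. P \<inter> U \<noteq> {}})"

definition face_to_face :: "'a::euclidean_space set set \<Rightarrow> bool" where
  "face_to_face T \<longleftrightarrow> (\<forall>P\<in>T. \<forall>Q\<in>T. (P \<inter> Q) face_of P \<and> (P \<inter> Q) face_of Q)"

text \<open>All faces of all tiles (including the empty face). The adjoined top element
  is fixed by every automorphism, so it is omitted.\<close>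
definition faces :: "'a::euclidean_space set set \<Rightarrow> 'a set set" where
  "faces T = {F. \<exists>P\<in>T. F face_of P}"

definition order_iso :: "'a set set \<Rightarrow> 'b set set \<Rightarrow> ('a set \<Rightarrow> 'b set) \<Rightarrow> bool" where
  "order_iso A B f \<longleftrightarrow> bij_betw f A B \<and> (\<forall>F\<in>A. \<forall>G\<in>A. F \<subseteq> G \<longleftrightarrow> f F \<subseteq> f G)"

definition comb_aut :: "'a::euclidean_space set set \<Rightarrow> ('a set \<Rightarrow> 'a set) set" where
  "comb_aut T = {\<phi> \<in> extensional (faces T). order_iso (faces T) (faces T) \<phi>}"

definition tile_stabilizer :: "'a::euclidean_space set set \<Rightarrow> 'a set \<Rightarrow> ('a set \<Rightarrow> 'a set) set" where
  "tile_stabilizer T P = {\<phi> \<in> comb_aut T. \<phi> P = P}"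

definition tile_orbit_rel :: "'a::euclidean_space set set \<Rightarrow> ('a set \<times> 'a set) set" where
  "tile_orbit_rel T = {(P, Q). P \<in> T \<and> Q \<in> T \<and> (\<exists>\<phi>\<in>comb_aut T. \<phi> P = Q)}"

definition comb_multihedral :: "'a::euclidean_space set set \<Rightarrow> bool" where
  "comb_multihedral T \<longleftrightarrow> finite (T // tile_orbit_rel T)"

definition num_tile_orbits :: "'a::euclidean_space set set \<Rightarrow> nat" where
  "num_tile_orbits T = card (T // tile_orbit_rel T)"

definition comb_tile_transitive :: "'a::euclidean_space set set \<Rightarrow> nat \<Rightarrow> bool" where
  "comb_tile_transitive T n \<longleftrightarrow> comb_multihedral T \<and> num_tile_orbits T = n"

definition adj_rel :: "'a::euclidean_space set set \<Rightarrow> ('a set \<times> 'a set) set" where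
  "adj_rel T = {(P, Q). P \<in> T \<and> Q \<in> T \<and> (P \<inter> Q) face_of P \<and> (P \<inter> Q) face_of Q
                  \<and> aff_dim (P \<inter> Q) \<ge> int DIM('a) - 2}"

text \<open>Since adjacency is reflexive on tiles, d(P,Q) \<le> k iff (P,Q) \<in> adj_rel T ^^ k.
  The k-th corona: all tiles within distance k, with all their faces.\<close>
definition corona :: "'a::euclidean_space set set \<Rightarrow> nat \<Rightarrow> 'a set \<Rightarrow> 'a set set" where
  "corona T k P = {F. \<exists>Q. (P, Q) \<in> adj_rel T ^^ k \<and> F face_of Q}"

definition corona_aut :: "'a::euclidean_space set set \<Rightarrow> nat \<Rightarrow> 'a set \<Rightarrow> ('a set \<Rightarrow> 'a set) set" where
  "corona_aut T k P = {\<alpha> \<in> extensional (corona T k P).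
       order_iso (corona T k P) (corona T k P) \<alpha> \<and> \<alpha> P = P}"

definition corona_iso_rel :: "'a::euclidean_space set set \<Rightarrow> nat \<Rightarrow> ('a set \<times> 'a set) set" where
  "corona_iso_rel T k = {(P, P'). P \<in> T \<and> P' \<in> T \<and>
       (\<exists>\<alpha>. order_iso (corona T k P) (corona T k P') \<alpha> \<and> \<alpha> P = P')}"

definition corona_classes :: "'a::euclidean_space set set \<Rightarrow> nat \<Rightarrow> 'a set set set" where
  "corona_classes T k = T // corona_iso_rel T k"

definition N_coronas :: "'a::euclidean_space set set \<Rightarrow> nat \<Rightarrow> nat" where
  "N_coronas T k = card (corona_classes T k)"

definition cond1 :: "'a::euclidean_space set set \<Rightarrow> nat \<Rightarrow> bool" where
  "cond1 T k \<longleftrightarrow> finite (corona_classes T k) \<and> N_coronas T (k - 1) = N_coronas T k"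

text \<open>Condition (2): Gamma(C_{k-1}(P)) = Gamma(C_k(P)) via restriction, for every tile P
  (equivalently for every representative P_i, the groups being independent of the
  chosen representative up to isomorphism).\<close>
definition cond2 :: "'a::euclidean_space set set \<Rightarrow> nat \<Rightarrow> bool" where
  "cond2 T k \<longleftrightarrow> (\<forall>P\<in>T. bij_betw (\<lambda>\<alpha>. restrict \<alpha> (corona T (k - 1) P))
                                   (corona_aut T k P) (corona_aut T (k - 1) P))"

end

theory Submission
  imports Defs
begin

text \<open>
  If (1) and (2) hold for \<open>k\<close>, every centered isomorphism of \<open>(k-1)\<close>-st coronas extends uniquely to the
  \<open>k\<close>-th coronas. An isomorphism of \<open>k\<close>-th coronas at a tile therefore continues to each adjacent tile, and
  the issue is path independence. All tiles at a point off the faces of dimension at most \<open>d - 3\<close> are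
  pairwise adjacent, and around such a point continuation is consistent because an isomorphism of
  polytopes is determined by its restriction to one facet. Continue along straight segments from an
  interior point of the initial tile that avoid these low-dimensional faces: the result is locally constant
  in the end point, hence constant on each tile, because the shadow of the low-dimensional faces has
  codimension at least two. The continued isomorphisms glue to a combinatorial automorphism, whose
  inverse arises in the same way from the inverse isomorphism.

  Conversely, if there are finitely many orbits, the number of corona classes is bounded and
  non-decreasing, while the finite groups of the coronas decrease, so both stabilize simultaneously.
\<close>

section \<open>Finite unions of affine subspaces and convex sets\<close>

text \<open>Condition (1) only yields some isomorphism between the \<open>k\<close>-th coronas of
  tiles whose \<open>(k-1)\<close>-st coronas are isomorphic; condition (2) corrects it by an
  automorphism until it extends the prescribed one. Moving the centre to an adjacent tile costs one
  corona level, and the extension restores it, so continuation never runs out. The bound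
  \<open>d - 2\<close> in the adjacency is what removes holonomy: all tiles around a face of
  dimension \<open>d - 2\<close> lie in a single corona, so one isomorphism controls a full turn
  around that face. Smaller faces need no control because paths can avoid them. No homotopies are
  used; the topology is reduced to the fact that finitely many sets of codimension two do not
  disconnect a convex set. A map glued from local pieces is known to be injective only across
  facets, and distant tiles might a priori be identified. Hence the inverse has to be continued as
  well, and uniqueness of continuation is proved for maps that are isomorphisms only
  locally.\<close>

lemma convex_subset_Union_affine:
  fixes K :: "'a::real_vector set"
  assumes "finite \<A>" "\<And>A. A \<in> \<A> \<Longrightarrow> affine A" "convex K" "K \<noteq> {}" "K \<subseteq> \<Union>\<A>"
  shows "\<exists>A\<in>\<A>. K \<subseteq> A"
  using assms
proof (induction \<A> rule: finite_induct)
  case empty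
  then show ?case by auto
next
  case (insert A \<B>)
  show ?case
  proof (rule ccontr)
    assume "\<not> ?case"
    then have nA: "\<not> K \<subseteq> A" and nB: "\<not> (\<exists>B\<in>\<B>. K \<subseteq> B)" by auto
    then have "\<not> K \<subseteq> \<Union>\<B>" using insert by blast
    then obtain y where y: "y \<in> K" "y \<notin> \<Union>\<B>" by blast
    with insert.prems have yA: "y \<in> A" by blast
    obtain x where x: "x \<in> K" "x \<notin> A" using nA by blast
    define f where "f t = (1 - t) *\<^sub>R y + t *\<^sub>R x" for t :: real
    have affA: "affine A" using insert.prems by auto
    have inB: "f t \<in> \<Union>\<B>" if "t \<in> {0<..<1}" for t
    proof -
      have "f t \<in> K"
        unfolding f_def using that x y \<open>convex K\<close> by (intro convexD) auto
      moreover have "f t \<notin> A"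
      proof
        assume "f t \<in> A"
        then have "(1 - 1/t) *\<^sub>R y + (1/t) *\<^sub>R f t \<in> A"
          using affA yA unfolding affine_alt by blast
        moreover have "(1 - 1/t) *\<^sub>R y + (1/t) *\<^sub>R f t = x"
        proof -
          have "(1 - 1/t) *\<^sub>R y + (1/t) *\<^sub>R f t = ((1 - 1/t) + (1/t)*(1-t)) *\<^sub>R y + x"
            using that unfolding f_def scaleR_add_right scaleR_add_left scaleR_scaleR by simp
          also have "(1 - 1/t) + (1/t)*(1-t) = 0" using that by (simp add: field_simps)
          finally show ?thesis by simp
        qed
        ultimately show False using x by simp
      qed
      ultimately show ?thesis using insert.prems by auto
    qed
    \<comment> \<open>Pigeonhole: some subspace of \<open>\<B>\<close> contains two points of the
      line through \<open>y\<close> and \<open>x\<close>, hence the whole line, including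
      \<open>y\<close>.\<close>
    have "infinite {0<..<(1::real)}" by (simp add: infinite_Ioo)
    moreover have "{0<..<1} = (\<Union>B\<in>\<B>. {t\<in>{0<..<1}. f t \<in> B})" using inB by blast
    ultimately obtain B where B: "B \<in> \<B>" "infinite {t\<in>{0<..<1}. f t \<in> B}"
      using \<open>finite \<B>\<close> by (metis (no_types, lifting) finite_UN)
    then obtain s t where st: "f s \<in> B" "f t \<in> B" "s - t \<noteq> 0"
    proof -
      obtain s where s: "s \<in> {t\<in>{0<..<1}. f t \<in> B}"
        using infinite_imp_nonempty[OF B(2)] by blast
      obtain t where t: "t \<in> {t\<in>{0<..<1}. f t \<in> B} - {s}"
        using infinite_imp_nonempty[OF infinite_remove[OF B(2), of s]] by blast
      show ?thesis using that[of s t] s t by simp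
    qed
    have "affine B" using insert.prems B by auto
    \<comment> \<open>The weight \<open>s/(s-t)\<close> is where the affine map from parameter
      \<open>s\<close> to parameter \<open>t\<close> takes the value 0, the parameter of
      \<open>y\<close>.\<close>
    then have "(1 - s/(s-t)) *\<^sub>R f s + (s/(s-t)) *\<^sub>R f t \<in> B"
      using st unfolding affine_alt by blast
    moreover have "(1 - s/(s-t)) *\<^sub>R f s + (s/(s-t)) *\<^sub>R f t = y"
    proof -
      have "(1 - s/(s-t)) *\<^sub>R f s + (s/(s-t)) *\<^sub>R f t
          = ((1 - s/(s-t)) * (1-s) + (s/(s-t)) * (1-t)) *\<^sub>R y
            + ((1 - s/(s-t)) * s + (s/(s-t)) * t) *\<^sub>R x"
        unfolding f_def scaleR_add_right scaleR_add_left scaleR_scaleR by (simp only: ac_simps)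
      also have "(1 - s/(s-t)) * (1-s) + (s/(s-t)) * (1-t) = 1 - s + s/(s-t) * (s-t)"
        by algebra
      also have "(1 - s/(s-t)) * s + (s/(s-t)) * t = s - s/(s-t) * (s-t)"
        by algebra
      also have "s/(s-t) * (s-t) = s" using st(3) by simp
      finally show ?thesis by simp
    qed
    ultimately show False using y B by auto
  qed
qed

lemma convex_point_off_affine_hulls:
  fixes K :: "'a::euclidean_space set"
  assumes "finite \<A>" "convex K" "K \<noteq> {}" "\<And>A. A \<in> \<A> \<Longrightarrow> aff_dim A < aff_dim K"
  obtains z where "z \<in> K" "\<And>A. A \<in> \<A> \<Longrightarrow> z \<notin> affine hull A"
proof -
  have "\<not> K \<subseteq> \<Union>((hull) affine ` \<A>)"
  proof
    assume "K \<subseteq> \<Union>((hull) affine ` \<A>)"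
    then obtain A where "A \<in> \<A>" "K \<subseteq> affine hull A"
      using convex_subset_Union_affine[of "(hull) affine ` \<A>" K] assms(1-3)
      by (metis (mono_tags, lifting) Setcompr_eq_image \<open>K \<noteq> {}\<close> affine_affine_hull finite_imageI image_iff)
    then have "aff_dim K \<le> aff_dim A" by (metis aff_dim_affine_hull aff_dim_subset)
    then show False using assms(4)[OF \<open>A \<in> \<A>\<close>] by simp
  qed
  then show ?thesis using that by blast
qed

lemma aff_dim_insert_le: "aff_dim (insert x S) \<le> aff_dim S + 1"
  for S :: "'a::euclidean_space set"
  by (simp add: aff_dim_insert)

text \<open>Seen from \<open>v\<close>, the set \<open>A\<close> casts a shadow of at most one
  dimension more. Every general position argument below counts dimensions with this fact.\<close>

lemma segment_end_in_affine_hull: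
  assumes "w \<in> closed_segment v z" "w \<in> A" "v \<notin> A"
  shows "z \<in> affine hull (insert v A)"
proof -
  obtain t where t: "w = (1 - t) *\<^sub>R v + t *\<^sub>R z" using assms(1) by (auto simp: in_segment)
  have "t \<noteq> 0" using t assms(2,3) by auto
  have "(1 - 1/t) *\<^sub>R v + (1/t) *\<^sub>R w = ((1 - 1/t) + (1/t) * (1 - t)) *\<^sub>R v + ((1/t) * t) *\<^sub>R z"
    unfolding t scaleR_add_right scaleR_add_left scaleR_scaleR by simp
  also have "(1 - 1/t) + (1/t) * (1 - t) = 0" using \<open>t \<noteq> 0\<close> by (simp add: field_simps)
  finally have "z = (1 - 1/t) *\<^sub>R v + (1/t) *\<^sub>R w" using \<open>t \<noteq> 0\<close> by simp
  also have "\<dots> \<in> affine hull (insert v A)"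
    using assms(2) by (intro mem_affine[OF affine_affine_hull]) (auto intro: hull_inc)
  finally show ?thesis .
qed

text \<open>Codimension two leaves room for the shadows: those of the sets in \<open>\<A>\<close>,
  seen from \<open>x\<close> and from \<open>y\<close>, have dimension below that of
  \<open>K\<close>, and any \<open>z\<close> off their affine hulls is reached from both points
  without obstruction.\<close>

lemma two_segments_avoiding:
  fixes K :: "'a::euclidean_space set"
  assumes "finite \<A>" "convex K" "x \<in> K" "y \<in> K" "x \<notin> \<Union>\<A>" "y \<notin> \<Union>\<A>"
    and dim: "\<And>A. A \<in> \<A> \<Longrightarrow> aff_dim A + 2 \<le> aff_dim K"
  obtains z where "z \<in> K" "(closed_segment x z \<union> closed_segment z y) \<inter> \<Union>\<A> = {}"
proof -
  obtain z where z: "z \<in> K" "\<And>A. A \<in> insert x ` \<A> \<union> insert y ` \<A> \<Longrightarrow> z \<notin> affine hull A"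
  proof (rule convex_point_off_affine_hulls[of "insert x ` \<A> \<union> insert y ` \<A>" K])
    show "aff_dim A < aff_dim K" if "A \<in> insert x ` \<A> \<union> insert y ` \<A>" for A
    proof -
      from that obtain B v where B: "B \<in> \<A>" "A = insert v B" by blast
      have "aff_dim (insert v B) \<le> aff_dim B + 1" by (rule aff_dim_insert_le)
      with dim[OF B(1)] B(2) show ?thesis by simp
    qed
  qed (use assms in auto)
  have "(closed_segment x z \<union> closed_segment z y) \<inter> \<Union>\<A> = {}"
  proof -
    have "w \<notin> A" if "A \<in> \<A>" "w \<in> closed_segment x z \<union> closed_segment z y" for w A
    proof (cases "w \<in> closed_segment x z")
      case True
      then show ?thesis using segment_end_in_affine_hull[of w x z A] z(2)[of "insert x A"] that(1) assms(5) by blast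
    next
      case False
      then have "w \<in> closed_segment y z" using that(2) by (simp add: closed_segment_commute)
      then show ?thesis using segment_end_in_affine_hull[of w y z A] z(2)[of "insert y A"] that(1) assms(6) by blast
    qed
    then show ?thesis by (meson UnionE disjoint_iff)
  qed
  then show ?thesis by (rule that[OF z(1)])
qed

text \<open>The sets reachable from \<open>i\<close> and the remaining ones would otherwise split
  \<open>L\<close> into two disjoint closed pieces. This converts a path avoiding small faces into a
  chain of neighbouring facets or tiles.\<close>

lemma connected_closed_cover_chain:
  assumes "connected L" "finite I" "\<And>i. i \<in> I \<Longrightarrow> closed (C i)" "L \<subseteq> (\<Union>i\<in>I. C i)"
    and "i \<in> I" "j \<in> I" "C i \<inter> L \<noteq> {}" "C j \<inter> L \<noteq> {}"
    and E: "\<And>i j. i \<in> I \<Longrightarrow> j \<in> I \<Longrightarrow> C i \<inter> C j \<inter> L \<noteq> {} \<Longrightarrow> E i j"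
  shows "(i, j) \<in> {(i, j). i \<in> I \<and> j \<in> I \<and> E i j}\<^sup>*"
proof (rule ccontr)
  let ?R = "{(i, j). i \<in> I \<and> j \<in> I \<and> E i j}"
  assume non: "(i, j) \<notin> ?R\<^sup>*"
  define X where "X = {k\<in>I. (i, k) \<in> ?R\<^sup>*}"
  have "X \<subseteq> I" by (auto simp: X_def)
  then have fin: "finite X" "finite (I - X)" using \<open>finite I\<close> finite_subset by auto
  have cl: "closed (\<Union>k\<in>X. C k)" "closed (\<Union>k\<in>I-X. C k)"
    using fin \<open>X \<subseteq> I\<close> assms(3) by (auto intro!: closed_UN)
  have "C k \<inter> C l \<inter> L = {}" if "k \<in> X" "l \<in> I - X" for k l
  proof (rule ccontr)
    assume "C k \<inter> C l \<inter> L \<noteq> {}"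
    then have "(k, l) \<in> ?R" using E that by (auto simp: X_def)
    then show False using that unfolding X_def by (auto dest: rtrancl_into_rtrancl)
  qed
  then have "(\<Union>k\<in>X. C k) \<inter> (\<Union>k\<in>I-X. C k) \<inter> L = {}" by blast
  moreover have "L \<subseteq> (\<Union>k\<in>X. C k) \<union> (\<Union>k\<in>I-X. C k)" using assms(4) by blast
  moreover have "i \<in> X" "j \<in> I - X" using assms non by (auto simp: X_def)
  then have "(\<Union>k\<in>X. C k) \<inter> L \<noteq> {}" "(\<Union>k\<in>I-X. C k) \<inter> L \<noteq> {}" using assms(7,8) by blast+
  ultimately show False
    using connected_closedD[OF \<open>connected L\<close> _ _ cl] by metis
qed

lemma connected_induction_balls:
  fixes K :: "'a::metric_space set"
  assumes "connected K" "a \<in> K" "b \<in> K" "P a"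
    and local: "\<And>y. y \<in> K \<Longrightarrow> \<exists>\<epsilon>>0. \<forall>x\<in>K \<inter> ball y \<epsilon>. \<forall>z\<in>K \<inter> ball y \<epsilon>. P x \<longrightarrow> P z"
  shows "P b"
proof (rule connected_induction_simple[where P = P, OF assms(1-4)])
  fix y assume "y \<in> K"
  then obtain \<epsilon> where "\<epsilon> > 0" "\<forall>x\<in>K \<inter> ball y \<epsilon>. \<forall>z\<in>K \<inter> ball y \<epsilon>. P x \<longrightarrow> P z"
    using local by blast
  then show "\<exists>N. openin (top_of_set K) N \<and> y \<in> N \<and> (\<forall>x\<in>N. \<forall>z\<in>N. P x \<longrightarrow> P z)"
    using \<open>y \<in> K\<close> by (intro exI[of _ "K \<inter> ball y \<epsilon>"]) (simp add: openin_open_Int)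
qed

lemma rel_interior_add_scaled:
  fixes E :: "'a::euclidean_space set"
  assumes "x \<in> rel_interior E" "x + h \<in> affine hull E"
  obtains \<delta> where "\<delta> > 0" "\<And>s. \<bar>s\<bar> \<le> \<delta> \<Longrightarrow> x + s *\<^sub>R h \<in> E"
proof -
  obtain e where e: "e > 0" "ball x e \<inter> affine hull E \<subseteq> E"
    using assms(1) by (auto simp: mem_rel_interior_ball)
  have xE: "x \<in> affine hull E" using assms(1) by (meson hull_inc rel_interior_subset subsetD)
  have "x + s *\<^sub>R h \<in> E" if "\<bar>s\<bar> \<le> e / (norm h + 1)" for s
  proof -
    have pos: "0 < norm h + 1" by (simp add: add_nonneg_pos)
    then have "\<bar>s\<bar> * (norm h + 1) \<le> e" using that by (simp add: pos_le_divide_eq)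
    then have "\<bar>s\<bar> * norm h < e"
      using e(1) by (cases "s = 0") (auto simp: algebra_simps)
    then have "x + s *\<^sub>R h \<in> ball x e" by (simp add: dist_norm)
    moreover have "(1 - s) *\<^sub>R x + s *\<^sub>R (x + h) \<in> affine hull E"
      using xE assms(2) affine_affine_hull unfolding affine_alt by blast
    then have "x + s *\<^sub>R h \<in> affine hull E" by (simp add: algebra_simps)
    ultimately show ?thesis using e by blast
  qed
  moreover have "e / (norm h + 1) > 0"
    using e by (simp add: add_nonneg_pos)
  ultimately show ?thesis using that by blast
qed

section \<open>Ridges and facets of polytopes\<close>

text \<open>The number \<open>u\<close> is a coordinate transverse to \<open>S\<close>, measured
  from \<open>x\<close>. A direction \<open>h\<close> of \<open>affine hull S\<close> is encoded by
  the membership of \<open>x + h\<close>.\<close>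

lemma affine_hull_insert_decompose:
  fixes S :: "'a::real_vector set"
  assumes "z \<in> affine hull (insert a S)" "x \<in> affine hull S"
  obtains u h where "x + h \<in> affine hull S" "z = x + u *\<^sub>R (a - x) + h"
proof -
  let ?M = "{x + u *\<^sub>R (a - x) + h | u h. x + h \<in> affine hull S}"
  have "affine ?M"
  proof (rule iffD2[OF affine_alt], intro ballI allI)
    fix p q :: 'a and t :: real
    assume "p \<in> ?M" "q \<in> ?M"
    then obtain u h v k where p: "p = x + u *\<^sub>R (a - x) + h" "x + h \<in> affine hull S"
      and q: "q = x + v *\<^sub>R (a - x) + k" "x + k \<in> affine hull S" by blast
    have "(1 - t) *\<^sub>R (x + h) + t *\<^sub>R (x + k) \<in> affine hull S"
      using p q by (intro mem_affine[OF affine_affine_hull]) auto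
    moreover have "(1 - t) *\<^sub>R (x + h) + t *\<^sub>R (x + k) = x + ((1 - t) *\<^sub>R h + t *\<^sub>R k)"
      by (simp add: algebra_simps)
    moreover have "(1 - t) *\<^sub>R p + t *\<^sub>R q
        = x + ((1 - t) * u + t * v) *\<^sub>R (a - x) + ((1 - t) *\<^sub>R h + t *\<^sub>R k)"
      unfolding p q by (simp add: algebra_simps)
    ultimately show "(1 - t) *\<^sub>R p + t *\<^sub>R q \<in> ?M" by force
  qed
  moreover have "insert a S \<subseteq> ?M"
  proof
    fix y assume "y \<in> insert a S"
    then consider "y = a" | "y \<in> S" by blast
    then show "y \<in> ?M"
    proof cases
      case 1
      then have "y = x + 1 *\<^sub>R (a - x) + 0" by simp
      moreover have "x + 0 \<in> affine hull S" using assms by simp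
      ultimately show ?thesis by blast
    next
      case 2
      then have "y = x + 0 *\<^sub>R (a - x) + (y - x)" "x + (y - x) \<in> affine hull S"
        by (simp_all add: hull_inc)
      then show ?thesis by blast
    qed
  qed
  ultimately have "affine hull (insert a S) \<subseteq> ?M" by (simp add: hull_minimal)
  then show ?thesis using assms(1) that by blast
qed

text \<open>Scaled by a small factor, the identity describes one point \<open>y\<close> near
  \<open>x\<close> in two ways: it lies on the segment from \<open>x\<close> to \<open>g\<close>,
  hence in \<open>G\<close>, and it is a convex combination of points of \<open>Q\<close> with
  positive weight on \<open>a\<close>. The face property then forces \<open>a\<close> into
  \<open>G\<close>. Since \<open>x\<close> is relatively interior to \<open>E\<close>, the shift by
  \<open>h\<close> stays within \<open>E\<close>.\<close>

lemma face_contains_cone_generator: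
  fixes Q :: "'a::euclidean_space set"
  assumes "convex Q" "G face_of Q" "x \<in> rel_interior E" "E \<subseteq> G"
    and "a \<in> Q" "b \<in> Q" "g \<in> G" "s > 0" "t \<ge> 0" "u \<ge> 0"
    and h: "x + h \<in> affine hull E"
    and eq: "s *\<^sub>R (a - x) + t *\<^sub>R (b - x) + h = u *\<^sub>R (g - x)"
  shows "a \<in> G"
proof -
  obtain \<delta> where \<delta>: "\<delta> > 0" "\<And>r. \<bar>r\<bar> \<le> \<delta> \<Longrightarrow> x + r *\<^sub>R h \<in> E"
    using rel_interior_add_scaled[OF assms(3) h] by blast
  have xG: "x \<in> G" using assms rel_interior_subset by blast
  have GQ: "G \<subseteq> Q" and cG: "convex G" using assms face_of_imp_subset face_of_imp_convex by blast+
  obtain d where d: "d = 2 / \<delta>" "d > 0" using \<delta> by simp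
  \<comment> \<open>Large enough for three bounds on \<open>\<epsilon> = 1/m\<close>: the weight
    \<open>r\<close> left for \<open>x\<close> exceeds 1/2, the point \<open>y\<close> lies between
    \<open>x\<close> and \<open>g\<close>, and \<open>\<epsilon>/r\<close> stays below
    \<open>\<delta>\<close>.\<close>
  define m where "m = 1 + 2 * (s + t) + u + d"
  have m: "m > d" "m > 2 * (s + t)" "m > u" "m > 0"
    unfolding m_def using assms(8-10) d(2) by simp_all
  then have "m > 2 / \<delta>" using d by simp
  define \<epsilon> where "\<epsilon> = 1 / m"
  have \<epsilon>: "\<epsilon> > 0" "\<epsilon> * (s + t) < 1/2" "\<epsilon> * u < 1" "2 * \<epsilon> < \<delta>"
    using m \<open>m > 2 / \<delta>\<close> \<delta>(1) by (simp_all add: \<epsilon>_def field_simps)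
  define r where "r = 1 - \<epsilon> * (s + t)"
  have r: "r > 1/2" using \<epsilon> by (simp add: r_def)
  have et: "0 \<le> \<epsilon> * t" "0 < \<epsilon> * s" "0 \<le> \<epsilon> * u" using \<epsilon>(1) assms(8-10) by simp_all
  then have es: "\<epsilon> * s < 1" using \<epsilon>(2) by (simp add: distrib_left)
  define k where "k = x + (\<epsilon> / r) *\<^sub>R h"
  have "\<epsilon> / r \<le> \<epsilon> / (1/2)" using r \<epsilon>(1) by (intro divide_left_mono) auto
  then have "k \<in> E" unfolding k_def using \<epsilon> r by (intro \<delta>(2)) simp
  then have kQ: "k \<in> Q" using assms(4) GQ by blast
  define y where "y = (1 - \<epsilon> * u) *\<^sub>R x + (\<epsilon> * u) *\<^sub>R g"
  have yG: "y \<in> G" unfolding y_def using cG xG assms(7) \<epsilon>(3) et(3) by (simp add: convexD)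
  define w where "w = (r / (1 - \<epsilon> * s)) *\<^sub>R k + (\<epsilon> * t / (1 - \<epsilon> * s)) *\<^sub>R b"
  have "r / (1 - \<epsilon> * s) + \<epsilon> * t / (1 - \<epsilon> * s) = (r + \<epsilon> * t) / (1 - \<epsilon> * s)"
    by (simp add: add_divide_distrib)
  also have "r + \<epsilon> * t = 1 - \<epsilon> * s" by (simp add: r_def distrib_left)
  finally have "r / (1 - \<epsilon> * s) + \<epsilon> * t / (1 - \<epsilon> * s) = 1" using es by simp
  then have wQ: "w \<in> Q"
    unfolding w_def using r es et by (intro convexD[OF \<open>convex Q\<close> kQ \<open>b \<in> Q\<close>]) auto
  have "y = x + \<epsilon> *\<^sub>R (u *\<^sub>R (g - x))" by (simp add: y_def algebra_simps)
  also have "\<dots> = x + \<epsilon> *\<^sub>R (s *\<^sub>R (a - x) + t *\<^sub>R (b - x) + h)" by (simp only: eq)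
  also have "\<dots> = r *\<^sub>R x + \<epsilon> *\<^sub>R h + (\<epsilon> * t) *\<^sub>R b + (\<epsilon> * s) *\<^sub>R a"
    by (simp add: r_def algebra_simps)
  also have "r *\<^sub>R x + \<epsilon> *\<^sub>R h = r *\<^sub>R k" using r by (simp add: k_def scaleR_add_right)
  also have "r *\<^sub>R k + (\<epsilon> * t) *\<^sub>R b = (1 - \<epsilon> * s) *\<^sub>R w" using es by (simp add: w_def scaleR_add_right)
  finally have y: "y = (1 - \<epsilon> * s) *\<^sub>R w + (\<epsilon> * s) *\<^sub>R a" .
  show ?thesis
  proof (cases "w = a")
    case True
    then show ?thesis using y yG by (simp add: algebra_simps)
  next
    case False
    then have "y \<in> open_segment w a" using y es et by (auto simp: in_segment)
    then show ?thesis using face_ofD[OF assms(2) _ wQ \<open>a \<in> Q\<close> yG] by blast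
  qed
qed

lemma face_subset_eq_if_aff_dim_eq:
  fixes Q :: "'a::euclidean_space set"
  assumes "convex Q" "F face_of Q" "G face_of Q" "F \<subseteq> G" "aff_dim F = aff_dim G"
  shows "F = G"
proof (rule ccontr)
  assume "F \<noteq> G"
  have "F face_of G" using assms face_of_subset face_of_imp_subset by blast
  then have "aff_dim F < aff_dim G"
    using face_of_aff_dim_lt[of G F] assms(3) \<open>F \<noteq> G\<close> face_of_imp_convex by blast
  with assms(5) show False by simp
qed

lemma ridge_in_at_most_two_facets:
  fixes Q :: "'a::euclidean_space set"
  assumes "convex Q" "E face_of Q" "E \<noteq> {}" "aff_dim E = aff_dim Q - 2"
    and F: "F1 face_of Q" "F2 face_of Q" "F3 face_of Q"
    and dimF: "aff_dim F1 = aff_dim Q - 1" "aff_dim F2 = aff_dim Q - 1" "aff_dim F3 = aff_dim Q - 1"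
    and EF: "E \<subseteq> F1" "E \<subseteq> F2" "E \<subseteq> F3"
  shows "F1 = F2 \<or> F1 = F3 \<or> F2 = F3"
proof -
  have conv: "convex F1" "convex F2" "convex F3" "convex E" using F assms(2) face_of_imp_convex by blast+
  have FQ: "F1 \<subseteq> Q" "F2 \<subseteq> Q" "F3 \<subseteq> Q" using F face_of_imp_subset by blast+
  have ne: "F1 \<noteq> {}" "F2 \<noteq> {}" "F3 \<noteq> {}" using EF assms(3) by auto
  obtain x where x: "x \<in> rel_interior E" using conv(4) assms(3) rel_interior_eq_empty by blast
  obtain c1 where c1: "c1 \<in> rel_interior F1" using conv ne rel_interior_eq_empty by blast
  obtain c2 where c2: "c2 \<in> rel_interior F2" using conv ne rel_interior_eq_empty by blast
  obtain c3 where c3: "c3 \<in> rel_interior F3" using conv ne rel_interior_eq_empty by blast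
  have cF: "c1 \<in> F1" "c2 \<in> F2" "c3 \<in> F3" using c1 c2 c3 rel_interior_subset by blast+
  then have cQ: "c1 \<in> Q" "c2 \<in> Q" "c3 \<in> Q" using FQ by blast+
  have xE: "x \<in> E" using x rel_interior_subset by blast
  have sub: "F \<subseteq> G" if "c \<in> rel_interior F" "c \<in> G" "G face_of Q" "F \<subseteq> Q" for c F G
    by (rule subset_of_face_of[OF that(3,4)]) (use that in auto)
  have eqI: "F = G" if "c \<in> rel_interior F" "c \<in> G" "G face_of Q" "F face_of Q"
    "aff_dim F = aff_dim Q - 1" "aff_dim G = aff_dim Q - 1" for c F G
    using face_subset_eq_if_aff_dim_eq[OF assms(1), of F G] sub[of c F G] that face_of_imp_subset[of F Q] by simp
  have notE: "c \<notin> E" if "c \<in> rel_interior F" "F face_of Q" "aff_dim F = aff_dim Q - 1" for c F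
  proof
    assume "c \<in> E"
    then have "F \<subseteq> E" using sub[of c F E] that assms(2) face_of_imp_subset[of F Q] by blast
    then have "aff_dim F \<le> aff_dim E" by (rule aff_dim_subset)
    then show False using that(3) assms(4) by simp
  qed
  have E_eq: "E = affine hull E \<inter> Q" by (rule face_of_imp_eq_affine_Int[OF assms(1,2)])
  have F1_eq: "F1 = affine hull F1 \<inter> Q" by (rule face_of_imp_eq_affine_Int[OF assms(1) F(1)])
  have xa: "x \<in> affine hull E" using xE by (rule hull_inc)
  \<comment> \<open>Modulo directions of the ridge, \<open>c3 - x\<close> is a combination of \<open>c1 - x\<close> and \<open>c2 - x\<close>. For every sign pattern
    of the coefficients some facet, or the ridge itself, contains a relative interior point of another facet.\<close>
  show ?thesis
  proof (cases "F1 = F2")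
    case False
    have "c1 \<notin> affine hull E" using notE[OF c1 F(1) dimF(1)] E_eq cQ by blast
    then have "aff_dim (insert c1 E) = aff_dim F1" using assms(4) dimF by (simp add: aff_dim_insert)
    then have h1: "affine hull (insert c1 E) = affine hull F1"
      by (intro affine_dim_equal) (use EF cF in \<open>auto intro!: hull_mono\<close>)
    have "c2 \<notin> F1" using eqI[of c2 F2 F1] c2 F dimF False by blast
    then have "c2 \<notin> affine hull (insert c1 E)" using h1 F1_eq cQ by blast
    then have "aff_dim (insert c2 (insert c1 E)) = aff_dim Q"
      using \<open>aff_dim (insert c1 E) = aff_dim F1\<close> dimF by (simp add: aff_dim_insert)
    then have h2: "affine hull (insert c2 (insert c1 E)) = affine hull Q"
      by (intro affine_dim_equal) (use EF FQ cQ in \<open>auto intro!: hull_mono\<close>)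
    then have "c3 \<in> affine hull (insert c2 (insert c1 E))" using cQ by (simp add: hull_inc)
    moreover have "x \<in> affine hull (insert c1 E)" using xE by (simp add: hull_inc)
    ultimately obtain v k where vk: "x + k \<in> affine hull (insert c1 E)" "c3 = x + v *\<^sub>R (c2 - x) + k"
      by (rule affine_hull_insert_decompose)
    obtain u h where uh: "x + h \<in> affine hull E" "x + k = x + u *\<^sub>R (c1 - x) + h"
      using affine_hull_insert_decompose[OF vk(1) xa] by blast
    have "k = u *\<^sub>R (c1 - x) + h" using uh(2) by (simp only: add.assoc add_left_cancel)
    then have eq: "c3 - x = u *\<^sub>R (c1 - x) + v *\<^sub>R (c2 - x) + h" using vk(2) by (simp add: add.commute add.left_commute)
    have mh: "x + - h \<in> affine hull E"
    proof -
      have "(1 - (-1)) *\<^sub>R x + (-1) *\<^sub>R (x + h) \<in> affine hull E"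
        using xa uh(1) by (intro mem_affine[OF affine_affine_hull]) auto
      then show ?thesis by (simp add: algebra_simps scaleR_2)
    qed
    note cone = face_contains_cone_generator[OF assms(1) _ x]
    consider "u > 0" "v \<ge> 0" | "u = 0" "v > 0" | "u = 0" "v = 0" | "u < 0" "v \<ge> 0" | "u \<ge> 0" "v < 0" | "u < 0" "v < 0"
      by linarith
    then show ?thesis
    proof cases
      case 1
      have "c1 \<in> F3"
        by (rule cone[OF F(3) EF(3) cQ(1,2) cF(3), of u v 1 h]) (use 1 eq uh in auto)
      then show ?thesis using eqI[OF c1 _ F(3,1) dimF(1,3)] by simp
    next
      case 2
      have "c2 \<in> F3"
        by (rule cone[OF F(3) EF(3) cQ(2,1) cF(3), of v u 1 h]) (use 2 eq uh in \<open>auto simp: algebra_simps\<close>)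
      then show ?thesis using eqI[OF c2 _ F(3,2) dimF(2,3)] by simp
    next
      case 3
      then have "c3 = x + h" using eq by (simp add: algebra_simps)
      then have "c3 \<in> E" using uh E_eq cQ by blast
      then show ?thesis using notE[OF c3 F(3) dimF(3)] by simp
    next
      case 4
      have "c3 \<in> F2"
        by (rule cone[OF F(2) EF(2) cQ(3,1) cF(2), of 1 "-u" v "-h"]) (use 4 eq mh in \<open>auto simp: algebra_simps\<close>)
      then show ?thesis using eqI[OF c3 _ F(2,3) dimF(3,2)] by simp
    next
      case 5
      have "c3 \<in> F1"
        by (rule cone[OF F(1) EF(1) cQ(3,2) cF(1), of 1 "-v" u "-h"]) (use 5 eq mh in \<open>auto simp: algebra_simps\<close>)
      then show ?thesis using eqI[OF c3 _ F(1,3) dimF(3,1)] by simp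
    next
      case 6
      \<comment> \<open>All three of \<open>c1\<close>, \<open>c2\<close>, \<open>c3\<close> now
        carry positive weights in a relation that sums to a ridge direction. The cone lemma accepts
        two generators, so \<open>c1\<close> and \<open>c3\<close> are merged into one point
        \<open>w\<close> of \<open>Q\<close>.\<close>
      define w where "w = (1 / (1 - u)) *\<^sub>R c3 + (- u / (1 - u)) *\<^sub>R c1"
      have "1 / (1 - u) + - u / (1 - u) = 1" using 6 by (simp add: field_simps)
      then have wQ: "w \<in> Q" unfolding w_def by (intro convexD[OF assms(1) cQ(3,1)]) (use 6 in \<open>auto simp: divide_nonpos_pos\<close>)
      have w: "(1 - u) *\<^sub>R w = c3 - u *\<^sub>R c1" using 6 by (simp add: w_def scaleR_add_right scaleR_diff_right)
      have "(- v) *\<^sub>R (c2 - x) + (1 - u) *\<^sub>R (w - x) + - h = 0 *\<^sub>R (x - x)"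
        unfolding scaleR_diff_right[of "1 - u"] w using eq by (simp add: algebra_simps)
      then have "c2 \<in> E"
        by (intro cone[OF assms(2) order_refl cQ(2) wQ xE, of "-v" "1-u" 0 "-h"]) (use 6 mh in auto)
      then show ?thesis using notE[OF c2 F(2) dimF(2)] by simp
    qed
  qed simp
qed

text \<open>Radial projection from a relatively interior point \<open>c\<close> turns a path in
  \<open>affine hull Q\<close> into a path on the boundary. The cone from \<open>c\<close> over a
  face of dimension at most \<open>aff_dim Q - 3\<close> has codimension at least two, so a path of
  two segments avoids all of them; where it passes between the cones over two facets, these share at
  least a ridge.\<close>

lemma polytope_facets_ridge_connected:
  fixes Q :: "'a::euclidean_space set"
  assumes "polytope Q" "2 \<le> aff_dim Q" "F facet_of Q" "F' facet_of Q"
  shows "(F, F') \<in> {(A, B). A facet_of Q \<and> B facet_of Q \<and> aff_dim Q - 2 \<le> aff_dim (A \<inter> B)}\<^sup>*"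
proof -
  have cQ: "convex Q" "compact Q" "bounded Q" "polyhedron Q" and neQ: "Q \<noteq> {}"
    using assms polytope_imp_convex polytope_imp_compact polytope_imp_bounded
      polytope_imp_polyhedron by auto
  then obtain c where c: "c \<in> rel_interior Q" using rel_interior_eq_empty by blast
  define \<A> where "\<A> = (\<lambda>G. affine hull (insert c G)) ` {G. G face_of Q \<and> aff_dim G \<le> aff_dim Q - 3}"
  have fin\<A>: "finite \<A>"
    unfolding \<A>_def using finite_subset[OF _ finite_polytope_faces[OF assms(1)]] by (intro finite_imageI) auto
  have dim\<A>: "aff_dim A + 2 \<le> aff_dim (affine hull Q)" if A: "A \<in> \<A>" for A
  proof -
    obtain G where G: "G face_of Q" "aff_dim G \<le> aff_dim Q - 3" "A = affine hull (insert c G)"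
      using A by (auto simp: \<A>_def)
    have "aff_dim A \<le> aff_dim G + 1" unfolding G(3) aff_dim_affine_hull by (rule aff_dim_insert_le)
    then show ?thesis using G by simp
  qed
  \<comment> \<open>The empty face contributes the set \<open>{c}\<close>, so the path also misses
    \<open>c\<close> and can be projected. Here dimension at least two enters, as the empty face has
    dimension -1.\<close>
  have oA: "c \<in> \<Union>\<A>"
  proof -
    have "affine hull (insert c {}) \<in> \<A>" unfolding \<A>_def using assms(2) by (intro imageI) auto
    then show ?thesis by auto
  qed
  have pick: "\<exists>y\<in>A. y \<notin> \<Union>\<A>" if "A facet_of Q" for A
  proof -
    have "aff_dim B < aff_dim A" if "B \<in> \<A>" for B
      using dim\<A>[OF that] \<open>A facet_of Q\<close> by (simp add: facet_of_def)
    moreover have "convex A" "A \<noteq> {}" using that face_of_imp_convex by (auto simp: facet_of_def)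
    ultimately obtain y where "y \<in> A" "\<And>B. B \<in> \<A> \<Longrightarrow> y \<notin> affine hull B"
      using convex_point_off_affine_hulls[OF fin\<A>, of A] by blast
    then show ?thesis by (meson UnionE hull_inc)
  qed
  obtain y where y: "y \<in> F" "y \<notin> \<Union>\<A>" using pick[OF assms(3)] by blast
  obtain y' where y': "y' \<in> F'" "y' \<notin> \<Union>\<A>" using pick[OF assms(4)] by blast
  have Q_hull: "A \<subseteq> affine hull Q" if "A facet_of Q" for A
    using facet_of_imp_subset[OF that] hull_subset[of Q affine] by (rule subset_trans)
  have yQ: "y \<in> affine hull Q" "y' \<in> affine hull Q" using Q_hull y y' assms(3,4) by blast+
  obtain z where z: "z \<in> affine hull Q" "(closed_segment y z \<union> closed_segment z y') \<inter> \<Union>\<A> = {}"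
    by (rule two_segments_avoiding[OF fin\<A>, of "affine hull Q" y y'])
       (use dim\<A> y y' yQ in \<open>auto simp: affine_imp_convex\<close>)
  define L where "L = closed_segment y z \<union> closed_segment z y'"
  have L: "connected L" "compact L"
    unfolding L_def by (auto intro!: connected_Un compact_Un)
  have L_hull: "L \<subseteq> affine hull Q"
    unfolding L_def using z(1) yQ
    by (intro Un_least closed_segment_subset affine_imp_convex[OF affine_affine_hull]) auto
  have oL: "w \<noteq> c" if "w \<in> L" for w using that oA z(2) unfolding L_def by blast
  obtain R where R: "\<And>w. w \<in> L \<Longrightarrow> norm (w - c) \<le> R"
  proof -
    have "bounded ((\<lambda>w. w - c) ` L)" using compact_imp_bounded[OF L(2)] bounded_translation_minus by blast
    then show ?thesis using that by (auto simp: bounded_iff)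
  qed
  have "c \<notin> rel_frontier Q" using c by (simp add: rel_frontier_def)
  moreover have "closed (rel_frontier Q)" using closed_rel_frontier by blast
  ultimately obtain m where m: "m > 0" "\<And>v. v \<in> rel_frontier Q \<Longrightarrow> m \<le> dist c v"
    using separate_point_closed[of "rel_frontier Q" c] by metis
  \<comment> \<open>Truncated cones over the facets; near the compact path \<open>L\<close> they agree with the full cones but are closed.\<close>
  define C where "C A = (\<lambda>(t, v). c + t *\<^sub>R (v - c)) ` ({0..R / m} \<times> A)" for A
  have C_mem: "\<exists>v t. v \<in> A \<and> 0 < t \<and> w = c + t *\<^sub>R (v - c)" if w: "w \<in> C A" "w \<in> L" for w A
  proof -
    obtain t v where tv: "v \<in> A" "0 \<le> t" "w = c + t *\<^sub>R (v - c)" using w by (auto simp: C_def)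
    then have "t \<noteq> 0" using oL[OF w(2)] by auto
    then show ?thesis using tv by (intro exI[of _ v] exI[of _ t] conjI) auto
  qed
  \<comment> \<open>A ray from \<open>c\<close> leaves \<open>Q\<close> only once: if
    \<open>v'\<close> in \<open>Q\<close> lay strictly beyond \<open>v\<close>, then
    \<open>v\<close> would be relatively interior.\<close>
  have ray_unique: "s = t" if v: "v \<in> A" "A facet_of Q" "v' \<in> Q" and st: "0 < s" "0 < t" "s \<le> t"
    and eq: "c + s *\<^sub>R (v' - c) = c + t *\<^sub>R (v - c)" for v v' s t A
  proof (rule ccontr)
    assume "s \<noteq> t"
    then have lt: "s / t < 1" "0 < s / t" using st by auto
    have "A face_of Q" "A \<noteq> Q" using v(2) facet_of_imp_face_of by auto
    then have nv: "v \<notin> rel_interior Q" using face_of_disjoint_rel_interior[of A Q] v by blast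
    have e: "t *\<^sub>R (v - c) = s *\<^sub>R (v' - c)" using eq by simp
    have "v - c = (1/t) *\<^sub>R (t *\<^sub>R (v - c))" using st by simp
    also have "\<dots> = (1/t) *\<^sub>R (s *\<^sub>R (v' - c))" by (simp only: e)
    also have "\<dots> = (s / t) *\<^sub>R (v' - c)" by simp
    finally have vv: "v = (1 - s/t) *\<^sub>R c + (s/t) *\<^sub>R v'" by (simp add: algebra_simps)
    have "v' \<noteq> c" using nv vv c by (auto simp: algebra_simps)
    then have "v \<in> open_segment c v'" using vv lt by (auto simp: in_segment)
    then have "v \<in> rel_interior Q"
      using rel_interior_closure_convex_segment[OF cQ(1) c, of v'] v(3) closure_subset by blast
    then show False using nv by blast
  qed
  have "(F, F') \<in> {(A, B). A \<in> {A. A facet_of Q} \<and> B \<in> {A. A facet_of Q}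
           \<and> aff_dim Q - 2 \<le> aff_dim (A \<inter> B)}\<^sup>*"
  proof (rule connected_closed_cover_chain[OF L(1) finite_polytope_facets[OF assms(1)], of C])
    show "closed (C A)" if "A \<in> {A. A facet_of Q}" for A
    proof -
      have "compact A" using that face_of_imp_compact cQ by (auto simp: facet_of_def)
      then show ?thesis unfolding C_def
        by (intro compact_imp_closed compact_continuous_image compact_Times)
           (auto simp: case_prod_unfold intro!: continuous_intros)
    qed
    \<comment> \<open>Boundary points are at distance at least \<open>m\<close> from
      \<open>c\<close> and points of \<open>L\<close> at distance at most \<open>R\<close>, so the
      cone parameter \<open>1 / d\<close> of a point of \<open>L\<close> is at most
      \<open>R / m\<close>.\<close>
    have cover: "w \<in> C A" if "w \<in> L" "v \<in> A" "A facet_of Q" "0 < d" "v = c + d *\<^sub>R (w - c)" for w v A d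
    proof -
      have "v \<in> rel_frontier Q" using that rel_frontier_of_polyhedron[OF cQ(4)] by blast
      then have "m \<le> d * norm (w - c)" using m(2)[of v] that by (simp add: dist_norm)
      also have "\<dots> \<le> d * R" using R[OF that(1)] that by simp
      finally have "1 / d \<le> R / m" using m that by (simp add: field_simps)
      moreover have "w = c + (1/d) *\<^sub>R (v - c)" using that by simp
      ultimately show ?thesis unfolding C_def using that(2,4)
        by (intro image_eqI[of _ _ "(1/d, v)"]) auto
    qed
    show "L \<subseteq> (\<Union>A\<in>{A. A facet_of Q}. C A)"
    proof
      fix w assume w: "w \<in> L"
      obtain d where d: "0 < d" "c + d *\<^sub>R (w - c) \<in> rel_frontier Q"
        by (rule ray_to_rel_frontier[OF cQ(3) c, of "w - c"]) (use w L_hull oL[OF w] in auto)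
      then show "w \<in> (\<Union>A\<in>{A. A facet_of Q}. C A)"
        using rel_frontier_of_polyhedron[OF cQ(4)] cover[OF w] by auto
    qed
    have "y \<in> L" "y' \<in> L" by (auto simp: L_def)
    then show "C F \<inter> L \<noteq> {}" "C F' \<inter> L \<noteq> {}"
      using cover[of y y F 1] cover[of y' y' F' 1] y y' assms by auto
    show "aff_dim Q - 2 \<le> aff_dim (A \<inter> B)"
      if AB: "A \<in> {A. A facet_of Q}" "B \<in> {A. A facet_of Q}" "C A \<inter> C B \<inter> L \<noteq> {}" for A B
    proof -
      obtain w where w: "w \<in> C A" "w \<in> C B" "w \<in> L" using AB by blast
      obtain v s where v: "v \<in> A" "0 < s" "w = c + s *\<^sub>R (v - c)" using C_mem w by blast
      obtain v' t where v': "v' \<in> B" "0 < t" "w = c + t *\<^sub>R (v' - c)" using C_mem w by blast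
      have eq: "c + s *\<^sub>R (v - c) = c + t *\<^sub>R (v' - c)" using v v' by simp
      have "v \<in> Q" "v' \<in> Q" using v v' AB facet_of_imp_subset by blast+
      then have "s = t"
        using ray_unique[of v' B v s t] ray_unique[of v A v' t s] v v' eq AB by (cases "s \<le> t") auto
      then have "v = v'" using eq v(2) by simp
      have fAB: "A \<inter> B face_of Q" using AB by (auto simp: facet_of_def intro: face_of_Int)
      show ?thesis
      proof (rule ccontr)
        assume "\<not> ?thesis"
        then have "affine hull (insert c (A \<inter> B)) \<in> \<A>"
          unfolding \<A>_def using fAB by (intro imageI) auto
        moreover have "(1 - s) *\<^sub>R c + s *\<^sub>R v \<in> affine hull (insert c (A \<inter> B))"
          using v v' \<open>v = v'\<close> by (intro mem_affine[OF affine_affine_hull]) (auto intro: hull_inc)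
        moreover have "(1 - s) *\<^sub>R c + s *\<^sub>R v = w" unfolding v(3) by (simp add: algebra_simps)
        ultimately show False using z(2) w(3) unfolding L_def by blast
      qed
    qed
  qed (use assms in auto)
  then show ?thesis by simp
qed

section \<open>Face lattice isomorphisms\<close>

definition face_lattice :: "'a::euclidean_space set \<Rightarrow> 'a set set" where
  "face_lattice Q = {F. F face_of Q}"

lemma order_iso_mem: "order_iso A B f \<Longrightarrow> X \<in> A \<Longrightarrow> f X \<in> B"
  by (auto simp: order_iso_def bij_betw_def)

lemma order_iso_subset_iff: "order_iso A B f \<Longrightarrow> X \<in> A \<Longrightarrow> Y \<in> A \<Longrightarrow> f X \<subseteq> f Y \<longleftrightarrow> X \<subseteq> Y"
  by (auto simp: order_iso_def)

lemma order_iso_eq_iff: "order_iso A B f \<Longrightarrow> X \<in> A \<Longrightarrow> Y \<in> A \<Longrightarrow> f X = f Y \<longleftrightarrow> X = Y"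
  by (auto simp: order_iso_def bij_betw_def dest: inj_onD)

lemma order_iso_surj: "order_iso A B f \<Longrightarrow> Y \<in> B \<Longrightarrow> \<exists>X\<in>A. f X = Y"
  by (auto simp: order_iso_def bij_betw_def)

lemma order_iso_id: "order_iso A A (\<lambda>X. X)"
  by (auto simp: order_iso_def bij_betw_def)

lemma order_iso_cong:
  assumes "\<And>X. X \<in> A \<Longrightarrow> f X = g X"
  shows "order_iso A B f \<longleftrightarrow> order_iso A B g"
  using assms bij_betw_cong[of A f g B] by (simp add: order_iso_def)

lemma order_iso_comp:
  assumes "order_iso A B f" "order_iso B C g"
  shows "order_iso A C (\<lambda>X. g (f X))"
  using assms bij_betw_trans[of f A B g C] order_iso_mem[OF assms(1)]
  by (auto simp: order_iso_def comp_def)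

lemma order_iso_inv_into:
  assumes "order_iso A B f"
  shows "order_iso B A (inv_into A f)"
proof -
  have bij: "bij_betw f A B" using assms by (simp add: order_iso_def)
  then have inv: "inv_into A f Y \<in> A" "f (inv_into A f Y) = Y" if "Y \<in> B" for Y
    using that by (auto simp: bij_betw_def inv_into_into f_inv_into_f)
  have "Y \<subseteq> Z \<longleftrightarrow> inv_into A f Y \<subseteq> inv_into A f Z" if "Y \<in> B" "Z \<in> B" for Y Z
    using order_iso_subset_iff[OF assms inv(1)[OF that(1)] inv(1)[OF that(2)]]
    by (simp add: inv(2) that)
  then show ?thesis using bij_betw_inv_into[OF bij] by (simp add: order_iso_def)
qed

lemma order_iso_inv_into_eq: "order_iso A B f \<Longrightarrow> X \<in> A \<Longrightarrow> inv_into A f (f X) = X"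
  unfolding order_iso_def using bij_betw_inv_into_left[of f A B X] by blast

lemma order_iso_f_inv_into: "order_iso A B f \<Longrightarrow> Y \<in> B \<Longrightarrow> f (inv_into A f Y) = Y"
  unfolding order_iso_def using bij_betw_inv_into_right[of f A B Y] by blast

lemma order_iso_restrict:
  assumes "order_iso A B f" "A' \<subseteq> A" "f ` A' = B'"
  shows "order_iso A' B' f"
  using assms bij_betw_subset[of f A B A' B'] unfolding order_iso_def by blast

lemma order_iso_face_lattice:
  assumes "order_iso A B f" "X \<in> A"
    and "face_lattice X = {G\<in>A. G \<subseteq> X}" "face_lattice (f X) = {H\<in>B. H \<subseteq> f X}"
  shows "order_iso (face_lattice X) (face_lattice (f X)) f"
proof (rule order_iso_restrict[OF assms(1)])
  show "f ` face_lattice X = face_lattice (f X)"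
  proof
    show "f ` face_lattice X \<subseteq> face_lattice (f X)"
    proof
      fix H assume "H \<in> f ` face_lattice X"
      then obtain G where G: "G \<in> A" "G \<subseteq> X" "H = f G" using assms(3) by auto
      then have "f G \<subseteq> f X" using order_iso_subset_iff[OF assms(1) G(1) assms(2)] by simp
      then show "H \<in> face_lattice (f X)" using order_iso_mem[OF assms(1) G(1)] assms(4) G by simp
    qed
    show "face_lattice (f X) \<subseteq> f ` face_lattice X"
    proof
      fix H assume "H \<in> face_lattice (f X)"
      then have H: "H \<in> B" "H \<subseteq> f X" using assms(4) by auto
      then obtain G where G: "G \<in> A" "f G = H" using order_iso_surj[OF assms(1)] by blast
      then have "G \<subseteq> X" using H order_iso_subset_iff[OF assms(1) G(1) assms(2)] by simp
      then show "H \<in> f ` face_lattice X" using G assms(3) by blast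
    qed
  qed
qed (use assms(3) in auto)

lemma face_lattice_face:
  assumes "G face_of Q"
  shows "face_lattice G = {F \<in> face_lattice Q. F \<subseteq> G}"
  using face_of_face[OF assms] by (auto simp: face_lattice_def)

lemma polytope_maximal_proper_face:
  assumes "polytope G" "G \<noteq> {}"
  obtains H where "H face_of G" "H \<noteq> G" "aff_dim H = aff_dim G - 1"
proof (cases "aff_dim G > 0")
  case True
  then obtain F where "F facet_of G" using polytope_facet_exists[OF assms(1)] by blast
  then show ?thesis using that[of F] facet_of_irrefl[of G] unfolding facet_of_def by metis
next
  case False
  then have "aff_dim G = 0" using assms(2) aff_dim_negative_iff[of G] by linarith
  then show ?thesis using that[of "{}"] assms(2) by auto
qed

text \<open>Dimension is a rank: descending through maximal proper faces lowers it by exactly one at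
  each step, while the strictly smaller image face loses at least one. Applied to an isomorphism and
  to its inverse, this makes dimension a combinatorial invariant. The induction measure is shifted
  by one because the empty face has dimension -1.\<close>

lemma strict_mono_faces_aff_dim_le:
  assumes "polytope A" "convex B"
    and f: "\<And>F. F face_of A \<Longrightarrow> f F face_of B"
    and mono: "\<And>F G. F face_of A \<Longrightarrow> G face_of A \<Longrightarrow> F \<subset> G \<Longrightarrow> f F \<subset> f G"
    and "G face_of A"
  shows "aff_dim G \<le> aff_dim (f G)"
  using \<open>G face_of A\<close>
proof (induction "nat (aff_dim G + 1)" arbitrary: G rule: less_induct)
  case less
  show ?case
  proof (cases "G = {}")
    case True
    then show ?thesis using aff_dim_geq[of "f G"] by simp
  next
    case False
    have "polytope G" using less.prems assms(1) face_of_polytope_polytope by blast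
    then obtain H where H: "H face_of G" "H \<noteq> G" "aff_dim H = aff_dim G - 1"
      using polytope_maximal_proper_face False by blast
    have HA: "H face_of A" using H less.prems face_of_trans by blast
    have "aff_dim G \<ge> 0" using False aff_dim_negative_iff[of G] by linarith
    then have "aff_dim H \<le> aff_dim (f H)" using less.hyps[OF _ HA] H by simp
    moreover have "H \<subset> G" using H face_of_imp_subset by blast
    then have ss: "f H \<subset> f G" using mono HA less.prems by blast
    have "f H face_of f G"
      using f[OF HA] f[OF less.prems] ss face_of_subset[of "f H" B "f G"] face_of_imp_subset by blast
    then have "aff_dim (f H) < aff_dim (f G)"
      using face_of_aff_dim_lt[of "f G" "f H"] ss f[OF less.prems] face_of_imp_convex by blast
    ultimately show ?thesis using H by simp
  qed
qed

lemma order_iso_faces_aff_dim: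
  assumes "polytope A" "polytope B" "order_iso (face_lattice A) (face_lattice B) f" "G face_of A"
  shows "aff_dim (f G) = aff_dim G"
proof (rule antisym)
  have lower: "aff_dim H \<le> aff_dim (g H)"
    if "polytope C" "polytope D" "order_iso (face_lattice C) (face_lattice D) g" "H face_of C" for C D g H
  proof (rule strict_mono_faces_aff_dim_le[OF that(1) polytope_imp_convex[OF that(2)]])
    show "g F face_of D" if "F face_of C" for F
      using order_iso_mem[OF \<open>order_iso (face_lattice C) (face_lattice D) g\<close>] that
      by (simp add: face_lattice_def)
    show "g F \<subset> g G" if "F face_of C" "G face_of C" "F \<subset> G" for F G
      using order_iso_subset_iff[OF \<open>order_iso (face_lattice C) (face_lattice D) g\<close>] that
      by (simp add: face_lattice_def less_le_not_le)
  qed (use that in auto)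
  show "aff_dim G \<le> aff_dim (f G)" using lower[OF assms] .
  have G: "G \<in> face_lattice A" using assms(4) by (simp add: face_lattice_def)
  have "f G face_of B" using order_iso_mem[OF assms(3) G] by (simp add: face_lattice_def)
  then have "aff_dim (f G) \<le> aff_dim (inv_into (face_lattice A) f (f G))"
    by (rule lower[OF assms(2,1) order_iso_inv_into[OF assms(3)]])
  then show "aff_dim (f G) \<le> aff_dim G" using order_iso_inv_into_eq[OF assms(3) G] by simp
qed

lemma face_of_segment_polytope:
  assumes "polytope Q" "aff_dim Q = 1"
  obtains a b where "\<And>F. F face_of Q \<Longrightarrow> F = {} \<or> F = {a} \<or> F = {b} \<or> F = Q"
proof -
  have "collinear Q" "Q \<noteq> {}" using assms by (auto simp: collinear_aff_dim)
  then obtain a b where ab: "Q = closed_segment a b"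
    using compact_convex_collinear_segment[of Q] assms polytope_imp_compact polytope_imp_convex by metis
  have "F = {} \<or> F = {a} \<or> F = {b} \<or> F = Q" if "F face_of Q" for F
  proof (rule ccontr)
    assume not: "\<not> ?thesis"
    then have "aff_dim F < 1" using face_of_aff_dim_lt[of Q F] that assms polytope_imp_convex by auto
    moreover have "\<not> aff_dim F < 0" using not by simp
    ultimately have "aff_dim F = 0" by linarith
    then obtain x where "F = {x}" by (auto simp: aff_dim_eq_0)
    then show False using that not ab by (simp add: face_of_singleton extreme_point_of_segment)
  qed
  then show ?thesis using that by blast
qed

lemma order_iso_top:
  assumes "order_iso A B f" "X \<in> A" "Y \<in> B" "\<And>G. G \<in> A \<Longrightarrow> G \<subseteq> X" "\<And>G. G \<in> B \<Longrightarrow> G \<subseteq> Y"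
  shows "f X = Y"
proof -
  obtain Z where Z: "Z \<in> A" "f Z = Y" using order_iso_surj[OF assms(1,3)] by blast
  then have "Y \<subseteq> f X" using order_iso_subset_iff[OF assms(1) Z(1) assms(2)] assms(4) by simp
  then show ?thesis using assms(5)[OF order_iso_mem[OF assms(1,2)]] by simp
qed

lemma order_iso_bot:
  assumes "order_iso A B f" "{} \<in> A" "{} \<in> B"
  shows "f {} = {}"
proof -
  obtain Z where "Z \<in> A" "f Z = {}" using order_iso_surj[OF assms(1,3)] by blast
  then show ?thesis using order_iso_subset_iff[OF assms(1,2), of Z] by simp
qed

text \<open>Fixedness spreads from a facet \<open>A\<close> to a facet \<open>B\<close> across their
  ridge: the ridge lies in \<open>A\<close>, \<open>B\<close> and \<open>\<phi> B\<close>, of which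
  two must coincide, so \<open>\<phi> B = B\<close>; then the induction hypothesis applies to
  \<open>B\<close>, with the ridge as its fixed facet. Ridge connectedness reaches all
  facets.\<close>

lemma face_lattice_automorphism_fixing_facet:
  fixes Q :: "'a::euclidean_space set"
  assumes "polytope Q" "F face_of Q" "aff_dim F = aff_dim Q - 1"
    and "order_iso (face_lattice Q) (face_lattice Q) \<phi>"
    and "\<And>G. G face_of F \<Longrightarrow> \<phi> G = G"
    and "G face_of Q"
  shows "\<phi> G = G"
  using assms
proof (induction "nat (aff_dim Q + 1)" arbitrary: Q F G rule: less_induct)
  case less
  note iso = less.prems(4)
  have convQ: "convex Q" using less.prems polytope_imp_convex by blast
  have top: "\<phi> Q = Q"
    by (rule order_iso_top[OF iso]) (auto simp: face_lattice_def face_of_refl convQ face_of_imp_subset)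
  have bot: "\<phi> {} = {}" by (rule order_iso_bot[OF iso]) (auto simp: face_lattice_def)
  have dim: "aff_dim (\<phi> H) = aff_dim H" if "H face_of Q" for H
    by (rule order_iso_faces_aff_dim[OF less.prems(1,1) iso that])
  have face: "\<phi> H face_of Q" if "H face_of Q" for H
    using order_iso_mem[OF iso] that by (simp add: face_lattice_def)
  have inj: "\<phi> H = \<phi> K \<longleftrightarrow> H = K" if "H face_of Q" "K face_of Q" for H K
    using order_iso_eq_iff[OF iso] that by (simp add: face_lattice_def)
  have mono: "\<phi> H \<subseteq> \<phi> K \<longleftrightarrow> H \<subseteq> K" if "H face_of Q" "K face_of Q" for H K
    using order_iso_subset_iff[OF iso] that by (simp add: face_lattice_def)
  have fixF: "\<phi> F = F" using less.prems(5)[of F] less.prems(2) face_of_imp_convex face_of_refl by blast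
  \<comment> \<open>Ridges are nonempty only from dimension two on, and the ridge lemmas need that.
    In smaller dimension the few faces are inspected directly.\<close>
  consider "aff_dim Q \<le> 0" | "aff_dim Q = 1" | "aff_dim Q \<ge> 2" by linarith
  then show ?case
  proof cases
    case 1
    have "G = {} \<or> G = Q"
    proof (rule ccontr)
      assume "\<not> ?thesis"
      then have "aff_dim G < aff_dim Q" using face_of_aff_dim_lt[OF convQ less.prems(6)] by blast
      then have "aff_dim G < 0" using 1 by linarith
      then show False using \<open>\<not> (G = {} \<or> G = Q)\<close> by simp
    qed
    then show ?thesis using top bot by auto
  next
    case 2
    obtain a b where ab: "\<And>F. F face_of Q \<Longrightarrow> F = {} \<or> F = {a} \<or> F = {b} \<or> F = Q"
      using face_of_segment_polytope[OF less.prems(1) 2] by blast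
    have "F \<noteq> {}" "F \<noteq> Q" using less.prems(3) 2 by auto
    then have "F = {a} \<or> F = {b}" using ab less.prems(2) by blast
    moreover have "\<phi> G = {} \<or> \<phi> G = {a} \<or> \<phi> G = {b} \<or> \<phi> G = Q" using ab face less.prems(6) by blast
    moreover have "G = {} \<or> G = {a} \<or> G = {b} \<or> G = Q" using ab less.prems(6) by blast
    moreover have "\<phi> G = F \<longleftrightarrow> G = F" "\<phi> G = {} \<longleftrightarrow> G = {}" "\<phi> G = Q \<longleftrightarrow> G = Q"
      using top bot fixF inj[OF less.prems(6) less.prems(2)] inj[OF less.prems(6), of "{}"]
        inj[OF less.prems(6) face_of_refl[OF convQ]] by simp_all
    ultimately show ?thesis by (elim disjE) simp_all
  next
    case 3
    have facet_iff: "A facet_of Q \<longleftrightarrow> A face_of Q \<and> aff_dim A = aff_dim Q - 1" for A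
      using 3 by (auto simp: facet_of_def)
    let ?fixed = "\<lambda>A. \<forall>H. H face_of A \<longrightarrow> \<phi> H = H"
    have ridge_step: "?fixed B"
      if A: "A facet_of Q" "?fixed A" and B: "B facet_of Q" and AB: "aff_dim Q - 2 \<le> aff_dim (A \<inter> B)" for A B
    proof (cases "A = B")
      case False
      have faces: "A face_of Q" "B face_of Q" and dims: "aff_dim A = aff_dim Q - 1" "aff_dim B = aff_dim Q - 1"
        using A(1) B facet_iff by auto
      let ?E = "A \<inter> B"
      have E: "?E face_of Q" "?E face_of A" "?E face_of B"
        using faces face_of_Int face_of_face by blast+
      have "?E \<noteq> B"
      proof
        assume "?E = B"
        then have "B \<subseteq> A" by blast
        then show False using face_subset_eq_if_aff_dim_eq[OF convQ faces(2,1)] dims False by simp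
      qed
      then have "aff_dim ?E < aff_dim B"
        using face_of_aff_dim_lt[of B ?E] E faces face_of_imp_convex by blast
      then have dimE: "aff_dim ?E = aff_dim Q - 2" using AB dims by simp
      have neE: "?E \<noteq> {}" using dimE 3 by auto
      have fixE: "\<phi> ?E = ?E" using A(2) E(2) by blast
      have "\<phi> A = A" using A(2) faces(1) face_of_imp_convex face_of_refl by blast
      have "?E \<subseteq> \<phi> B" using mono[OF E(1) faces(2)] fixE by simp
      then have "A = B \<or> A = \<phi> B \<or> B = \<phi> B"
        using ridge_in_at_most_two_facets[OF convQ E(1) neE dimE faces face[OF faces(2)] dims]
          dim[OF faces(2)] dims by simp
      then have fixB: "\<phi> B = B" using inj[OF faces] \<open>\<phi> A = A\<close> False by auto
      have isoB: "order_iso (face_lattice B) (face_lattice B) \<phi>"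
        using order_iso_face_lattice[OF iso, of B] fixB face_lattice_face[OF faces(2)] faces(2)
        by (simp add: face_lattice_def)
      show ?thesis
      proof (intro allI impI)
        fix H assume "H face_of B"
        show "\<phi> H = H"
        proof (rule less.hyps[OF _ _ E(3) _ isoB _ \<open>H face_of B\<close>])
          show "nat (aff_dim B + 1) < nat (aff_dim Q + 1)" using dims 3 by simp
          show "polytope B" using faces(2) less.prems(1) face_of_polytope_polytope by blast
          show "aff_dim ?E = aff_dim B - 1" using dimE dims by simp
          show "\<phi> K = K" if "K face_of ?E" for K
            using A(2) that E(2) face_of_trans by blast
        qed
      qed
    qed (use A in simp)
    have all_fixed: "?fixed B" if "B facet_of Q" for B
    proof -
      have "F facet_of Q" using less.prems facet_iff by blast
      then have "(F, B) \<in> {(A, B). A facet_of Q \<and> B facet_of Q \<and> aff_dim Q - 2 \<le> aff_dim (A \<inter> B)}\<^sup>*"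
        using polytope_facets_ridge_connected[OF less.prems(1) 3 _ that] by blast
      then show ?thesis
      proof (induction rule: rtrancl_induct)
        case base
        then show ?case using less.prems(5) by blast
      next
        case (step A B)
        then show ?case using ridge_step[of A B] by blast
      qed
    qed
    show ?thesis
    proof (cases "G = {} \<or> G = Q")
      case True
      then show ?thesis using top bot by auto
    next
      case False
      then obtain B where B: "B facet_of Q" "G \<subseteq> B"
        using face_of_polyhedron_subset_facet[of Q G] less.prems polytope_imp_polyhedron by metis
      then have "G face_of B" using less.prems(6) facet_of_imp_subset face_of_subset by blast
      then show ?thesis using all_fixed B by blast
    qed
  qed
qed

text \<open>Compose one map with the inverse of the other. This is the source of all rigidity below:
  once the image tile is known, its face lattice isomorphism is forced by a neighbour across a
  facet.\<close>

lemma order_iso_agree_on_facet: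
  fixes Q :: "'a::euclidean_space set"
  assumes "polytope Q" "F face_of Q" "aff_dim F = aff_dim Q - 1"
    and "order_iso (face_lattice Q) B \<phi>" "order_iso (face_lattice Q) B \<psi>"
    and "\<And>G. G face_of F \<Longrightarrow> \<phi> G = \<psi> G"
    and "G face_of Q"
  shows "\<phi> G = \<psi> G"
proof -
  let ?\<theta> = "\<lambda>H. inv_into (face_lattice Q) \<psi> (\<phi> H)"
  have "?\<theta> G = G"
  proof (rule face_lattice_automorphism_fixing_facet[OF assms(1-3) _ _ assms(7)])
    show "order_iso (face_lattice Q) (face_lattice Q) ?\<theta>"
      using order_iso_comp[OF assms(4) order_iso_inv_into[OF assms(5)]] .
    show "?\<theta> H = H" if "H face_of F" for H
    proof -
      have "H \<in> face_lattice Q" using that assms(2) face_of_trans by (auto simp: face_lattice_def)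
      then show ?thesis using assms(6)[OF that] order_iso_inv_into_eq[OF assms(5)] by simp
    qed
  qed
  moreover have "\<phi> G \<in> B" using order_iso_mem[OF assms(4)] assms(7) by (simp add: face_lattice_def)
  ultimately show ?thesis using order_iso_f_inv_into[OF assms(5), of "\<phi> G"] by simp
qed

section \<open>Facet chains in tilings\<close>

locale polytopal_tiling =
  fixes T :: "'a::euclidean_space set set"
  assumes tiling: "tiling T"
    and locally_finite: "locally_finite_tiling T"
    and face_to_face: "face_to_face T"
begin

lemma polytope_tile: "Q \<in> T \<Longrightarrow> polytope Q"
  and aff_dim_tile: "Q \<in> T \<Longrightarrow> aff_dim Q = int DIM('a)"
  and Union_tiles: "\<Union>T = UNIV"
  and interior_tiles_disjoint: "Q \<in> T \<Longrightarrow> R \<in> T \<Longrightarrow> Q \<noteq> R \<Longrightarrow> interior Q \<inter> interior R = {}"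
  using tiling by (auto simp: tiling_def)

lemma convex_tile: "Q \<in> T \<Longrightarrow> convex Q"
  and compact_tile: "Q \<in> T \<Longrightarrow> compact Q"
  and closed_tile: "Q \<in> T \<Longrightarrow> closed Q"
  using polytope_tile polytope_imp_convex polytope_imp_compact compact_imp_closed by blast+

lemma interior_tile_nonempty: "Q \<in> T \<Longrightarrow> interior Q \<noteq> {}"
  using aff_dim_tile convex_tile
  by (metis aff_dim_empty_eq empty_interior_lowdim aff_dim_eq_full interior_rel_interior
      rel_interior_eq_empty of_nat_0_le_iff not_less aff_dim_negative_iff)

lemma Int_face_of_tile: "Q \<in> T \<Longrightarrow> R \<in> T \<Longrightarrow> Q \<inter> R face_of Q"
  using face_to_face by (auto simp: face_to_face_def)

lemma tile_face_self: "Q \<in> T \<Longrightarrow> Q face_of Q"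
  by (simp add: convex_tile face_of_refl)

text \<open>Through the face-to-face property, incidence of a face with a tile is plain inclusion,
  so the order on faces alone recovers the face lattice of each tile.\<close>

lemma face_of_tile_if_subset:
  assumes "F face_of R" "R \<in> T" "Q \<in> T" "F \<subseteq> Q"
  shows "F face_of Q"
proof -
  have "Q \<inter> R face_of R" using Int_face_of_tile[of R Q] assms by (simp add: Int_commute)
  then have "F face_of Q \<inter> R"
    using assms face_of_imp_subset[OF assms(1)] face_of_imp_subset by (intro face_of_subset[OF assms(1)]) auto
  then show ?thesis using face_of_trans Int_face_of_tile assms by blast
qed

lemma tile_subset_eq: "Q \<in> T \<Longrightarrow> R \<in> T \<Longrightarrow> Q \<subseteq> R \<Longrightarrow> Q = R"
  using face_subset_eq_if_aff_dim_eq[of R Q R] face_of_tile_if_subset[of Q Q R]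
    tile_face_self convex_tile aff_dim_tile by simp

lemma finite_tiles_meeting_bounded:
  assumes "bounded B"
  shows "finite {Q\<in>T. Q \<inter> B \<noteq> {}}"
proof -
  obtain U where U: "\<And>x. open (U x)" "\<And>x. x \<in> U x" "\<And>x. finite {P\<in>T. P \<inter> U x \<noteq> {}}"
    using locally_finite unfolding locally_finite_tiling_def by metis
  have "compact (closure B)" using assms by simp
  then obtain C where C: "finite C" "closure B \<subseteq> (\<Union>x\<in>C. U x)"
    using compactE_image[of "closure B" "closure B" U] U(1,2) by (metis UN_I subsetI)
  have "{Q\<in>T. Q \<inter> B \<noteq> {}} \<subseteq> (\<Union>x\<in>C. {P\<in>T. P \<inter> U x \<noteq> {}})"
  proof -
    have "B \<subseteq> (\<Union>x\<in>C. U x)" using closure_subset C(2) by (rule subset_trans)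
    then show ?thesis by blast
  qed
  then show ?thesis using C(1) U(3) by (meson finite_UN_I finite_subset)
qed

lemma finite_faces_meeting_bounded:
  assumes "bounded B"
  shows "finite {F \<in> faces T. F \<inter> B \<noteq> {}}"
proof -
  have "{F \<in> faces T. F \<inter> B \<noteq> {}} \<subseteq> (\<Union>Q\<in>{Q\<in>T. Q \<inter> B \<noteq> {}}. {F. F face_of Q})"
    using face_of_imp_subset by (fastforce simp: faces_def)
  moreover have "finite (\<Union>Q\<in>{Q\<in>T. Q \<inter> B \<noteq> {}}. {F. F face_of Q})"
    using finite_tiles_meeting_bounded[OF assms] finite_polytope_faces[OF polytope_tile]
    by (intro finite_UN_I) auto
  ultimately show ?thesis by (rule finite_subset)
qed

lemma compact_face:
  assumes "F \<in> faces T" shows "compact F"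
proof -
  obtain Q where "Q \<in> T" "F face_of Q" using assms by (auto simp: faces_def)
  then show ?thesis using face_of_imp_compact compact_tile convex_tile by blast
qed

text \<open>Only finitely many faces enter the neighbourhood of \<open>K\<close> of radius 1, and
  each that misses \<open>K\<close> has positive distance from it; all others are at distance at
  least 1.\<close>

lemma faces_separated_from_compact:
  assumes "compact K"
  obtains \<delta> where "\<delta> > 0" "\<And>F x y. F \<in> faces T \<Longrightarrow> F \<inter> K = {} \<Longrightarrow> x \<in> F \<Longrightarrow> y \<in> K \<Longrightarrow> \<delta> \<le> dist x y"
proof -
  define B where "B = (\<Union>y\<in>K. ball y 1)"
  obtain M where M: "\<And>y. y \<in> K \<Longrightarrow> norm y \<le> M"
    using compact_imp_bounded[OF assms] by (auto simp: bounded_iff)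
  have "norm x \<le> M + 1" if x: "x \<in> B" for x
  proof -
    obtain y where y: "y \<in> K" "dist y x < 1" using x by (auto simp: B_def)
    then show ?thesis using M[OF y(1)] norm_triangle_ineq2[of x y] by (simp add: dist_norm norm_minus_commute)
  qed
  then have "bounded B" by (auto simp: bounded_iff)
  define \<F> where "\<F> = {F \<in> faces T. F \<inter> B \<noteq> {} \<and> F \<inter> K = {}}"
  have fin: "finite \<F>"
    using finite_subset[OF _ finite_faces_meeting_bounded[OF \<open>bounded B\<close>], of \<F>] by (auto simp: \<F>_def)
  have "\<exists>d>0. \<forall>x\<in>F. \<forall>y\<in>K. d \<le> dist x y" if F: "F \<in> \<F>" for F
  proof -
    have "closed F"
      using F compact_face compact_imp_closed by (auto simp: \<F>_def)
    then obtain d where "d > 0" "\<forall>x\<in>K. \<forall>y\<in>F. d \<le> dist x y"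
      using separate_compact_closed[OF assms, of F] F by (auto simp: \<F>_def)
    then show ?thesis by (metis dist_commute)
  qed
  then obtain d where d: "\<And>F. F \<in> \<F> \<Longrightarrow> d F > 0" "\<And>F x y. F \<in> \<F> \<Longrightarrow> x \<in> F \<Longrightarrow> y \<in> K \<Longrightarrow> d F \<le> dist x y"
    by metis
  show ?thesis
  proof (rule that[of "Min (insert 1 (d ` \<F>))"])
    show "0 < Min (insert 1 (d ` \<F>))" using fin d(1) by auto
    fix F x y assume F: "F \<in> faces T" "F \<inter> K = {}" "x \<in> F" "y \<in> K"
    show "Min (insert 1 (d ` \<F>)) \<le> dist x y"
    proof (cases "F \<in> \<F>")
      case True
      have "Min (insert 1 (d ` \<F>)) \<le> d F" using fin True by (intro Min_le) auto
      then show ?thesis using d(2)[OF True F(3,4)] by simp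
    next
      case False
      then have "x \<notin> B" using F by (auto simp: \<F>_def)
      then have "1 \<le> dist x y" using F(4) by (force simp: B_def dist_commute)
      moreover have "Min (insert 1 (d ` \<F>)) \<le> 1" using fin by (intro Min_le) auto
      ultimately show ?thesis by simp
    qed
  qed
qed

lemma tile_in_faces: "Q \<in> T \<Longrightarrow> Q \<in> faces T"
  using tile_face_self by (auto simp: faces_def)

lemma ball_meets_only_tiles_at_center:
  obtains \<epsilon> where "\<epsilon> > 0" "\<And>Q. Q \<in> T \<Longrightarrow> Q \<inter> ball x \<epsilon> \<noteq> {} \<Longrightarrow> x \<in> Q"
proof -
  obtain \<delta> where \<delta>: "\<delta> > 0" "\<And>F z y. F \<in> faces T \<Longrightarrow> F \<inter> {x} = {} \<Longrightarrow> z \<in> F \<Longrightarrow> y \<in> {x} \<Longrightarrow> \<delta> \<le> dist z y"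
    using faces_separated_from_compact[of "{x}"] by auto
  show ?thesis
  proof (rule that[OF \<delta>(1)])
    fix Q assume Q: "Q \<in> T" "Q \<inter> ball x \<delta> \<noteq> {}"
    then obtain z where z: "z \<in> Q" "dist x z < \<delta>" by auto
    show "x \<in> Q"
    proof (rule ccontr)
      assume "x \<notin> Q"
      then have "\<delta> \<le> dist z x" using \<delta>(2)[OF tile_in_faces[OF Q(1)], of z x] z by simp
      then show False using z by (simp add: dist_commute)
    qed
  qed
qed

text \<open>The hypothesis on \<open>h\<close> says that \<open>c\<close> and \<open>c'\<close> lie
  in the same direction from \<open>G\<close>, up to directions of \<open>G\<close>. Moving slightly
  from \<open>x\<close> towards \<open>c\<close> therefore reaches the same point as moving from
  some \<open>e\<close> in \<open>G\<close> towards \<open>c'\<close>; that point is interior to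
  both tiles.\<close>

lemma face_of_tile_same_side:
  assumes Q: "Q \<in> T" "R \<in> T" and G: "G face_of Q" "G face_of R" "x \<in> rel_interior G"
    and c: "c \<in> interior Q" "c' \<in> interior R"
    and h: "x + h \<in> affine hull G" "c - x = u *\<^sub>R (c' - x) + h" "u > 0"
  shows "Q = R"
proof (rule ccontr)
  assume "Q \<noteq> R"
  obtain \<delta> where \<delta>: "\<delta> > 0" "\<And>r. \<bar>r\<bar> \<le> \<delta> \<Longrightarrow> x + r *\<^sub>R h \<in> G"
    using rel_interior_add_scaled[OF G(3) h(1)] by blast
  \<comment> \<open>The bound 1 keeps the first point within reach of \<open>c\<close>,
    \<open>1/(2*u)\<close> leaves weight at least 1/2 on \<open>e\<close>, and
    \<open>\<delta>/2\<close> then keeps the shift of \<open>e\<close> within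
    \<open>\<delta>\<close>, hence inside \<open>G\<close>.\<close>
  define \<epsilon> where "\<epsilon> = min 1 (min (1 / (2 * u)) (\<delta> / 2))"
  have \<epsilon>: "0 < \<epsilon>" "\<epsilon> \<le> 1" "\<epsilon> \<le> 1 / (2 * u)" "2 * \<epsilon> \<le> \<delta>" using \<delta> h(3) by (auto simp: \<epsilon>_def)
  have eu: "\<epsilon> * u \<le> 1 / 2" "0 < \<epsilon> * u" using \<epsilon> h(3) by (simp_all add: field_simps)
  define e where "e = x + (\<epsilon> / (1 - \<epsilon> * u)) *\<^sub>R h"
  have "\<epsilon> / (1 - \<epsilon> * u) \<le> \<epsilon> / (1/2)" using eu \<epsilon>(1) by (intro divide_left_mono) auto
  then have "e \<in> G" unfolding e_def using \<epsilon> eu by (intro \<delta>(2)) simp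
  have xG: "x \<in> G" using G(3) rel_interior_subset by blast
  have GQ: "G \<subseteq> Q" "G \<subseteq> R" using G face_of_imp_subset by auto
  have 1: "x - \<epsilon> *\<^sub>R (x - c) \<in> interior Q"
    by (rule mem_interior_convex_shrink[OF convex_tile[OF Q(1)] c(1)]) (use xG GQ \<epsilon> in auto)
  have 2: "e - (\<epsilon> * u) *\<^sub>R (e - c') \<in> interior R"
    by (rule mem_interior_convex_shrink[OF convex_tile[OF Q(2)] c(2)]) (use \<open>e \<in> G\<close> GQ eu in auto)
  have "x - \<epsilon> *\<^sub>R (x - c) = x + \<epsilon> *\<^sub>R (c - x)" by (simp add: algebra_simps)
  also have "\<dots> = x + \<epsilon> *\<^sub>R (u *\<^sub>R (c' - x) + h)" by (simp only: h(2))
  also have "\<dots> = (1 - \<epsilon> * u) *\<^sub>R x + \<epsilon> *\<^sub>R h + (\<epsilon> * u) *\<^sub>R c'" by (simp add: algebra_simps)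
  also have "(1 - \<epsilon> * u) *\<^sub>R x + \<epsilon> *\<^sub>R h = (1 - \<epsilon> * u) *\<^sub>R e"
    using eu by (simp add: e_def scaleR_add_right)
  also have "(1 - \<epsilon> * u) *\<^sub>R e + (\<epsilon> * u) *\<^sub>R c' = e - (\<epsilon> * u) *\<^sub>R (e - c')" by (simp add: algebra_simps)
  finally show False using 1 2 interior_tiles_disjoint[OF Q \<open>Q \<noteq> R\<close>] by auto
qed

text \<open>A hyperplane has two sides. Relative to \<open>c1\<close>, the interior points
  \<open>c2\<close> and \<open>c3\<close> have nonzero transverse coordinates \<open>u\<close> and
  \<open>v\<close>; among 1, \<open>u\<close>, \<open>v\<close> two have equal sign, and the
  corresponding tiles overlap.\<close>

lemma facet_in_at_most_two_tiles:
  assumes Q: "Q1 \<in> T" "Q2 \<in> T" "Q3 \<in> T"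
    and G: "G face_of Q1" "G face_of Q2" "G face_of Q3" "aff_dim G = int DIM('a) - 1"
  shows "Q1 = Q2 \<or> Q1 = Q3 \<or> Q2 = Q3"
proof -
  have "G \<noteq> {}" using G(4) by (auto simp: algebra_simps)
  then obtain x where x: "x \<in> rel_interior G"
    using rel_interior_eq_empty face_of_imp_convex[OF G(1)] by blast
  have off: "c \<notin> affine hull G" if "Q \<in> T" "G face_of Q" "c \<in> interior Q" for c Q
  proof
    assume "c \<in> affine hull G"
    then have "c \<in> G"
      using face_of_imp_eq_affine_Int[OF convex_tile[OF that(1)] that(2)] that(3) interior_subset by blast
    moreover have "G \<noteq> Q" using G(4) aff_dim_tile[OF that(1)] by auto
    ultimately show False using face_of_disjoint_interior[OF that(2)] that(3) by blast
  qed
  obtain c1 c2 c3 where c: "c1 \<in> interior Q1" "c2 \<in> interior Q2" "c3 \<in> interior Q3"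
    using interior_tile_nonempty Q by (meson all_not_in_conv)
  have "aff_dim (insert c1 G) = int DIM('a)" using off[OF Q(1) G(1) c(1)] G(4) by (simp add: aff_dim_insert)
  then have full: "affine hull (insert c1 G) = UNIV" by (simp add: aff_dim_eq_full)
  have xh: "x \<in> affine hull G" using x rel_interior_subset hull_inc by (meson subsetD)
  have dec: "\<exists>u h. x + h \<in> affine hull G \<and> c - x = u *\<^sub>R (c1 - x) + h" for c
  proof -
    obtain u h where "x + h \<in> affine hull G" "c = x + u *\<^sub>R (c1 - x) + h"
      by (rule affine_hull_insert_decompose[of c c1 G x]) (use full xh in auto)
    then show ?thesis by (intro exI[of _ u] exI[of _ h]) simp
  qed
  obtain u h where u: "x + h \<in> affine hull G" "c2 - x = u *\<^sub>R (c1 - x) + h" using dec by blast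
  obtain v k where v: "x + k \<in> affine hull G" "c3 - x = v *\<^sub>R (c1 - x) + k" using dec by blast
  have u0: "u \<noteq> 0"
  proof
    assume "u = 0"
    then have "c2 = x + h" using u(2) by (simp add: algebra_simps)
    then show False using off[OF Q(2) G(2) c(2)] u(1) by simp
  qed
  have v0: "v \<noteq> 0"
  proof
    assume "v = 0"
    then have "c3 = x + k" using v(2) by (simp add: algebra_simps)
    then show False using off[OF Q(3) G(3) c(3)] v(1) by simp
  qed
  consider "u > 0" | "v > 0" | "u < 0" "v < 0" using u0 v0 by linarith
  then show ?thesis
  proof cases
    case 1
    then show ?thesis using face_of_tile_same_side[OF Q(2,1) G(2,1) x c(2,1) u] by simp
  next
    case 2
    then show ?thesis using face_of_tile_same_side[OF Q(3,1) G(3,1) x c(3,1) v] by simp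
  next
    case 3
    define w where "w = u / v"
    have w: "w > 0" "w * v = u" using 3 by (auto simp: w_def divide_neg_neg)
    have "w *\<^sub>R (c3 - x) + (h - w *\<^sub>R k) = (w * v) *\<^sub>R (c1 - x) + h" unfolding v(2) by (simp add: algebra_simps)
    then have eq: "c2 - x = w *\<^sub>R (c3 - x) + (h - w *\<^sub>R k)" using u(2) w(2) by simp
    have hh: "x + (h - w *\<^sub>R k) \<in> affine hull G"
    proof -
      have "(1 + w) *\<^sub>R x - w *\<^sub>R (x + k) = (1 - (-w)) *\<^sub>R x + (-w) *\<^sub>R (x + k)" by (simp add: algebra_simps)
      also have "\<dots> \<in> affine hull G" using xh v(1) by (intro mem_affine[OF affine_affine_hull]) auto
      finally have "x - w *\<^sub>R k \<in> affine hull G" by (simp add: algebra_simps)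
      then have "1 *\<^sub>R (x + h) + (-1) *\<^sub>R x + 1 *\<^sub>R (x - w *\<^sub>R k) \<in> affine hull G"
        using u(1) xh by (intro mem_affine_3[OF affine_affine_hull]) auto
      then show ?thesis by (simp add: algebra_simps)
    qed
    show ?thesis using face_of_tile_same_side[OF Q(2,3) G(2,3) x c(2,3) hh eq w(1)] by simp
  qed
qed

text \<open>The inequality also admits equal tiles. The parameter \<open>D\<close> records where a
  chain is allowed to run, since maps are often isomorphisms only on part of the tiling.\<close>

definition facet_adj :: "'a set set \<Rightarrow> ('a set \<times> 'a set) set" where
  "facet_adj D = {(A, B). A \<in> D \<and> B \<in> D \<and> int DIM('a) - 1 \<le> aff_dim (A \<inter> B)}"

lemma facet_adj_mono: "D \<subseteq> D' \<Longrightarrow> facet_adj D \<subseteq> facet_adj D'"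
  by (auto simp: facet_adj_def)

text \<open>A path of two segments inside \<open>K\<close> can avoid all faces of dimension at most
  \<open>d - 2\<close>, so tiles sharing a point of it share a facet. The full-dimensional
  intersections with \<open>K\<close> provide end points off those faces. A large \<open>K\<close>
  gives global chains, a small ball gives chains around a point.\<close>

lemma facet_chain_in_convex:
  assumes K: "convex K" "bounded K" and Q: "Q \<in> T" "R \<in> T"
    and dim: "aff_dim (Q \<inter> K) = int DIM('a)" "aff_dim (R \<inter> K) = int DIM('a)"
  shows "(Q, R) \<in> (facet_adj {A\<in>T. A \<inter> K \<noteq> {}})\<^sup>*"
proof -
  have dimK: "aff_dim K = int DIM('a)"
    using aff_dim_subset[of "Q \<inter> K" K] dim(1) aff_dim_le_DIM[of K] by simp
  define \<A> where "\<A> = {G \<in> faces T. G \<inter> K \<noteq> {} \<and> aff_dim G \<le> int DIM('a) - 2}"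
  have fin: "finite \<A>"
    using finite_subset[OF _ finite_faces_meeting_bounded[OF K(2)], of \<A>] by (auto simp: \<A>_def)
  have pick: "\<exists>y. y \<in> A \<and> y \<in> K \<and> y \<notin> \<Union>\<A>" if A: "A \<in> T" "aff_dim (A \<inter> K) = int DIM('a)" for A
  proof -
    have ne: "A \<inter> K \<noteq> {}" using A(2) by auto
    have conv: "convex (A \<inter> K)" using convex_tile[OF A(1)] K(1) by (rule convex_Int)
    obtain y where "y \<in> A \<inter> K" "\<And>B. B \<in> \<A> \<Longrightarrow> y \<notin> affine hull B"
      by (rule convex_point_off_affine_hulls[OF fin conv ne]) (auto simp: \<A>_def A(2))
    then show ?thesis by (metis IntE UnionE hull_inc)
  qed
  obtain y where y: "y \<in> Q" "y \<in> K" "y \<notin> \<Union>\<A>" using pick[OF Q(1) dim(1)] by blast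
  obtain y' where y': "y' \<in> R" "y' \<in> K" "y' \<notin> \<Union>\<A>" using pick[OF Q(2) dim(2)] by blast
  obtain z where z: "z \<in> K" "(closed_segment y z \<union> closed_segment z y') \<inter> \<Union>\<A> = {}"
    by (rule two_segments_avoiding[OF fin K(1) y(2) y'(2) y(3) y'(3)]) (auto simp: dimK \<A>_def)
  define L where "L = closed_segment y z \<union> closed_segment z y'"
  have L: "connected L" "L \<subseteq> K"
    unfolding L_def using closed_segment_subset[OF y(2) z(1) K(1)] closed_segment_subset[OF z(1) y'(2) K(1)]
    by (auto intro!: connected_Un)
  have "(Q, R) \<in> {(A, B). A \<in> {A\<in>T. A \<inter> K \<noteq> {}} \<and> B \<in> {A\<in>T. A \<inter> K \<noteq> {}}
      \<and> int DIM('a) - 1 \<le> aff_dim (A \<inter> B)}\<^sup>*"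
  proof (rule connected_closed_cover_chain[OF L(1) finite_tiles_meeting_bounded[OF K(2)], of "\<lambda>A. A"])
    show "L \<subseteq> (\<Union>A\<in>{A\<in>T. A \<inter> K \<noteq> {}}. A)"
    proof
      fix w assume "w \<in> L"
      moreover obtain A where "A \<in> T" "w \<in> A" using Union_tiles by blast
      ultimately show "w \<in> (\<Union>A\<in>{A\<in>T. A \<inter> K \<noteq> {}}. A)" using L(2) by blast
    qed
    show "int DIM('a) - 1 \<le> aff_dim (A \<inter> B)"
      if AB: "A \<in> {A\<in>T. A \<inter> K \<noteq> {}}" "B \<in> {A\<in>T. A \<inter> K \<noteq> {}}" "A \<inter> B \<inter> L \<noteq> {}" for A B
    proof (rule ccontr)
      assume "\<not> ?thesis"
      then have "A \<inter> B \<in> \<A>"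
        using AB L(2) Int_face_of_tile[of A B] by (auto simp: \<A>_def faces_def)
      then show False using AB(3) z(2) unfolding L_def by blast
    qed
  qed (use closed_tile Q y y' in \<open>auto simp: L_def\<close>)
  then show ?thesis by (simp add: facet_adj_def)
qed

lemma facet_chain_global:
  assumes "Q \<in> T" "R \<in> T"
  shows "(Q, R) \<in> (facet_adj T)\<^sup>*"
proof -
  let ?K = "convex hull (Q \<union> R)"
  have "bounded ?K"
    using assms compact_tile by (simp add: bounded_convex_hull compact_imp_bounded)
  moreover have "Q \<inter> ?K = Q" "R \<inter> ?K = R" using hull_subset[of "Q \<union> R" convex] by blast+
  ultimately have "(Q, R) \<in> (facet_adj {A\<in>T. A \<inter> ?K \<noteq> {}})\<^sup>*"
    using facet_chain_in_convex[of ?K Q R] assms aff_dim_tile convex_convex_hull by metis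
  then show ?thesis using rtrancl_mono[OF facet_adj_mono[of "{A\<in>T. A \<inter> ?K \<noteq> {}}" T]] by blast
qed

lemma facet_chain_at_point:
  assumes "Q \<in> T" "R \<in> T" "x \<in> Q" "x \<in> R"
  shows "(Q, R) \<in> (facet_adj {A\<in>T. x \<in> A})\<^sup>*"
proof -
  obtain \<epsilon> where \<epsilon>: "\<epsilon> > 0" "\<And>A. A \<in> T \<Longrightarrow> A \<inter> ball x \<epsilon> \<noteq> {} \<Longrightarrow> x \<in> A"
    using ball_meets_only_tiles_at_center by blast
  have "aff_dim (A \<inter> ball x \<epsilon>) = int DIM('a)" if "A \<in> T" "x \<in> A" for A
  proof -
    have "x \<in> A \<inter> ball x \<epsilon>" using that \<epsilon>(1) by simp
    then have "A \<inter> ball x \<epsilon> \<noteq> {}" by blast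
    then show ?thesis
      using aff_dim_convex_Int_open[OF convex_tile[OF that(1)] open_ball, of x \<epsilon>] aff_dim_tile[OF that(1)]
      by simp
  qed
  then have "(Q, R) \<in> (facet_adj {A\<in>T. A \<inter> ball x \<epsilon> \<noteq> {}})\<^sup>*"
    using facet_chain_in_convex[of "ball x \<epsilon>" Q R] assms by simp
  moreover have "{A\<in>T. A \<inter> ball x \<epsilon> \<noteq> {}} \<subseteq> {A\<in>T. x \<in> A}" using \<epsilon>(2) by blast
  ultimately show ?thesis using rtrancl_mono[OF facet_adj_mono] by blast
qed

section \<open>Coronas\<close>

text \<open>Coronas and the whole face poset are both of this form, so their isomorphisms can be
  studied together.\<close>

definition complex_of :: "'a set set \<Rightarrow> 'a set set" where
  "complex_of D = {F. \<exists>Q\<in>D. F face_of Q}"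

definition tile_ball :: "nat \<Rightarrow> 'a set \<Rightarrow> 'a set set" where
  "tile_ball k P = {Q. (P, Q) \<in> adj_rel T ^^ k}"

lemma faces_eq_complex: "faces T = complex_of T"
  by (auto simp: faces_def complex_of_def)

lemma corona_eq_complex: "corona T k P = complex_of (tile_ball k P)"
  by (auto simp: corona_def complex_of_def tile_ball_def)

lemma adj_rel_iff: "(P, Q) \<in> adj_rel T \<longleftrightarrow> P \<in> T \<and> Q \<in> T \<and> int DIM('a) - 2 \<le> aff_dim (P \<inter> Q)"
  using Int_face_of_tile[of P Q] Int_face_of_tile[of Q P] by (auto simp: adj_rel_def Int_commute)

lemma adj_rel_refl: "P \<in> T \<Longrightarrow> (P, P) \<in> adj_rel T"
  by (simp add: adj_rel_iff aff_dim_tile)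

lemma facet_adj_imp_adj_rel: "D \<subseteq> T \<Longrightarrow> (P, Q) \<in> facet_adj D \<Longrightarrow> (P, Q) \<in> adj_rel T"
  by (auto simp: facet_adj_def adj_rel_iff)

lemma tile_ball_0: "tile_ball 0 P = {P}"
  by (auto simp: tile_ball_def)

lemma tile_ball_Suc: "tile_ball (Suc k) P = {R. \<exists>Q\<in>tile_ball k P. (Q, R) \<in> adj_rel T}"
  by (auto simp: tile_ball_def relcomp_unfold)

lemma tile_ball_tiles: "P \<in> T \<Longrightarrow> tile_ball k P \<subseteq> T"
  by (induction k) (auto simp: tile_ball_0 tile_ball_Suc adj_rel_iff)

lemma tile_ball_center: "P \<in> T \<Longrightarrow> P \<in> tile_ball k P"
  by (induction k) (auto simp: tile_ball_0 tile_ball_Suc intro: adj_rel_refl)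

lemma tile_ball_mono:
  assumes "P \<in> T" "j \<le> k"
  shows "tile_ball j P \<subseteq> tile_ball k P"
proof -
  have "tile_ball j P \<subseteq> tile_ball (Suc j) P" for j
    using tile_ball_tiles[OF assms(1)] adj_rel_refl by (auto simp: tile_ball_Suc)
  then show ?thesis using lift_Suc_mono_le[of "\<lambda>k. tile_ball k P"] assms(2) by blast
qed

lemma tile_ball_neighbour:
  assumes "(P, Q) \<in> adj_rel T"
  shows "tile_ball k Q \<subseteq> tile_ball (Suc k) P"
  using assms relpow_Suc_I2[of P Q "adj_rel T"] by (auto simp: tile_ball_def)

lemma adj_rel_tile_ball: "(P, Q) \<in> adj_rel T \<Longrightarrow> 0 < k \<Longrightarrow> Q \<in> tile_ball k P"
  using tile_ball_neighbour[of P Q "k - 1"] tile_ball_center[of Q "k - 1"] by (auto simp: adj_rel_iff)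

lemma complex_of_mono: "D \<subseteq> D' \<Longrightarrow> complex_of D \<subseteq> complex_of D'"
  by (auto simp: complex_of_def)

lemma corona_mono: "P \<in> T \<Longrightarrow> j \<le> k \<Longrightarrow> corona T j P \<subseteq> corona T k P"
  by (simp add: corona_eq_complex complex_of_mono tile_ball_mono)

lemma corona_subset_faces: "P \<in> T \<Longrightarrow> corona T k P \<subseteq> faces T"
  by (simp add: corona_eq_complex faces_eq_complex complex_of_mono tile_ball_tiles)

lemma tile_in_complex: "D \<subseteq> T \<Longrightarrow> Q \<in> D \<Longrightarrow> Q \<in> complex_of D"
  using tile_face_self by (auto simp: complex_of_def)

lemma center_in_corona: "P \<in> T \<Longrightarrow> P \<in> corona T k P"
  by (simp add: corona_eq_complex tile_in_complex tile_ball_tiles tile_ball_center)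

lemma face_lattice_subset_complex: "Q \<in> D \<Longrightarrow> face_lattice Q \<subseteq> complex_of D"
  by (auto simp: complex_of_def face_lattice_def)

lemma complex_of_UN: "complex_of D = (\<Union>Q\<in>D. face_lattice Q)"
  by (auto simp: complex_of_def face_lattice_def)

lemma corona_0: "corona T 0 P = face_lattice P"
  by (simp add: corona_eq_complex tile_ball_0 complex_of_UN)

lemma face_lattice_in_complex:
  assumes "D \<subseteq> T" "Q \<in> D"
  shows "face_lattice Q = {G \<in> complex_of D. G \<subseteq> Q}"
  using face_of_tile_if_subset[of _ _ Q] assms face_of_imp_subset
  by (fastforce simp: face_lattice_def complex_of_def)

section \<open>What order isomorphisms of subcomplexes preserve\<close>

context
  fixes D D' f
  assumes D: "D \<subseteq> T" "D' \<subseteq> T" and f: "order_iso (complex_of D) (complex_of D') f"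
begin

text \<open>Tiles are the maximal elements of the complex, and maximality is visible in the
  order.\<close>

lemma complex_iso_tile:
  assumes "Q \<in> D" shows "f Q \<in> D'"
proof -
  have "f Q \<in> complex_of D'" using order_iso_mem[OF f] tile_in_complex[OF D(1) assms] by blast
  then obtain R where R: "R \<in> D'" "f Q \<subseteq> R" by (auto simp: complex_of_def dest: face_of_imp_subset)
  then obtain X where X: "X \<in> complex_of D" "f X = R"
    using order_iso_surj[OF f] tile_in_complex[OF D(2)] by blast
  then obtain Q' where Q': "Q' \<in> D" "X \<subseteq> Q'" by (auto simp: complex_of_def dest: face_of_imp_subset)
  have "Q \<subseteq> X" using order_iso_subset_iff[OF f tile_in_complex[OF D(1) assms] X(1)] R X by simp
  then have "Q = Q'" using tile_subset_eq[of Q Q'] Q' D assms by blast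
  then show ?thesis using \<open>Q \<subseteq> X\<close> Q'(2) R X by auto
qed

lemma complex_iso_face_lattice:
  assumes "Q \<in> D"
  shows "order_iso (face_lattice Q) (face_lattice (f Q)) f"
  using order_iso_face_lattice[OF f tile_in_complex[OF D(1) assms]]
    face_lattice_in_complex[OF D(1) assms] face_lattice_in_complex[OF D(2) complex_iso_tile[OF assms]]
  by simp

text \<open>The intersection of two tiles is itself a face in the complex, so it is their meet in
  the order, and order isomorphisms preserve meets. With the invariance of dimension this makes
  adjacency, and hence distance, combinatorial.\<close>

lemma complex_iso_Int:
  assumes "Q \<in> D" "R \<in> D"
  shows "f (Q \<inter> R) = f Q \<inter> f R"
proof
  have in_cx: "Q \<in> complex_of D" "R \<in> complex_of D" using tile_in_complex[OF D(1)] assms by auto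
  have QR: "Q \<inter> R \<in> complex_of D"
    using assms D(1) Int_face_of_tile[of Q R] by (auto simp: complex_of_def)
  show "f (Q \<inter> R) \<subseteq> f Q \<inter> f R"
    using order_iso_subset_iff[OF f QR in_cx(1)] order_iso_subset_iff[OF f QR in_cx(2)] by simp
  have "f Q \<inter> f R \<in> complex_of D'"
    using complex_iso_tile[OF assms(1)] complex_iso_tile[OF assms(2)] D(2) Int_face_of_tile[of "f Q" "f R"]
    by (auto simp: complex_of_def)
  then obtain X where X: "X \<in> complex_of D" "f X = f Q \<inter> f R" using order_iso_surj[OF f] by blast
  then have "X \<subseteq> Q \<inter> R"
    using order_iso_subset_iff[OF f X(1) in_cx(1)] order_iso_subset_iff[OF f X(1) in_cx(2)] by simp
  then show "f Q \<inter> f R \<subseteq> f (Q \<inter> R)" using order_iso_subset_iff[OF f X(1) QR] X(2) by simp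
qed

lemma complex_iso_aff_dim_Int:
  assumes "Q \<in> D" "R \<in> D"
  shows "aff_dim (f Q \<inter> f R) = aff_dim (Q \<inter> R)"
proof -
  have "Q \<in> T" "R \<in> T" "f Q \<in> T" using assms D complex_iso_tile by blast+
  then have "aff_dim (f (Q \<inter> R)) = aff_dim (Q \<inter> R)"
    using order_iso_faces_aff_dim[OF _ _ complex_iso_face_lattice[OF assms(1)]]
      polytope_tile Int_face_of_tile by blast
  then show ?thesis using complex_iso_Int[OF assms] by simp
qed

lemma complex_iso_adj_rel:
  assumes "Q \<in> D" "R \<in> D"
  shows "(f Q, f R) \<in> adj_rel T \<longleftrightarrow> (Q, R) \<in> adj_rel T"
proof -
  have "Q \<in> T" "R \<in> T" "f Q \<in> T" "f R \<in> T" using assms D complex_iso_tile by blast+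
  then show ?thesis using complex_iso_aff_dim_Int[OF assms] by (simp add: adj_rel_iff)
qed

lemma complex_iso_tile_ball_subset:
  assumes "Q \<in> T" "tile_ball j Q \<subseteq> D"
  shows "f ` tile_ball j Q \<subseteq> tile_ball j (f Q)"
  using assms(2)
proof (induction j)
  case 0
  then show ?case by (simp add: tile_ball_0)
next
  case (Suc j)
  have sub: "tile_ball j Q \<subseteq> D" using tile_ball_mono[OF assms(1), of j "Suc j"] Suc.prems by simp
  show ?case
  proof
    fix X assume "X \<in> f ` tile_ball (Suc j) Q"
    then obtain S R where SR: "X = f S" "S \<in> tile_ball (Suc j) Q" "R \<in> tile_ball j Q" "(R, S) \<in> adj_rel T"
      by (auto simp: tile_ball_Suc)
    then have "(f R, f S) \<in> adj_rel T" using complex_iso_adj_rel[of R S] sub Suc.prems by blast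
    moreover have "f R \<in> tile_ball j (f Q)" using Suc.IH[OF sub] SR by blast
    ultimately show "X \<in> tile_ball (Suc j) (f Q)" using SR(1) by (auto simp: tile_ball_Suc)
  qed
qed

end

text \<open>Balls are preserved in both directions, by \<open>f\<close> and by its inverse; the ball
  around \<open>f Q\<close> has to lie in \<open>D'\<close> for the inverse to be defined on
  it.\<close>

lemma complex_iso_corona:
  assumes D: "D \<subseteq> T" "D' \<subseteq> T" and f: "order_iso (complex_of D) (complex_of D') f"
    and Q: "Q \<in> D" and sub: "tile_ball j Q \<subseteq> D" "tile_ball j (f Q) \<subseteq> D'"
  shows "order_iso (corona T j Q) (corona T j (f Q)) f"
proof -
  let ?g = "inv_into (complex_of D) f"
  have g: "order_iso (complex_of D') (complex_of D) ?g" using order_iso_inv_into[OF f] .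
  have Qc: "Q \<in> complex_of D" using tile_in_complex[OF D(1) Q] .
  have fQ: "f Q \<in> D'" using complex_iso_tile[OF D f Q] .
  have gQ: "?g (f Q) = Q" using order_iso_inv_into_eq[OF f Qc] .
  have 1: "f ` tile_ball j Q \<subseteq> tile_ball j (f Q)"
    using complex_iso_tile_ball_subset[OF D f] Q D sub by blast
  have 2: "?g ` tile_ball j (f Q) \<subseteq> tile_ball j Q"
    using complex_iso_tile_ball_subset[OF D(2,1) g, of "f Q" j] fQ D sub gQ by auto
  have fl: "f ` face_lattice R = face_lattice (f R)" if "R \<in> D" for R
    using complex_iso_face_lattice[OF D f that] by (simp add: order_iso_def bij_betw_def)
  have "f ` corona T j Q = corona T j (f Q)"
  proof
    show "f ` corona T j Q \<subseteq> corona T j (f Q)"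
    proof
      fix X assume "X \<in> f ` corona T j Q"
      then obtain S G where S: "S \<in> tile_ball j Q" "G \<in> face_lattice S" "X = f G"
        by (auto simp: corona_eq_complex complex_of_UN)
      then have "X \<in> face_lattice (f S)" "f S \<in> tile_ball j (f Q)" using fl[of S] sub(1) 1 by blast+
      then show "X \<in> corona T j (f Q)" by (auto simp: corona_eq_complex complex_of_UN)
    qed
    show "corona T j (f Q) \<subseteq> f ` corona T j Q"
    proof
      fix X assume "X \<in> corona T j (f Q)"
      then obtain S where S: "S \<in> tile_ball j (f Q)" "X \<in> face_lattice S"
        by (auto simp: corona_eq_complex complex_of_UN)
      have Sc: "S \<in> complex_of D'" using S sub(2) tile_in_complex[OF D(2)] by blast
      have gS: "?g S \<in> tile_ball j Q" using 2 S(1) by blast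
      have "f (?g S) = S" using order_iso_f_inv_into[OF f Sc] .
      then have "X \<in> f ` face_lattice (?g S)" using fl[of "?g S"] gS sub(1) S(2) by auto
      then show "X \<in> f ` corona T j Q" using gS by (auto simp: corona_eq_complex complex_of_UN)
    qed
  qed
  moreover have "corona T j Q \<subseteq> complex_of D"
    using complex_of_mono[OF sub(1)] by (simp add: corona_eq_complex)
  ultimately show ?thesis using order_iso_restrict[OF f] by blast
qed

text \<open>The ball of radius \<open>k\<close> about a neighbour lies in the ball of radius
  \<open>k + 1\<close> about \<open>P\<close>. This is the level lost on moving the centre, which
  the extension property later restores.\<close>

lemma corona_iso_restrict_neighbour:
  assumes P: "P \<in> T" "P' \<in> T" and f: "order_iso (corona T (Suc k) P) (corona T (Suc k) P') f" "f P = P'"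
    and Q: "(P, Q) \<in> adj_rel T"
  shows "order_iso (corona T k Q) (corona T k (f Q)) f" "(P', f Q) \<in> adj_rel T"
proof -
  let ?D = "tile_ball (Suc k) P" and ?D' = "tile_ball (Suc k) P'"
  have D: "?D \<subseteq> T" "?D' \<subseteq> T" using tile_ball_tiles P by auto
  have iso: "order_iso (complex_of ?D) (complex_of ?D') f" using f by (simp add: corona_eq_complex)
  have Qin: "Q \<in> ?D" using adj_rel_tile_ball[OF Q] by simp
  show adj: "(P', f Q) \<in> adj_rel T"
    using complex_iso_adj_rel[OF D iso tile_ball_center[OF P(1)] Qin] Q f(2) by simp
  show "order_iso (corona T k Q) (corona T k (f Q)) f"
    by (rule complex_iso_corona[OF D iso Qin tile_ball_neighbour[OF Q] tile_ball_neighbour[OF adj]])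
qed

lemma corona_iso_restrict:
  assumes P: "P \<in> T" "P' \<in> T" and f: "order_iso (corona T k P) (corona T k P') f" "f P = P'"
    and "j \<le> k"
  shows "order_iso (corona T j P) (corona T j P') f"
proof -
  have "order_iso (corona T j P) (corona T j (f P)) f"
    by (rule complex_iso_corona[of "tile_ball k P" "tile_ball k P'"])
       (use assms tile_ball_tiles tile_ball_center tile_ball_mono in \<open>auto simp: corona_eq_complex\<close>)
  then show ?thesis using f(2) by simp
qed

text \<open>The part of being a complex isomorphism that is inherited by a map glued from local pieces: global
  injectivity is only required across facets.\<close>

definition local_iso :: "'a set set \<Rightarrow> ('a set \<Rightarrow> 'a set) \<Rightarrow> bool" where
  "local_iso D f \<longleftrightarrow> (\<forall>Q\<in>D. f Q \<in> T \<and> order_iso (face_lattice Q) (face_lattice (f Q)) f)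
     \<and> (\<forall>(Q, R)\<in>facet_adj D. f Q = f R \<longrightarrow> Q = R)"

lemma complex_iso_imp_local_iso:
  assumes D: "D \<subseteq> T" "D' \<subseteq> T" and f: "order_iso (complex_of D) (complex_of D') f"
  shows "local_iso D f"
  unfolding local_iso_def
  using complex_iso_tile[OF D f] complex_iso_face_lattice[OF D f] D(2)
    order_iso_eq_iff[OF f] tile_in_complex[OF D(1)]
  by (auto simp: facet_adj_def)

lemma local_iso_mono: "local_iso D' f \<Longrightarrow> D \<subseteq> D' \<Longrightarrow> local_iso D f"
  using facet_adj_mono[of D D'] by (fastforce simp: local_iso_def)

lemma corona_iso_imp_local_iso:
  assumes "P \<in> T" "P' \<in> T" "order_iso (corona T k P) (corona T k P') f"
  shows "local_iso (tile_ball k P) f"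
  using complex_iso_imp_local_iso[of "tile_ball k P" "tile_ball k P'"] assms tile_ball_tiles
  by (simp add: corona_eq_complex)

text \<open>The image of the common facet lies in \<open>f Q = g Q\<close>, in \<open>f R\<close>
  and in \<open>g R\<close>. At most two tiles contain it, and injectivity across the facet
  separates \<open>f R\<close> and \<open>g R\<close> from the first, so they coincide. Both maps on
  \<open>R\<close> then agree on a facet and are equal.\<close>

lemma local_iso_agree_step:
  assumes D: "D \<subseteq> T" and f: "local_iso D f" and g: "local_iso D g"
    and QR: "(Q, R) \<in> facet_adj D" and agree: "\<forall>F\<in>face_lattice Q. f F = g F"
  shows "\<forall>F\<in>face_lattice R. f F = g F"
proof (cases "Q = R")
  case False
  have QT: "Q \<in> D" "R \<in> D" "Q \<in> T" "R \<in> T" and dim: "int DIM('a) - 1 \<le> aff_dim (Q \<inter> R)"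
    using QR D by (auto simp: facet_adj_def)
  let ?G = "Q \<inter> R"
  have G: "?G face_of Q" "?G face_of R"
    using QT Int_face_of_tile[of Q R] Int_face_of_tile[of R Q] by (auto simp: Int_commute)
  have "?G \<noteq> R" using tile_subset_eq[OF QT(4,3)] False by blast
  then have dimG: "aff_dim ?G = int DIM('a) - 1"
    using face_of_aff_dim_lt[OF convex_tile[OF QT(4)] G(2)] aff_dim_tile[OF QT(4)] dim by simp
  have isos: "order_iso (face_lattice X) (face_lattice (f X)) f" "order_iso (face_lattice X) (face_lattice (g X)) g"
    and tiles: "f X \<in> T" "g X \<in> T" if "X \<in> D" for X
    using f g that by (auto simp: local_iso_def)
  have fQ: "f Q = g Q" using agree tile_face_self[OF QT(3)] by (simp add: face_lattice_def)
  have fG: "f ?G = g ?G" using agree G(1) by (simp add: face_lattice_def)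
  have faceG: "f ?G face_of f Q" "f ?G face_of f R" "g ?G face_of g R"
    using order_iso_mem[OF isos(1)[OF QT(1)], of ?G] order_iso_mem[OF isos(1)[OF QT(2)], of ?G]
      order_iso_mem[OF isos(2)[OF QT(2)], of ?G] G by (auto simp: face_lattice_def)
  have "aff_dim (f ?G) = int DIM('a) - 1"
    using order_iso_faces_aff_dim[OF _ _ isos(1)[OF QT(1)] G(1)] polytope_tile tiles QT dimG by simp
  then have "f Q = f R \<or> f Q = g R \<or> f R = g R"
    using facet_in_at_most_two_tiles[OF tiles(1)[OF QT(1)] tiles(1)[OF QT(2)] tiles(2)[OF QT(2)] faceG(1,2)]
      faceG(3) fG by simp
  moreover have "f Q \<noteq> f R" "g Q \<noteq> g R" using f g QR False by (auto simp: local_iso_def)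
  ultimately have fR: "f R = g R" using fQ by simp
  show ?thesis
  proof
    fix F assume F: "F \<in> face_lattice R"
    show "f F = g F"
    proof (rule order_iso_agree_on_facet[OF polytope_tile[OF QT(4)] G(2) _ isos(1)[OF QT(2)]])
      show "order_iso (face_lattice R) (face_lattice (f R)) g" using isos(2)[OF QT(2)] fR by simp
      show "f H = g H" if "H face_of ?G" for H
        using agree face_of_trans[OF that G(1)] by (simp add: face_lattice_def)
    qed (use F dimG aff_dim_tile QT in \<open>auto simp: face_lattice_def\<close>)
  qed
qed (use agree in simp)

lemma local_iso_agree_chain:
  assumes "D \<subseteq> T" "local_iso D f" "local_iso D g" "(Q, R) \<in> (facet_adj D)\<^sup>*"
    and "\<forall>F\<in>face_lattice Q. f F = g F"
  shows "\<forall>F\<in>face_lattice R. f F = g F"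
  using assms(4,5) by (induction rule: rtrancl_induct) (use local_iso_agree_step[OF assms(1-3)] in blast)+

text \<open>A tile through a relatively interior point of \<open>Q \<inter> R\<close> contains all
  of \<open>Q \<inter> R\<close>, hence is adjacent to \<open>Q\<close>. So the facet chain around
  that point never leaves the star of \<open>Q\<close>.\<close>

lemma facet_chain_in_star:
  assumes "(Q, R) \<in> adj_rel T"
  shows "(Q, R) \<in> (facet_adj {A. (Q, A) \<in> adj_rel T})\<^sup>*"
proof (cases "Q \<inter> R = {}")
  \<comment> \<open>In dimension one the empty face has dimension \<open>d - 2\<close>, so any two tiles are adjacent.\<close>
  case True
  then have "DIM('a) \<le> 1" using assms by (simp add: adj_rel_iff)
  then have "int DIM('a) - 2 \<le> aff_dim (Q \<inter> A)" for A using aff_dim_geq[of "Q \<inter> A"] by linarith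
  then have "{A. (Q, A) \<in> adj_rel T} = T" using assms by (auto simp: adj_rel_iff)
  then show ?thesis using facet_chain_global assms by (simp add: adj_rel_iff)
next
  case False
  have QT: "Q \<in> T" "R \<in> T" and dim: "int DIM('a) - 2 \<le> aff_dim (Q \<inter> R)" using assms by (auto simp: adj_rel_iff)
  have "convex (Q \<inter> R)" using QT convex_tile by (simp add: convex_Int)
  then obtain x where x: "x \<in> rel_interior (Q \<inter> R)" using False rel_interior_eq_empty by blast
  then have xQR: "x \<in> Q" "x \<in> R" using rel_interior_subset by auto
  have "{A\<in>T. x \<in> A} \<subseteq> {A. (Q, A) \<in> adj_rel T}"
  proof
    fix A assume "A \<in> {A\<in>T. x \<in> A}"
    then have A: "A \<in> T" "x \<in> A" by auto
    have "Q \<inter> R \<subseteq> Q \<inter> A"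
      by (rule subset_of_face_of[OF Int_face_of_tile[OF QT(1) A(1)]]) (use x xQR A in auto)
    then have "aff_dim (Q \<inter> R) \<le> aff_dim (Q \<inter> A)" by (rule aff_dim_subset)
    then show "A \<in> {A. (Q, A) \<in> adj_rel T}" using QT A dim by (simp add: adj_rel_iff)
  qed
  then show ?thesis
    using facet_chain_at_point[OF QT xQR] rtrancl_mono[OF facet_adj_mono] by blast
qed

lemma facet_chain_in_tile_ball:
  assumes "P \<in> T" "Q \<in> tile_ball k P"
  shows "(P, Q) \<in> (facet_adj (tile_ball k P))\<^sup>*"
  using assms(2)
proof (induction k arbitrary: Q)
  case 0
  then show ?case by (simp add: tile_ball_0)
next
  case (Suc k)
  then obtain R where R: "R \<in> tile_ball k P" "(R, Q) \<in> adj_rel T" by (auto simp: tile_ball_Suc)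
  have "(P, R) \<in> (facet_adj (tile_ball (Suc k) P))\<^sup>*"
    using Suc.IH[OF R(1)] rtrancl_mono[OF facet_adj_mono[OF tile_ball_mono[OF assms(1), of k "Suc k"]]]
    by auto
  moreover have "{A. (R, A) \<in> adj_rel T} \<subseteq> tile_ball (Suc k) P" using R(1) by (auto simp: tile_ball_Suc)
  then have "(R, Q) \<in> (facet_adj (tile_ball (Suc k) P))\<^sup>*"
    using facet_chain_in_star[OF R(2)] rtrancl_mono[OF facet_adj_mono] by blast
  ultimately show ?case by simp
qed

text \<open>Agreement at the centre spreads along facet chains inside the ball. Hence extensions of
  corona isomorphisms are unique and restriction of corona groups is injective.\<close>

lemma corona_rigid:
  assumes "P \<in> T" "local_iso (tile_ball k P) f" "local_iso (tile_ball k P) g"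
    and "\<forall>F\<in>face_lattice P. f F = g F" "F \<in> corona T k P"
  shows "f F = g F"
proof -
  obtain Q where Q: "Q \<in> tile_ball k P" "F \<in> face_lattice Q"
    using assms(5) by (auto simp: corona_eq_complex complex_of_UN)
  then show ?thesis
    using local_iso_agree_chain[OF tile_ball_tiles[OF assms(1)] assms(2,3)
        facet_chain_in_tile_ball[OF assms(1) Q(1)] assms(4)] by blast
qed

lemma faces_rigid:
  assumes "P \<in> T" "local_iso T f" "local_iso T g"
    and "\<forall>F\<in>face_lattice P. f F = g F" "F \<in> faces T"
  shows "f F = g F"
proof -
  obtain Q where Q: "Q \<in> T" "F \<in> face_lattice Q"
    using assms(5) by (auto simp: faces_eq_complex complex_of_UN)
  then show ?thesis
    using local_iso_agree_chain[OF order_refl assms(2,3) facet_chain_global[OF assms(1) Q(1)] assms(4)] by blast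
qed

section \<open>Transport along segments\<close>

text \<open>Two tiles sharing a point off these faces meet in dimension at least \<open>d - 2\<close>, so they are adjacent.
  The complement of the union of these faces is simply connected by general position, which is what
  makes parallel transport path independent below.\<close>

definition codim3_faces :: "'a set set" where
  "codim3_faces = {F \<in> faces T. aff_dim F \<le> int DIM('a) - 3}"

lemma interior_point_in_face:
  assumes "P \<in> T" "p \<in> interior P" "F \<in> faces T" "p \<in> F"
  shows "aff_dim F = int DIM('a)"
proof -
  obtain R where R: "R \<in> T" "F face_of R" using assms(3) by (auto simp: faces_def)
  have "R = closure (interior R)"
    using convex_closure_interior[OF convex_tile[OF R(1)] interior_tile_nonempty[OF R(1)]]
      closed_tile[OF R(1)] by simp
  moreover have "p \<in> R" using R(2) assms(4) face_of_imp_subset by blast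
  ultimately have "interior P \<inter> interior R \<noteq> {}"
    using assms(2) open_Int_closure_eq_empty[of "interior P" "interior R"] by auto
  then have "P = R" using interior_tiles_disjoint assms(1) R(1) by blast
  then have "F = R" using face_of_disjoint_interior[OF R(2)] assms(2,4) by blast
  then show ?thesis using aff_dim_tile R(1) by simp
qed

end

text \<open>An abstract local system: \<open>V Q\<close> is the fibre over the tile
  \<open>Q\<close>, \<open>tr\<close> is parallel transport, and \<open>tr_tr\<close> states that
  there is no holonomy around a point off the faces of codimension three.\<close>

locale tile_transport = polytopal_tiling T
  for T :: "'a::euclidean_space set set" +
  fixes V :: "'a set \<Rightarrow> 'g \<Rightarrow> bool" and tr :: "'a set \<Rightarrow> 'a set \<Rightarrow> 'g \<Rightarrow> 'g"
  assumes tr_valid: "\<And>x Q R g. x \<notin> \<Union>codim3_faces \<Longrightarrow> Q \<in> T \<Longrightarrow> R \<in> T \<Longrightarrow> x \<in> Q \<Longrightarrow> x \<in> R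
      \<Longrightarrow> V Q g \<Longrightarrow> V R (tr Q R g)"
    and tr_tr: "\<And>x Q R S g. x \<notin> \<Union>codim3_faces \<Longrightarrow> Q \<in> T \<Longrightarrow> R \<in> T \<Longrightarrow> S \<in> T
      \<Longrightarrow> x \<in> Q \<Longrightarrow> x \<in> R \<Longrightarrow> x \<in> S \<Longrightarrow> V Q g \<Longrightarrow> tr R S (tr Q R g) = tr Q S g"
    and tr_id: "\<And>Q g. Q \<in> T \<Longrightarrow> V Q g \<Longrightarrow> tr Q Q g = g"
begin

text \<open>A parallel section along \<open>K\<close>. Values belong to tiles instead of points,
  which suits segments: a convex tile meets a segment in an interval and is never entered twice.
  Only tiles that meet \<open>K\<close> are constrained.\<close>

definition flat_on :: "'a set \<Rightarrow> ('a set \<Rightarrow> 'g) \<Rightarrow> bool" where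
  "flat_on K f \<longleftrightarrow> (\<forall>Q\<in>T. Q \<inter> K \<noteq> {} \<longrightarrow> V Q (f Q))
     \<and> (\<forall>Q\<in>T. \<forall>R\<in>T. Q \<inter> R \<inter> K \<noteq> {} \<longrightarrow> f R = tr Q R (f Q))"

lemma flat_onD:
  assumes "flat_on K f" "x \<in> K" "Q \<in> T" "x \<in> Q"
  shows "V Q (f Q)" "R \<in> T \<Longrightarrow> x \<in> R \<Longrightarrow> f R = tr Q R (f Q)"
  using assms unfolding flat_on_def by blast+

text \<open>Inclusion of \<open>K'\<close> in \<open>K\<close> is not demanded, only that
  \<open>K'\<close> meets no further faces. A section along a segment thereby serves for a slightly
  perturbed segment too.\<close>

lemma flat_on_mono:
  assumes "flat_on K f" "\<And>F. F \<in> faces T \<Longrightarrow> F \<inter> K' \<noteq> {} \<Longrightarrow> F \<inter> K \<noteq> {}"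
  shows "flat_on K' f"
proof -
  have "Q \<inter> R \<in> faces T" if "Q \<in> T" "R \<in> T" for Q R
    using Int_face_of_tile that by (auto simp: faces_def)
  then show ?thesis using assms tile_in_faces unfolding flat_on_def by meson
qed

lemma flat_on_unique:
  assumes "connected K" "flat_on K f" "flat_on K f'"
    and "p \<in> K" "P \<in> T" "p \<in> P" "f P = f' P" and "x \<in> K" "Q \<in> T" "x \<in> Q"
  shows "f Q = f' Q"
proof -
  let ?Z = "\<lambda>x. \<forall>R\<in>T. x \<in> R \<longrightarrow> f R = f' R"
  have spread: "f R' = f' R'"
    if "y \<in> K" "R \<in> T" "y \<in> R" "f R = f' R" "R' \<in> T" "y \<in> R'" for y R R'
    using flat_onD(2)[OF assms(2) that(1,2,3,5,6)] flat_onD(2)[OF assms(3) that(1,2,3,5,6)] that(4) by simp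
  have "?Z x"
  proof (rule connected_induction_balls[where P = ?Z, OF assms(1,4,8)])
    show "?Z p" using spread[OF assms(4,5,6,7)] by blast
  next
    fix y assume y: "y \<in> K"
    obtain \<epsilon> where \<epsilon>: "\<epsilon> > 0" "\<And>R. R \<in> T \<Longrightarrow> R \<inter> ball y \<epsilon> \<noteq> {} \<Longrightarrow> y \<in> R"
      using ball_meets_only_tiles_at_center by blast
    have "?Z b" if a: "a \<in> K \<inter> ball y \<epsilon>" and b: "b \<in> K \<inter> ball y \<epsilon>" and Za: "?Z a" for a b
    proof (intro ballI impI)
      fix R' assume R': "R' \<in> T" "b \<in> R'"
      obtain R where R: "R \<in> T" "a \<in> R" using Union_tiles by blast
      have "y \<in> R" "y \<in> R'" using \<epsilon>(2) R R' a b by blast+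
      then show "f R' = f' R'" using spread[OF y R(1) _ _ R'(1)] Za R by blast
    qed
    then show "\<exists>\<epsilon>>0. \<forall>x\<in>K \<inter> ball y \<epsilon>. \<forall>z\<in>K \<inter> ball y \<epsilon>. ?Z x \<longrightarrow> ?Z z"
      by (intro exI[of _ \<epsilon>] conjI \<epsilon>(1)) blast
  qed
  then show ?thesis using assms by blast
qed

text \<open>All tiles met between \<open>a\<close> and \<open>b\<close> contain the single point
  \<open>y\<close>. New tiles receive their value by transport from a tile \<open>Q\<close> at
  \<open>\<gamma> a\<close>, and absence of holonomy at \<open>y\<close> makes these values
  consistent.\<close>

lemma flat_on_segment_extend:
  fixes \<gamma> :: "real \<Rightarrow> 'a"
  assumes \<gamma>: "\<And>t. \<gamma> t = (1 - t) *\<^sub>R p + t *\<^sub>R q" and P: "P \<in> T" "p \<in> P"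
    and ab: "0 \<le> a" "a \<le> b"
    and f: "flat_on (\<gamma> ` {0..a}) f" "f P = g"
    and y: "y \<notin> \<Union>codim3_faces" "\<And>u R. a \<le> u \<Longrightarrow> u \<le> b \<Longrightarrow> R \<in> T \<Longrightarrow> \<gamma> u \<in> R \<Longrightarrow> y \<in> R"
  shows "\<exists>f. flat_on (\<gamma> ` {0..b}) f \<and> f P = g"
proof -
  obtain Q where Q: "Q \<in> T" "\<gamma> a \<in> Q" using Union_tiles by blast
  have ya: "\<gamma> a \<in> \<gamma> ` {0..a}" using ab by simp
  define f' where "f' R = (if R \<inter> \<gamma> ` {0..a} \<noteq> {} then f R else tr Q R (f Q))" for R
  have old: "f' R = f R" if "\<gamma> u \<in> R" "0 \<le> u" "u \<le> a" for u R
    using that by (auto simp: f'_def)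
  have VQ: "V Q (f Q)" using flat_onD(1)[OF f(1) ya Q] .
  have yQ: "y \<in> Q" using y(2)[of a Q] Q ab by simp
  \<comment> \<open>A tile met both up to \<open>a\<close> and after \<open>a\<close> is met at
    \<open>a\<close> by convexity, so its old value already equals the transport from
    \<open>Q\<close> and no conflict arises.\<close>
  have between: "\<gamma> a \<in> R" if "R \<in> T" "\<gamma> v \<in> R" "v \<le> a" "\<gamma> u \<in> R" "a \<le> u" for R u v
  proof -
    have "convex {t. \<gamma> t \<in> R}"
    proof (rule convexI)
      fix s t \<mu> \<nu> :: real
      assume *: "s \<in> {t. \<gamma> t \<in> R}" "t \<in> {t. \<gamma> t \<in> R}" "0 \<le> \<mu>" "0 \<le> \<nu>" "\<mu> + \<nu> = 1"
      have "\<mu> *\<^sub>R \<gamma> s + \<nu> *\<^sub>R \<gamma> t \<in> R"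
        using convexD[OF convex_tile[OF that(1)]] * by blast
      moreover have "\<mu> *\<^sub>R \<gamma> s + \<nu> *\<^sub>R \<gamma> t = (\<mu> + \<nu> - (\<mu> * s + \<nu> * t)) *\<^sub>R p + (\<mu> * s + \<nu> * t) *\<^sub>R q"
        unfolding \<gamma> by (simp add: algebra_simps)
      ultimately show "\<mu> *\<^sub>R s + \<nu> *\<^sub>R t \<in> {t. \<gamma> t \<in> R}" unfolding \<gamma> using *(5) by simp
    qed
    then have "is_interval {t. \<gamma> t \<in> R}" by (simp add: is_interval_convex_1)
    then show ?thesis using that unfolding is_interval_1 by blast
  qed
  have new: "f' R = tr Q R (f Q)" "y \<in> R" if R: "R \<in> T" "\<gamma> u \<in> R" "a \<le> u" "u \<le> b" for u R
  proof -
    show "y \<in> R" using y(2) R by blast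
    show "f' R = tr Q R (f Q)"
    proof (cases "R \<inter> \<gamma> ` {0..a} = {}")
      case False
      then obtain v where v: "v \<le> a" "\<gamma> v \<in> R" by auto
      then have "\<gamma> a \<in> R" using between R by blast
      then have "f R = tr Q R (f Q)" using flat_onD(2)[OF f(1) ya Q R(1)] by blast
      then show ?thesis using False by (simp add: f'_def)
    qed (simp add: f'_def)
  qed
  have "V R (f' R)" if R: "R \<in> T" "R \<inter> \<gamma> ` {0..b} \<noteq> {}" for R
  proof -
    obtain u where u: "0 \<le> u" "u \<le> b" "\<gamma> u \<in> R" using R(2) by auto
    show ?thesis
    proof (cases "u \<le> a")
      case True
      then show ?thesis using old[OF u(3,1)] flat_onD(1)[OF f(1) _ R(1) u(3)] u by simp
    next
      case False
      then show ?thesis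
        using new[OF R(1) u(3) _ u(2)] tr_valid[OF y(1) Q(1) R(1) yQ _ VQ] by simp
    qed
  qed
  moreover have "f' S = tr R S (f' R)" if RS: "R \<in> T" "S \<in> T" "R \<inter> S \<inter> \<gamma> ` {0..b} \<noteq> {}" for R S
  proof -
    obtain u where u: "0 \<le> u" "u \<le> b" "\<gamma> u \<in> R" "\<gamma> u \<in> S" using RS(3) by auto
    show ?thesis
    proof (cases "u \<le> a")
      case True
      then show ?thesis
        using old[OF u(3,1)] old[OF u(4,1)] flat_onD(2)[OF f(1) _ RS(1) u(3) RS(2) u(4)] u by simp
    next
      case False
      then show ?thesis
        using new[OF RS(1) u(3) _ u(2)] new[OF RS(2) u(4) _ u(2)]
          tr_tr[OF y(1) Q(1) RS(1,2) yQ _ _ VQ] by simp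
    qed
  qed
  ultimately have "flat_on (\<gamma> ` {0..b}) f'" unfolding flat_on_def by blast
  moreover have "\<gamma> 0 \<in> P" using P(2) unfolding \<gamma> by simp
  then have "f' P = g" using old[of 0 P] ab(1) f(2) by simp
  ultimately show ?thesis by (intro exI[of _ f'] conjI)
qed

lemma flat_on_segment_exists:
  assumes avoid: "closed_segment p q \<inter> \<Union>codim3_faces = {}" and P: "P \<in> T" "p \<in> P" "V P g"
  obtains f where "flat_on (closed_segment p q) f" "f P = g"
proof -
  define \<gamma> where "\<gamma> t = (1 - t) *\<^sub>R p + t *\<^sub>R q" for t :: real
  have seg: "closed_segment p q = \<gamma> ` {0..1}" by (auto simp: \<gamma>_def closed_segment_image_interval)
  let ?Z = "\<lambda>t. \<exists>f. flat_on (\<gamma> ` {0..t}) f \<and> f P = g"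
  have Z_mono: "?Z t" if "?Z s" "t \<le> s" for s t
  proof -
    obtain f where f: "flat_on (\<gamma> ` {0..s}) f" "f P = g" using \<open>?Z s\<close> by blast
    have "\<gamma> ` {0..t} \<subseteq> \<gamma> ` {0..s}" using \<open>t \<le> s\<close> by (intro image_mono) auto
    then have "flat_on (\<gamma> ` {0..t}) f" by (intro flat_on_mono[OF f(1)]) blast
    then show ?thesis using f(2) by blast
  qed
  have "?Z 1"
  proof (rule connected_induction_balls[where P = ?Z and K = "{0..1::real}" and a = 0 and b = 1])
    have p: "p \<notin> \<Union>codim3_faces" using avoid by auto
    have "flat_on {p} (\<lambda>R. tr P R g)"
      unfolding flat_on_def using tr_valid[OF p P(1) _ P(2) _ P(3)] tr_tr[OF p P(1) _ _ P(2) _ _ P(3)] by auto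
    moreover have "\<gamma> ` {0..0} = {p}" by (simp add: \<gamma>_def)
    ultimately show "?Z 0" using tr_id[OF P(1,3)] by auto
  next
    fix t :: real assume t: "t \<in> {0..1}"
    \<comment> \<open>Close to parameter \<open>t\<close> only tiles through
      \<open>\<gamma> t\<close> are met; this point takes the role of \<open>y\<close> in the
      extension step.\<close>
    obtain \<epsilon> where \<epsilon>: "\<epsilon> > 0" "\<And>R. R \<in> T \<Longrightarrow> R \<inter> ball (\<gamma> t) \<epsilon> \<noteq> {} \<Longrightarrow> \<gamma> t \<in> R"
      using ball_meets_only_tiles_at_center by blast
    have "isCont \<gamma> t" unfolding \<gamma>_def by (intro continuous_intros)
    then obtain \<delta> where \<delta>: "\<delta> > 0" "\<And>s. dist s t < \<delta> \<Longrightarrow> dist (\<gamma> s) (\<gamma> t) < \<epsilon>"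
      using \<epsilon>(1) unfolding continuous_at_eps_delta by blast
    have yS: "\<gamma> t \<notin> \<Union>codim3_faces" using avoid t unfolding seg by blast
    have "?Z b" if a: "a \<in> {0..1} \<inter> ball t \<delta>" and b: "b \<in> {0..1} \<inter> ball t \<delta>" and Za: "?Z a" for a b
    proof (cases "b \<le> a")
      case True
      then show ?thesis using Z_mono[OF Za] by blast
    next
      case False
      obtain f where f: "flat_on (\<gamma> ` {0..a}) f" "f P = g" using Za by blast
      show ?thesis
      proof (rule flat_on_segment_extend[OF \<gamma>_def P(1,2) _ _ f yS])
        fix u R assume u: "a \<le> u" "u \<le> b" "R \<in> T" "\<gamma> u \<in> R"
        have "dist u t < \<delta>" using a b u by (auto simp: dist_real_def)
        then have "\<gamma> u \<in> R \<inter> ball (\<gamma> t) \<epsilon>" using \<delta>(2)[of u] u(4) by (simp add: dist_commute)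
        then show "\<gamma> t \<in> R" using \<epsilon>(2)[OF u(3)] by blast
      qed (use a False in auto)
    qed
    then show "\<exists>\<epsilon>>0. \<forall>x\<in>{0..1} \<inter> ball t \<epsilon>. \<forall>z\<in>{0..1} \<inter> ball t \<epsilon>. ?Z x \<longrightarrow> ?Z z"
      by (intro exI[of _ \<delta>] conjI \<delta>(1)) blast
  qed auto
  then show ?thesis using that seg by auto
qed

text \<open>The section at a tile is read off at any of its points visible from \<open>p\<close>.
  The shadow of the small faces has dimension at most \<open>d - 2\<close>, so every facet contains
  a visible point where two neighbours can be compared, whereas a smaller common face may lie wholly
  in the shadow. Hence compatibility is claimed across facets only.\<close>

lemma flat_section_exists:
  assumes P: "P \<in> T" "V P g"
  shows "\<exists>f. f P = g \<and> (\<forall>Q\<in>T. V Q (f Q)) \<and> (\<forall>(Q, R)\<in>facet_adj T. f R = tr Q R (f Q))"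
proof -
  obtain p where p: "p \<in> interior P" using interior_tile_nonempty[OF P(1)] by blast
  then have pP: "p \<in> P" using interior_subset by blast
  have p_off: "p \<notin> F" if "F \<in> codim3_faces" for F
    using interior_point_in_face[OF P(1) p, of F] that by (auto simp: codim3_faces_def)
  define U where "U = {q. closed_segment p q \<inter> \<Union>codim3_faces = {}}"
  have finite_shadow: "finite {F \<in> codim3_faces. F \<inter> B \<noteq> {}}" if "bounded B" for B
    by (rule finite_subset[OF _ finite_faces_meeting_bounded[OF that]]) (auto simp: codim3_faces_def)
  have pick: "\<exists>q. q \<in> K \<and> q \<in> U"
    if K: "convex K" "K \<noteq> {}" "bounded K" "int DIM('a) - 1 \<le> aff_dim K" for K
  proof -
    \<comment> \<open>Only faces meeting this hull can block a segment from \<open>p\<close> to a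
      point of \<open>K\<close>; boundedness leaves finitely many of them.\<close>
    let ?B = "convex hull (insert p K)"
    have "bounded ?B" using K(3) by (simp add: bounded_convex_hull)
    then have fin: "finite (insert p ` {F \<in> codim3_faces. F \<inter> ?B \<noteq> {}})" using finite_shadow by blast
    have dim: "aff_dim A < aff_dim K" if A: "A \<in> insert p ` {F \<in> codim3_faces. F \<inter> ?B \<noteq> {}}" for A
    proof -
      obtain F where F: "F \<in> codim3_faces" "A = insert p F" using A by blast
      have "aff_dim (insert p F) \<le> aff_dim F + 1" by (rule aff_dim_insert_le)
      then show ?thesis using F K(4) by (simp add: codim3_faces_def)
    qed
    obtain q where q: "q \<in> K" "\<And>A. A \<in> insert p ` {F \<in> codim3_faces. F \<inter> ?B \<noteq> {}} \<Longrightarrow> q \<notin> affine hull A"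
      using convex_point_off_affine_hulls[OF fin K(1,2) dim] by blast
    have "q \<in> U"
    proof (rule ccontr)
      assume "q \<notin> U"
      then obtain F w where F: "F \<in> codim3_faces" "w \<in> F" "w \<in> closed_segment p q" by (auto simp: U_def)
      have "closed_segment p q \<subseteq> ?B" using q(1) hull_inc[of _ "insert p K" convex]
        by (intro closed_segment_subset convex_convex_hull) auto
      then have "insert p F \<in> insert p ` {F \<in> codim3_faces. F \<inter> ?B \<noteq> {}}" using F by blast
      then show False using q(2) segment_end_in_affine_hull[OF F(3,2) p_off[OF F(1)]] by blast
    qed
    then show ?thesis using q(1) by blast
  qed
  define fq where "fq q = (SOME f. flat_on (closed_segment p q) f \<and> f P = g)" for q
  have fq: "flat_on (closed_segment p q) (fq q)" "fq q P = g" if q: "q \<in> U" for q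
  proof -
    obtain f where "flat_on (closed_segment p q) f \<and> f P = g"
      using flat_on_segment_exists[of p q P g] P pP q by (auto simp: U_def)
    then have "\<exists>f. flat_on (closed_segment p q) f \<and> f P = g" by blast
    from someI_ex[OF this] show "flat_on (closed_segment p q) (fq q)" "fq q P = g" unfolding fq_def by blast+
  qed
  have locally_const: "\<exists>\<epsilon>>0. \<forall>q'\<in>ball q \<epsilon>. q' \<in> U \<and> (\<forall>Q\<in>T. q' \<in> Q \<longrightarrow> fq q' Q = fq q Q)"
    if q: "q \<in> U" for q
  proof -
    obtain \<delta> where \<delta>: "\<delta> > 0"
      "\<And>F x y. F \<in> faces T \<Longrightarrow> F \<inter> closed_segment p q = {} \<Longrightarrow> x \<in> F \<Longrightarrow> y \<in> closed_segment p q \<Longrightarrow> \<delta> \<le> dist x y"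
      using faces_separated_from_compact[OF compact_segment] by blast
    \<comment> \<open>Points with equal parameter on the two segments are less than
      \<open>\<delta>\<close> apart, so the perturbed segment meets no new face. The section for
      \<open>q\<close> is then flat along the segment to \<open>q'\<close>, and uniqueness
      identifies it with the section for \<open>q'\<close>.\<close>
    have near: "F \<inter> closed_segment p q \<noteq> {}"
      if q': "q' \<in> ball q \<delta>" and F: "F \<in> faces T" "F \<inter> closed_segment p q' \<noteq> {}" for q' F
    proof
      assume empty: "F \<inter> closed_segment p q = {}"
      obtain w where w: "w \<in> F" "w \<in> closed_segment p q'" using F(2) by blast
      then obtain t where t: "0 \<le> t" "t \<le> 1" "w = (1 - t) *\<^sub>R p + t *\<^sub>R q'" by (auto simp: in_segment)
      have "(1 - t) *\<^sub>R p + t *\<^sub>R q \<in> closed_segment p q" using t by (auto simp: in_segment)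
      then have "\<delta> \<le> dist w ((1 - t) *\<^sub>R p + t *\<^sub>R q)" using \<delta>(2)[OF F(1) empty w(1)] by blast
      also have "\<dots> = norm (t *\<^sub>R (q' - q))" unfolding t(3) dist_norm by (simp add: algebra_simps)
      also have "\<dots> \<le> 1 * norm (q' - q)" unfolding norm_scaleR using t by (intro mult_right_mono) auto
      also have "\<dots> < \<delta>" using q' by (simp add: dist_norm norm_minus_commute)
      finally show False by simp
    qed
    have "q' \<in> U \<and> (\<forall>Q\<in>T. q' \<in> Q \<longrightarrow> fq q' Q = fq q Q)" if q': "q' \<in> ball q \<delta>" for q'
    proof -
      have q'U: "q' \<in> U"
      proof (rule ccontr)
        assume "q' \<notin> U"
        then obtain F where F: "F \<in> codim3_faces" "F \<inter> closed_segment p q' \<noteq> {}" by (auto simp: U_def)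
        then have "F \<inter> closed_segment p q \<noteq> {}" using near[OF q'] by (auto simp: codim3_faces_def)
        then show False using q F(1) by (auto simp: U_def)
      qed
      moreover have "flat_on (closed_segment p q') (fq q)"
        using flat_on_mono[OF fq(1)[OF q]] near[OF q'] by blast
      then have "fq q' Q = fq q Q" if "Q \<in> T" "q' \<in> Q" for Q
        using flat_on_unique[of "closed_segment p q'" "fq q'" "fq q" p P q' Q]
          fq[OF q'U] fq(2)[OF q] P(1) pP that by simp
      ultimately show ?thesis by blast
    qed
    then show ?thesis using \<delta>(1) by blast
  qed
  have segment_const: "fq x Q = fq y Q"
    if Q: "Q \<in> T" "x \<in> Q" "y \<in> Q" and sub: "closed_segment x y \<subseteq> U" for x y Q
  proof -
    have inQ: "closed_segment x y \<subseteq> Q" using Q convex_tile closed_segment_subset by blast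
    show ?thesis
    proof (rule connected_induction_balls[where P = "\<lambda>w. fq x Q = fq w Q", OF connected_segment(1)[of x y]])
      fix w assume w: "w \<in> closed_segment x y"
      then obtain \<epsilon> where \<epsilon>: "\<epsilon> > 0" "\<And>q' Q. q' \<in> ball w \<epsilon> \<Longrightarrow> Q \<in> T \<Longrightarrow> q' \<in> Q \<Longrightarrow> fq q' Q = fq w Q"
        using locally_const[of w] sub by blast
      have "fq a Q = fq w Q" if "a \<in> closed_segment x y \<inter> ball w \<epsilon>" for a
        using \<epsilon>(2)[of a Q] that inQ Q(1) by blast
      then show "\<exists>\<epsilon>>0. \<forall>a\<in>closed_segment x y \<inter> ball w \<epsilon>. \<forall>b\<in>closed_segment x y \<inter> ball w \<epsilon>.
          fq x Q = fq a Q \<longrightarrow> fq x Q = fq b Q"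
        using \<epsilon>(1) by (intro exI[of _ \<epsilon>]) simp
    qed auto
  qed
  have tile_const: "fq x Q = fq y Q" if Q: "Q \<in> T" and xy: "x \<in> Q" "y \<in> Q" "x \<in> U" "y \<in> U" for x y Q
  proof -
    \<comment> \<open>The exact set of blocked end points rather than the affine hull of
      \<open>insert p F\<close>: points of \<open>U\<close> avoid the former but may lie in the
      latter, and \<open>x\<close>, \<open>y\<close> are only known to be in
      \<open>U\<close>.\<close>
    define shadow where "shadow F = {v. closed_segment p v \<inter> F \<noteq> {}}" for F
    let ?B = "convex hull (insert p Q)"
    let ?\<A> = "shadow ` {F \<in> codim3_faces. F \<inter> ?B \<noteq> {}}"
    have "bounded ?B" using compact_tile[OF Q] by (simp add: bounded_convex_hull compact_imp_bounded)
    then have fin: "finite ?\<A>" using finite_shadow by blast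
    have dim: "aff_dim A + 2 \<le> aff_dim Q" if A: "A \<in> ?\<A>" for A
    proof -
      obtain F where F: "F \<in> codim3_faces" "A = shadow F" using A by blast
      have "shadow F \<subseteq> affine hull (insert p F)"
        using segment_end_in_affine_hull[OF _ _ p_off[OF F(1)]] by (auto simp: shadow_def)
      then have "aff_dim (shadow F) \<le> aff_dim (insert p F)" by (metis aff_dim_affine_hull aff_dim_subset)
      also have "\<dots> \<le> aff_dim F + 1" by (rule aff_dim_insert_le)
      finally show ?thesis using F aff_dim_tile[OF Q] by (simp add: codim3_faces_def)
    qed
    have off: "v \<notin> \<Union>?\<A>" if "v \<in> U" for v using that by (auto simp: U_def shadow_def)
    obtain z where z: "z \<in> Q" "(closed_segment x z \<union> closed_segment z y) \<inter> \<Union>?\<A> = {}"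
      using two_segments_avoiding[OF fin convex_tile[OF Q] xy(1,2) off[OF xy(3)] off[OF xy(4)] dim] by blast
    have inU: "w \<in> U" if w: "w \<in> closed_segment x z \<union> closed_segment z y" for w
    proof (rule ccontr)
      assume "w \<notin> U"
      then obtain F where F: "F \<in> codim3_faces" "closed_segment p w \<inter> F \<noteq> {}" by (auto simp: U_def)
      have "w \<in> Q"
        using w closed_segment_subset[OF xy(1) z(1) convex_tile[OF Q]]
          closed_segment_subset[OF z(1) xy(2) convex_tile[OF Q]] by blast
      then have "closed_segment p w \<subseteq> ?B" using hull_inc[of _ "insert p Q" convex]
        by (intro closed_segment_subset convex_convex_hull) auto
      then have "shadow F \<in> ?\<A>" using F by blast
      moreover have "w \<in> shadow F" using F(2) by (simp add: shadow_def)
      ultimately show False using z(2) w by blast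
    qed
    have "fq x Q = fq z Q" by (rule segment_const[OF Q xy(1) z(1)]) (use inU in blast)
    also have "\<dots> = fq y Q" by (rule segment_const[OF Q z(1) xy(2)]) (use inU in blast)
    finally show ?thesis .
  qed
  define s where "s Q = (SOME q. q \<in> Q \<and> q \<in> U)" for Q
  have s: "s Q \<in> Q" "s Q \<in> U" if "Q \<in> T" for Q
  proof -
    have "\<exists>q. q \<in> Q \<and> q \<in> U"
    proof (rule pick)
      show "Q \<noteq> {}" using interior_tile_nonempty[OF that] by auto
    qed (use that convex_tile compact_tile aff_dim_tile compact_imp_bounded in auto)
    from someI_ex[OF this] show "s Q \<in> Q" "s Q \<in> U" unfolding s_def by blast+
  qed
  show ?thesis
  proof (intro exI[of _ "\<lambda>Q. fq (s Q) Q"] conjI ballI)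
    show "fq (s P) P = g" using fq(2) s P by blast
    show "V Q (fq (s Q) Q)" if "Q \<in> T" for Q
      using flat_onD(1)[OF fq(1)[OF s(2)[OF that]] _ that s(1)[OF that]] by simp
    show "case x of (Q, R) \<Rightarrow> fq (s R) R = tr Q R (fq (s Q) Q)" if "x \<in> facet_adj T" for x
    proof -
      obtain Q R where x: "x = (Q, R)" by fastforce
      have QR: "Q \<in> T" "R \<in> T" "int DIM('a) - 1 \<le> aff_dim (Q \<inter> R)" using that x by (auto simp: facet_adj_def)
      have "\<exists>q. q \<in> Q \<inter> R \<and> q \<in> U"
      proof (rule pick)
        show "convex (Q \<inter> R)" using QR convex_tile by (simp add: convex_Int)
        show "Q \<inter> R \<noteq> {}" using QR(3) by auto
        show "bounded (Q \<inter> R)" using compact_tile[OF QR(1)] by (simp add: bounded_Int compact_imp_bounded)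
      qed (use QR in simp)
      then obtain q where q: "q \<in> Q" "q \<in> R" "q \<in> U" by blast
      have "fq q R = tr Q R (fq q Q)"
        using flat_onD(2)[OF fq(1)[OF q(3)] _ QR(1) q(1) QR(2) q(2)] by simp
      moreover have "fq q R = fq (s R) R" "fq q Q = fq (s Q) Q"
        using tile_const s q QR by blast+
      ultimately show ?thesis using x by simp
    qed
  qed
qed

end

section \<open>Automorphisms of coronas and of the tiling\<close>

context polytopal_tiling
begin

lemma nonempty_face_of_tile_at_rel_interior:
  assumes "Q \<in> T" "R \<in> T" "F face_of Q" "x \<in> rel_interior F" "x \<in> R"
  shows "F face_of R"
proof -
  have "F \<subseteq> Q \<inter> R"
  proof (rule subset_of_face_of[OF Int_face_of_tile[OF assms(1,2)]])
    show "F \<subseteq> Q" using assms(3) face_of_imp_subset by blast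
    then show "Q \<inter> R \<inter> rel_interior F \<noteq> {}" using assms(4,5) rel_interior_subset by blast
  qed
  then show ?thesis using face_of_tile_if_subset assms by blast
qed

lemma local_isoD:
  assumes "local_iso D f" "Q \<in> D"
  shows "f Q \<in> T" "order_iso (face_lattice Q) (face_lattice (f Q)) f"
  using assms by (auto simp: local_iso_def)

lemma local_iso_face:
  assumes "local_iso T f" "F \<in> faces T"
  shows "f F \<in> faces T"
proof -
  obtain Q where Q: "Q \<in> T" "F \<in> face_lattice Q" using assms(2) by (auto simp: faces_def face_lattice_def)
  then show ?thesis
    using order_iso_mem[OF local_isoD(2)[OF assms(1) Q(1)] Q(2)] local_isoD(1)[OF assms(1) Q(1)]
    by (auto simp: faces_def face_lattice_def)
qed

lemma local_iso_mono_faces: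
  assumes "local_iso T f" "F \<in> faces T" "G \<in> faces T" "F \<subseteq> G"
  shows "f F \<subseteq> f G"
proof -
  obtain Q R where Q: "Q \<in> T" "G face_of Q" and R: "R \<in> T" "F face_of R"
    using assms(2,3) by (auto simp: faces_def)
  have "F face_of Q"
    using face_of_tile_if_subset[OF R(2,1) Q(1)] face_of_imp_subset[OF Q(2)] assms(4) by blast
  then show ?thesis
    using order_iso_subset_iff[OF local_isoD(2)[OF assms(1) Q(1)]] Q(2) assms(4) by (simp add: face_lattice_def)
qed

lemma local_iso_facet_adj:
  assumes "local_iso T f" "(Q, R) \<in> facet_adj T"
  shows "(f Q, f R) \<in> facet_adj T"
proof -
  have QR: "Q \<in> T" "R \<in> T" "int DIM('a) - 1 \<le> aff_dim (Q \<inter> R)" using assms(2) by (auto simp: facet_adj_def)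
  note isoQ = local_isoD[OF assms(1) QR(1)]
  have faces: "Q \<inter> R face_of Q" "Q \<inter> R \<in> faces T" using Int_face_of_tile QR by (auto simp: faces_def)
  have "aff_dim (f (Q \<inter> R)) = aff_dim (Q \<inter> R)"
    using order_iso_faces_aff_dim[OF polytope_tile[OF QR(1)] polytope_tile[OF isoQ(1)] isoQ(2) faces(1)] .
  moreover have "f (Q \<inter> R) \<subseteq> f Q \<inter> f R"
    using local_iso_mono_faces[OF assms(1) faces(2)] tile_in_faces QR by simp
  then have "aff_dim (f (Q \<inter> R)) \<le> aff_dim (f Q \<inter> f R)" by (rule aff_dim_subset)
  ultimately show ?thesis using QR local_isoD(1)[OF assms(1)] by (simp add: facet_adj_def)
qed

lemma local_iso_comp:
  assumes f: "local_iso T f" and g: "local_iso T g"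
  shows "local_iso T (\<lambda>F. g (f F))"
  unfolding local_iso_def
proof (intro conjI ballI)
  fix Q assume Q: "Q \<in> T"
  show "g (f Q) \<in> T" using local_isoD(1)[OF g] local_isoD(1)[OF f Q] by blast
  show "order_iso (face_lattice Q) (face_lattice (g (f Q))) (\<lambda>F. g (f F))"
    using order_iso_comp[OF local_isoD(2)[OF f Q] local_isoD(2)[OF g local_isoD(1)[OF f Q]]] .
next
  fix p assume p: "p \<in> facet_adj T"
  then obtain Q R where QR: "p = (Q, R)" "(Q, R) \<in> facet_adj T" by (cases p) auto
  have "f Q = f R" if "g (f Q) = g (f R)"
    using g local_iso_facet_adj[OF f QR(2)] that by (auto simp: local_iso_def)
  then show "case p of (Q, R) \<Rightarrow> g (f Q) = g (f R) \<longrightarrow> Q = R"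
    using f QR by (auto simp: local_iso_def)
qed

lemma local_iso_id: "local_iso T (\<lambda>F. F)"
  by (auto simp: local_iso_def order_iso_id)

text \<open>Each composite is again a local isomorphism and agrees with the identity on one tile;
  rigidity makes it the identity on all faces. This supplies the global injectivity and surjectivity
  that gluing does not provide.\<close>

lemma local_iso_inverse_imp_order_iso:
  assumes f: "local_iso T f" and g: "local_iso T g"
    and P: "P \<in> T" "\<And>F. F \<in> face_lattice P \<Longrightarrow> g (f F) = F"
    and P': "P' \<in> T" "\<And>F. F \<in> face_lattice P' \<Longrightarrow> f (g F) = F"
  shows "order_iso (faces T) (faces T) f"
proof -
  have gf: "g (f F) = F" if "F \<in> faces T" for F
    using faces_rigid[OF P(1) local_iso_comp[OF f g] local_iso_id _ that] P(2) by blast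
  have fg: "f (g F) = F" if "F \<in> faces T" for F
    using faces_rigid[OF P'(1) local_iso_comp[OF g f] local_iso_id _ that] P'(2) by blast
  have "bij_betw f (faces T) (faces T)"
    by (rule bij_betw_byWitness[of _ g])
       (use gf fg local_iso_face[OF f] local_iso_face[OF g] in auto)
  moreover have "F \<subseteq> G \<longleftrightarrow> f F \<subseteq> f G" if FG: "F \<in> faces T" "G \<in> faces T" for F G
    using local_iso_mono_faces[OF f FG] local_iso_mono_faces[OF g local_iso_face[OF f FG(1)] local_iso_face[OF f FG(2)]]
      gf[OF FG(1)] gf[OF FG(2)] by auto
  ultimately show ?thesis by (simp add: order_iso_def)
qed

lemma comb_aut_restrict_corona:
  assumes "order_iso (faces T) (faces T) f" "P \<in> T"
  shows "f P \<in> T" "order_iso (corona T k P) (corona T k (f P)) f"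
proof -
  have iso: "order_iso (complex_of T) (complex_of T) f" using assms(1) by (simp add: faces_eq_complex)
  show fP: "f P \<in> T" by (rule complex_iso_tile[OF order_refl order_refl iso assms(2)])
  show "order_iso (corona T k P) (corona T k (f P)) f"
    by (rule complex_iso_corona[OF order_refl order_refl iso assms(2) tile_ball_tiles[OF assms(2)] tile_ball_tiles[OF fP]])
qed

lemma comb_aut_local_iso: "order_iso (faces T) (faces T) f \<Longrightarrow> local_iso T f"
  using complex_iso_imp_local_iso[of T T f] by (simp add: faces_eq_complex)

lemma face_lattice_subset_corona: "P \<in> T \<Longrightarrow> face_lattice P \<subseteq> corona T k P"
  using face_lattice_subset_complex[OF tile_ball_center] by (simp add: corona_eq_complex)

lemma restrict_order_iso: "order_iso A B f \<Longrightarrow> order_iso A B (restrict f A)"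
  using order_iso_cong[of A "restrict f A" f B] by simp

lemma corona_aut_rigid:
  assumes "P \<in> T" "\<alpha> \<in> corona_aut T k P" "\<beta> \<in> corona_aut T k P"
    and "\<And>F. F \<in> face_lattice P \<Longrightarrow> \<alpha> F = \<beta> F"
  shows "\<alpha> = \<beta>"
proof (rule extensionalityI[of _ "corona T k P"])
  have iso: "order_iso (corona T k P) (corona T k P) \<alpha>" "order_iso (corona T k P) (corona T k P) \<beta>"
    using assms by (auto simp: corona_aut_def)
  show "\<alpha> F = \<beta> F" if "F \<in> corona T k P" for F
    using corona_rigid[OF assms(1) corona_iso_imp_local_iso[OF assms(1,1) iso(1)]
        corona_iso_imp_local_iso[OF assms(1,1) iso(2)] _ that] assms(4) by blast
qed (use assms in \<open>auto simp: corona_aut_def\<close>)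

lemma restrict_corona_aut:
  assumes "P \<in> T" "\<alpha> \<in> corona_aut T k P" "j \<le> k"
  shows "restrict \<alpha> (corona T j P) \<in> corona_aut T j P"
proof -
  have "order_iso (corona T j P) (corona T j P) \<alpha>"
    using corona_iso_restrict[OF assms(1,1) _ _ assms(3)] assms(2) by (auto simp: corona_aut_def)
  then show ?thesis
    using restrict_order_iso assms center_in_corona[OF assms(1)] by (auto simp: corona_aut_def)
qed

lemma inj_on_restrict_corona_aut:
  assumes "P \<in> T" "j \<le> k"
  shows "inj_on (\<lambda>\<alpha>. restrict \<alpha> (corona T j P)) (corona_aut T k P)"
proof (rule inj_onI)
  fix \<alpha> \<beta> assume *: "\<alpha> \<in> corona_aut T k P" "\<beta> \<in> corona_aut T k P"
    "restrict \<alpha> (corona T j P) = restrict \<beta> (corona T j P)"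
  show "\<alpha> = \<beta>"
  proof (rule corona_aut_rigid[OF assms(1) *(1,2)])
    fix F assume "F \<in> face_lattice P"
    then have "F \<in> corona T j P" using face_lattice_subset_corona[OF assms(1)] by blast
    then show "\<alpha> F = \<beta> F" using fun_cong[OF *(3), of F] by simp
  qed
qed

text \<open>The corona itself can be infinite: on the line the empty face has dimension
  \<open>d - 2\<close>, so any two tiles are adjacent. Finiteness comes from rigidity, which embeds
  the group into the automorphisms of one polytope.\<close>

lemma finite_corona_aut:
  assumes "P \<in> T" shows "finite (corona_aut T k P)"
proof -
  have "finite (face_lattice P)"
    using finite_polytope_faces[OF polytope_tile[OF assms]] by (simp add: face_lattice_def)
  then have "finite (face_lattice P \<rightarrow>\<^sub>E face_lattice P)" by (simp add: finite_PiE)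
  moreover have "corona_aut T 0 P \<subseteq> face_lattice P \<rightarrow>\<^sub>E face_lattice P"
    by (auto simp: corona_aut_def corona_0 PiE_def order_iso_mem)
  ultimately have "finite (corona_aut T 0 P)" by (rule rev_finite_subset)
  moreover have "(\<lambda>\<alpha>. restrict \<alpha> (corona T 0 P)) ` corona_aut T k P \<subseteq> corona_aut T 0 P"
    using restrict_corona_aut[OF assms] by blast
  ultimately show ?thesis using inj_on_finite[OF inj_on_restrict_corona_aut[OF assms, of 0 k]] by blast
qed

section \<open>Classification of tiles by coronas and by automorphisms\<close>

lemma equiv_corona_iso_rel: "equiv T (corona_iso_rel T k)"
proof (rule equivI)
  show "corona_iso_rel T k \<subseteq> T \<times> T" by (auto simp: corona_iso_rel_def)
  show "refl_on T (corona_iso_rel T k)"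
    unfolding refl_on_def using order_iso_id by (fastforce simp: corona_iso_rel_def)
  show "sym (corona_iso_rel T k)"
  proof (rule symI)
    fix P P' assume "(P, P') \<in> corona_iso_rel T k"
    then obtain f where f: "P \<in> T" "P' \<in> T" "order_iso (corona T k P) (corona T k P') f" "f P = P'"
      by (auto simp: corona_iso_rel_def)
    have "inv_into (corona T k P) f P' = P"
      using order_iso_inv_into_eq[OF f(3) center_in_corona[OF f(1)]] f(4) by simp
    then show "(P', P) \<in> corona_iso_rel T k"
      using order_iso_inv_into[OF f(3)] f by (auto simp: corona_iso_rel_def)
  qed
  show "trans (corona_iso_rel T k)"
  proof (rule transI)
    fix P Q R assume "(P, Q) \<in> corona_iso_rel T k" "(Q, R) \<in> corona_iso_rel T k"
    then obtain f g where "P \<in> T" "R \<in> T" "order_iso (corona T k P) (corona T k Q) f" "f P = Q"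
      "order_iso (corona T k Q) (corona T k R) g" "g Q = R"
      by (auto simp: corona_iso_rel_def)
    then show "(P, R) \<in> corona_iso_rel T k"
      using order_iso_comp by (fastforce simp: corona_iso_rel_def)
  qed
qed

lemma corona_iso_rel_antimono: "j \<le> k \<Longrightarrow> corona_iso_rel T k \<subseteq> corona_iso_rel T j"
  using corona_iso_restrict by (fastforce simp: corona_iso_rel_def)

lemma tile_orbit_rel_iff:
  "(P, Q) \<in> tile_orbit_rel T \<longleftrightarrow> P \<in> T \<and> Q \<in> T \<and> (\<exists>f. order_iso (faces T) (faces T) f \<and> f P = Q)"
proof -
  have "\<exists>\<phi>\<in>comb_aut T. \<phi> P = Q" if "P \<in> T" "order_iso (faces T) (faces T) f" "f P = Q" for f
    using restrict_order_iso[OF that(2)] that tile_in_faces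
    by (intro bexI[of _ "restrict f (faces T)"]) (auto simp: comb_aut_def)
  then show ?thesis by (auto simp: tile_orbit_rel_def comb_aut_def)
qed

lemma equiv_tile_orbit_rel: "equiv T (tile_orbit_rel T)"
proof (rule equivI)
  show "tile_orbit_rel T \<subseteq> T \<times> T" by (auto simp: tile_orbit_rel_def)
  show "refl_on T (tile_orbit_rel T)"
    unfolding refl_on_def using order_iso_id by (fastforce simp: tile_orbit_rel_iff)
  show "sym (tile_orbit_rel T)"
  proof (rule symI)
    fix P P' assume "(P, P') \<in> tile_orbit_rel T"
    then obtain f where f: "P \<in> T" "P' \<in> T" "order_iso (faces T) (faces T) f" "f P = P'"
      by (auto simp: tile_orbit_rel_iff)
    have "inv_into (faces T) f P' = P"
      using order_iso_inv_into_eq[OF f(3) tile_in_faces[OF f(1)]] f(4) by simp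
    then show "(P', P) \<in> tile_orbit_rel T"
      using order_iso_inv_into[OF f(3)] f by (auto simp: tile_orbit_rel_iff)
  qed
  show "trans (tile_orbit_rel T)"
  proof (rule transI)
    fix P Q R assume "(P, Q) \<in> tile_orbit_rel T" "(Q, R) \<in> tile_orbit_rel T"
    then obtain f g where "P \<in> T" "R \<in> T" "order_iso (faces T) (faces T) f" "f P = Q"
      "order_iso (faces T) (faces T) g" "g Q = R"
      by (auto simp: tile_orbit_rel_iff)
    then show "(P, R) \<in> tile_orbit_rel T"
      using order_iso_comp[of "faces T" "faces T" f "faces T" g] by (auto simp: tile_orbit_rel_iff)
  qed
qed

lemma tile_orbit_rel_subset: "tile_orbit_rel T \<subseteq> corona_iso_rel T k"
  using comb_aut_restrict_corona by (fastforce simp: tile_orbit_rel_iff corona_iso_rel_def)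

text \<open>Conjugation with a centered isomorphism embeds one group into the other. It transfers
  group orders from orbit representatives to all tiles.\<close>

lemma card_corona_aut_le:
  assumes "(R, P) \<in> corona_iso_rel T k"
  shows "card (corona_aut T k R) \<le> card (corona_aut T k P)"
proof -
  obtain f where f: "R \<in> T" "P \<in> T" "order_iso (corona T k R) (corona T k P) f" "f R = P"
    using assms by (auto simp: corona_iso_rel_def)
  let ?g = "inv_into (corona T k R) f"
  let ?c = "\<lambda>\<theta>. restrict (\<lambda>F. f (\<theta> (?g F))) (corona T k P)"
  have g: "order_iso (corona T k P) (corona T k R) ?g" using order_iso_inv_into[OF f(3)] .
  have gf: "?g (f F) = F" if "F \<in> corona T k R" for F using order_iso_inv_into_eq[OF f(3) that] .
  have gP: "?g P = R" using gf[OF center_in_corona[OF f(1)]] f(4) by simp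
  have "?c \<theta> \<in> corona_aut T k P" if \<theta>: "\<theta> \<in> corona_aut T k R" for \<theta>
  proof -
    have "order_iso (corona T k R) (corona T k R) \<theta>" "\<theta> R = R" using \<theta> by (auto simp: corona_aut_def)
    then have "order_iso (corona T k P) (corona T k P) (\<lambda>F. f (\<theta> (?g F)))"
      using order_iso_comp[OF g order_iso_comp[OF _ f(3)]] by blast
    then show ?thesis
      using restrict_order_iso center_in_corona[OF f(2)] gP \<open>\<theta> R = R\<close> f(4) by (auto simp: corona_aut_def)
  qed
  then have sub: "?c ` corona_aut T k R \<subseteq> corona_aut T k P" by blast
  have "inj_on ?c (corona_aut T k R)"
  proof (rule inj_onI)
    fix \<theta> \<eta> assume *: "\<theta> \<in> corona_aut T k R" "\<eta> \<in> corona_aut T k R" "?c \<theta> = ?c \<eta>"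
    have iso: "order_iso (corona T k R) (corona T k R) \<theta>" "order_iso (corona T k R) (corona T k R) \<eta>"
      using * by (auto simp: corona_aut_def)
    show "\<theta> = \<eta>"
    proof (rule extensionalityI[of _ "corona T k R"])
      fix F assume F: "F \<in> corona T k R"
      have "f (\<theta> F) = f (\<eta> F)"
        using fun_cong[OF *(3), of "f F"] order_iso_mem[OF f(3) F] gf[OF F] by simp
      then show "\<theta> F = \<eta> F"
        using order_iso_eq_iff[OF f(3) order_iso_mem[OF iso(1) F] order_iso_mem[OF iso(2) F]] by simp
    qed (use * in \<open>auto simp: corona_aut_def\<close>)
  qed
  then show ?thesis using sub finite_corona_aut[OF f(2)] by (rule card_inj_on_le)
qed

end

section \<open>Continuation of corona isomorphisms\<close>

text \<open>Here \<open>m\<close> is \<open>k - 1\<close>. The assumption is the combined content of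
  conditions (1) and (2); uniqueness of \<open>\<beta>\<close> on the corona is not assumed but
  follows from rigidity.\<close>

locale extendable_coronas = polytopal_tiling T
  for T :: "'a::euclidean_space set set" +
  fixes m :: nat
  assumes corona_iso_extends: "\<And>Q Q' \<alpha>. Q \<in> T \<Longrightarrow> Q' \<in> T
      \<Longrightarrow> order_iso (corona T m Q) (corona T m Q') \<alpha> \<Longrightarrow> \<alpha> Q = Q'
      \<Longrightarrow> \<exists>\<beta>. order_iso (corona T (Suc m) Q) (corona T (Suc m) Q') \<beta> \<and> (\<forall>F\<in>corona T m Q. \<beta> F = \<alpha> F)"
begin

text \<open>Extensionality makes germs with equal values on the corona equal as functions, so that
  the transport laws can be stated as equations. The target tile is not a parameter but is read off
  as \<open>g Q\<close>.\<close>

definition germ :: "'a set \<Rightarrow> ('a set \<Rightarrow> 'a set) \<Rightarrow> bool" where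
  "germ Q g \<longleftrightarrow> g \<in> extensional (corona T (Suc m) Q) \<and> g Q \<in> T
     \<and> order_iso (corona T (Suc m) Q) (corona T (Suc m) (g Q)) g"

text \<open>The choice is harmless: \<open>g\<close> is an isomorphism on the smaller corona of an
  adjacent \<open>R\<close>, and by rigidity at most one germ extends it.\<close>

definition continue_germ :: "'a set \<Rightarrow> 'a set \<Rightarrow> ('a set \<Rightarrow> 'a set) \<Rightarrow> 'a set \<Rightarrow> 'a set" where
  "continue_germ Q R g = (SOME h. germ R h \<and> (\<forall>F\<in>corona T m R. h F = g F))"

lemma germ_local_iso: "Q \<in> T \<Longrightarrow> germ Q g \<Longrightarrow> local_iso (tile_ball (Suc m) Q) g"
  using corona_iso_imp_local_iso by (auto simp: germ_def)

lemma germ_rigid: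
  assumes "R \<in> T" "germ R g" "germ R h" "\<And>F. F \<in> face_lattice R \<Longrightarrow> g F = h F"
  shows "g = h"
proof (rule extensionalityI[of _ "corona T (Suc m) R"])
  show "g F = h F" if "F \<in> corona T (Suc m) R" for F
    using corona_rigid[OF assms(1) germ_local_iso[OF assms(1,2)] germ_local_iso[OF assms(1,3)] _ that]
      assms(4) by blast
qed (use assms in \<open>auto simp: germ_def\<close>)

lemma germ_extending:
  assumes "Q \<in> T" "Q' \<in> T" "order_iso (corona T m Q) (corona T m Q') \<alpha>" "\<alpha> Q = Q'"
  shows "\<exists>h. germ Q h \<and> (\<forall>F\<in>corona T m Q. h F = \<alpha> F)"
proof -
  obtain \<beta> where \<beta>: "order_iso (corona T (Suc m) Q) (corona T (Suc m) Q') \<beta>"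
    "\<forall>F\<in>corona T m Q. \<beta> F = \<alpha> F"
    using corona_iso_extends[OF assms] by blast
  have "\<beta> Q = Q'" using \<beta>(2) center_in_corona[OF assms(1)] assms(4) by simp
  then have "germ Q (restrict \<beta> (corona T (Suc m) Q))"
    using restrict_order_iso[OF \<beta>(1)] center_in_corona[OF assms(1)] assms(2) by (simp add: germ_def)
  moreover have "\<forall>F\<in>corona T m Q. restrict \<beta> (corona T (Suc m) Q) F = \<alpha> F"
    using \<beta>(2) corona_mono[OF assms(1), of m "Suc m"] by auto
  ultimately show ?thesis by blast
qed

lemma continue_germ:
  assumes "(Q, R) \<in> adj_rel T" "germ Q g"
  shows "germ R (continue_germ Q R g)" "\<And>F. F \<in> corona T m R \<Longrightarrow> continue_germ Q R g F = g F"
proof -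
  have T: "Q \<in> T" "R \<in> T" using assms(1) by (auto simp: adj_rel_iff)
  have g: "g Q \<in> T" "order_iso (corona T (Suc m) Q) (corona T (Suc m) (g Q)) g"
    using assms(2) by (auto simp: germ_def)
  note R = corona_iso_restrict_neighbour[OF T(1) g refl assms(1)]
  have "g R \<in> T" using R(2) by (simp add: adj_rel_iff)
  then have "\<exists>h. germ R h \<and> (\<forall>F\<in>corona T m R. h F = g F)"
    using germ_extending[OF T(2) _ R(1) refl] by blast
  from someI_ex[OF this] show "germ R (continue_germ Q R g)"
    "\<And>F. F \<in> corona T m R \<Longrightarrow> continue_germ Q R g F = g F"
    unfolding continue_germ_def by blast+
qed

lemma continue_germ_eqI:
  assumes "(Q, R) \<in> adj_rel T" "germ Q g" "germ R h" "\<And>F. F \<in> face_lattice R \<Longrightarrow> h F = g F"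
  shows "continue_germ Q R g = h"
proof -
  have "R \<in> T" using assms(1) by (simp add: adj_rel_iff)
  then show ?thesis
    using germ_rigid[OF _ continue_germ(1)[OF assms(1,2)] assms(3)] continue_germ(2)[OF assms(1,2)]
      face_lattice_subset_corona assms(4) by (metis subsetD)
qed

lemma adj_rel_off_codim3:
  assumes "x \<notin> \<Union>codim3_faces" "Q \<in> T" "R \<in> T" "x \<in> Q" "x \<in> R"
  shows "(Q, R) \<in> adj_rel T"
proof -
  have "Q \<inter> R \<in> faces T" using Int_face_of_tile assms(2,3) by (auto simp: faces_def)
  then have "\<not> aff_dim (Q \<inter> R) \<le> int DIM('a) - 3" using assms by (auto simp: codim3_faces_def)
  then show ?thesis using assms by (simp add: adj_rel_iff)
qed

text \<open>Tiles through \<open>x\<close> are pairwise adjacent, so all of them lie in the corona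
  of each, whose level \<open>Suc m\<close> is at least 1. Thus \<open>g\<close> and its
  continuation to \<open>R\<close> are both local isomorphisms around \<open>x\<close>; they agree
  on \<open>R\<close>, and the facet chain around \<open>x\<close> carries the agreement to
  \<open>S\<close>.\<close>

lemma continue_germ_trans:
  assumes x: "x \<notin> \<Union>codim3_faces" and T: "Q \<in> T" "R \<in> T" "S \<in> T" and xin: "x \<in> Q" "x \<in> R" "x \<in> S"
    and g: "germ Q g"
  shows "continue_germ R S (continue_germ Q R g) = continue_germ Q S g"
proof -
  let ?h = "continue_germ Q R g"
  let ?D = "{A\<in>T. x \<in> A}"
  have adj: "(Q, R) \<in> adj_rel T" "(R, S) \<in> adj_rel T" "(Q, S) \<in> adj_rel T"
    using adj_rel_off_codim3[OF x] T xin by auto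
  have h: "germ R ?h" by (rule continue_germ(1)[OF adj(1) g])
  have sub: "?D \<subseteq> tile_ball (Suc m) A" if "A \<in> T" "x \<in> A" for A
    using adj_rel_tile_ball adj_rel_off_codim3[OF x] that by blast
  have "\<forall>F\<in>face_lattice S. g F = ?h F"
  proof (rule local_iso_agree_chain[of ?D])
    show "local_iso ?D g" using local_iso_mono[OF germ_local_iso[OF T(1) g] sub] T(1) xin(1) by blast
    show "local_iso ?D ?h" using local_iso_mono[OF germ_local_iso[OF T(2) h] sub] T(2) xin(2) by blast
    show "(R, S) \<in> (facet_adj ?D)\<^sup>*" by (rule facet_chain_at_point[OF T(2,3) xin(2,3)])
    show "\<forall>F\<in>face_lattice R. g F = ?h F"
      using continue_germ(2)[OF adj(1) g] face_lattice_subset_corona[OF T(2), of m] by auto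
  qed auto
  then show ?thesis
    using continue_germ_eqI[OF adj(2) h continue_germ(1)[OF adj(3) g]] continue_germ(2)[OF adj(3) g]
      face_lattice_subset_corona[OF T(3), of m] by (metis subsetD)
qed

lemma germ_section_exists:
  assumes "P \<in> T" "germ P g"
  obtains f where "f P = g" "\<And>Q. Q \<in> T \<Longrightarrow> germ Q (f Q)"
    "\<And>Q R F. (Q, R) \<in> facet_adj T \<Longrightarrow> F \<in> face_lattice R \<Longrightarrow> f R F = f Q F"
proof -
  interpret tile_transport T germ continue_germ
  proof unfold_locales
    fix Q g assume Q: "Q \<in> T" "germ Q g"
    then show "continue_germ Q Q g = g" using continue_germ_eqI[OF adj_rel_refl] by blast
  next
    fix x Q R g assume "x \<notin> \<Union>codim3_faces" "Q \<in> T" "R \<in> T" "x \<in> Q" "x \<in> R" "germ Q g"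
    then show "germ R (continue_germ Q R g)" using continue_germ(1) adj_rel_off_codim3 by blast
  qed (rule continue_germ_trans)
  obtain f where f: "f P = g" "\<forall>Q\<in>T. germ Q (f Q)" "\<forall>(Q, R)\<in>facet_adj T. f R = continue_germ Q R (f Q)"
    using flat_section_exists[OF assms] by blast
  have "f R F = f Q F" if QR: "(Q, R) \<in> facet_adj T" and F: "F \<in> face_lattice R" for Q R F
  proof -
    have T: "Q \<in> T" "R \<in> T" using QR by (auto simp: facet_adj_def)
    have "f R = continue_germ Q R (f Q)" using f(3) QR by blast
    then show ?thesis
      using continue_germ(2)[OF facet_adj_imp_adj_rel[OF order_refl QR], of "f Q" F] f(2) T
        face_lattice_subset_corona[OF T(2), of m] F by auto
  qed
  then show ?thesis using that f by blast
qed

lemma local_iso_extending_germ: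
  assumes P: "P \<in> T" "germ P g"
  obtains \<Phi> where "local_iso T \<Phi>" "\<And>F. F \<in> face_lattice P \<Longrightarrow> \<Phi> F = g F"
proof -
  obtain f where f: "f P = g" "\<And>Q. Q \<in> T \<Longrightarrow> germ Q (f Q)"
    "\<And>Q R F. (Q, R) \<in> facet_adj T \<Longrightarrow> F \<in> face_lattice R \<Longrightarrow> f R F = f Q F"
    using germ_section_exists[OF P] by blast
  have loc: "local_iso (tile_ball (Suc m) Q) (f Q)" if "Q \<in> T" for Q
    using germ_local_iso f(2) that by blast
  have fQ: "f Q Q \<in> T" "order_iso (face_lattice Q) (face_lattice (f Q Q)) (f Q)" if "Q \<in> T" for Q
    using local_isoD[OF loc[OF that] tile_ball_center[OF that]] by auto
  \<comment> \<open>Compatibility across facets suffices for faces of every dimension: all tiles in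
    a facet chain around a relatively interior point of \<open>F\<close> contain \<open>F\<close>,
    and the value at \<open>F\<close> does not change along the chain. The empty face has no such
    point and is fixed by every lattice isomorphism.\<close>
  have agree: "f Q F = f R F" if QR: "Q \<in> T" "R \<in> T" "F face_of Q" "F face_of R" for Q R F
  proof (cases "F = {}")
    case True
    have "f A {} = {}" if "A \<in> T" for A
      using order_iso_bot[OF fQ(2)[OF that]] by (simp add: face_lattice_def)
    then show ?thesis using True QR by simp
  next
    case False
    then obtain x where x: "x \<in> rel_interior F"
      using rel_interior_eq_empty face_of_imp_convex[OF QR(3)] by blast
    have xQR: "x \<in> Q" "x \<in> R" using x rel_interior_subset QR(3,4) face_of_imp_subset by blast+
    from facet_chain_at_point[OF QR(1,2) xQR] show ?thesis
    proof (induction rule: rtrancl_induct)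
      case (step A B)
      have AB: "(A, B) \<in> facet_adj T" "B \<in> T" "x \<in> B" using step.hyps(2) by (auto simp: facet_adj_def)
      have "F face_of B" by (rule nonempty_face_of_tile_at_rel_interior[OF QR(1) AB(2) QR(3) x AB(3)])
      then show ?case using f(3)[OF AB(1), of F] step.IH by (simp add: face_lattice_def)
    qed simp
  qed
  define \<Phi> where "\<Phi> F = f (SOME Q. Q \<in> T \<and> F face_of Q) F" for F
  have \<Phi>: "\<Phi> F = f Q F" if Q: "Q \<in> T" "F face_of Q" for Q F
  proof -
    have "\<exists>Q. Q \<in> T \<and> F face_of Q" using Q by blast
    from someI_ex[OF this] show ?thesis unfolding \<Phi>_def using agree Q by blast
  qed
  have "local_iso T \<Phi>"
    unfolding local_iso_def
  proof (intro conjI ballI)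
    fix Q assume Q: "Q \<in> T"
    have "\<Phi> Q = f Q Q" using \<Phi>[OF Q tile_face_self[OF Q]] .
    then show "\<Phi> Q \<in> T" "order_iso (face_lattice Q) (face_lattice (\<Phi> Q)) \<Phi>"
      using fQ[OF Q] order_iso_cong[of "face_lattice Q" \<Phi> "f Q"] \<Phi>[OF Q] by (auto simp: face_lattice_def)
  next
    fix p assume p: "p \<in> facet_adj T"
    then obtain Q R where QR: "p = (Q, R)" "(Q, R) \<in> facet_adj T" by (cases p) auto
    have T: "Q \<in> T" "R \<in> T" using QR by (auto simp: facet_adj_def)
    have "Q = R" if eq: "\<Phi> Q = \<Phi> R"
    proof -
      have "R \<in> face_lattice R" using tile_face_self[OF T(2)] by (simp add: face_lattice_def)
      then have "f Q Q = f Q R"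
        using eq \<Phi>[OF T(1) tile_face_self[OF T(1)]] \<Phi>[OF T(2) tile_face_self[OF T(2)]] f(3)[OF QR(2)] by simp
      moreover have "(Q, R) \<in> facet_adj (tile_ball (Suc m) Q)"
        using QR(2) tile_ball_center[OF T(1)] adj_rel_tile_ball[OF facet_adj_imp_adj_rel[OF order_refl QR(2)]]
        by (simp add: facet_adj_def)
      ultimately show ?thesis using loc[OF T(1)] by (auto simp: local_iso_def)
    qed
    then show "case p of (Q, R) \<Rightarrow> \<Phi> Q = \<Phi> R \<longrightarrow> Q = R" using QR by simp
  qed
  then show ?thesis using that[of \<Phi>] \<Phi>[OF P(1)] f(1) by (simp add: face_lattice_def)
qed

lemma germ_extends_globally:
  assumes P: "P \<in> T" "germ P g"
  obtains \<Phi> where "order_iso (faces T) (faces T) \<Phi>" "\<And>F. F \<in> corona T (Suc m) P \<Longrightarrow> \<Phi> F = g F"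
proof -
  let ?C = "corona T (Suc m) P" and ?C' = "corona T (Suc m) (g P)"
  have g: "g P \<in> T" "order_iso ?C ?C' g" using P(2) by (auto simp: germ_def)
  let ?g' = "restrict (inv_into ?C g) ?C'"
  have inv: "inv_into ?C g (g F) = F" if "F \<in> ?C" for F using order_iso_inv_into_eq[OF g(2) that] .
  have g'P: "?g' (g P) = P" using inv center_in_corona P(1) g(1) by simp
  have "germ (g P) ?g'"
    using restrict_order_iso[OF order_iso_inv_into[OF g(2)]] g'P P(1) by (simp add: germ_def)
  then obtain \<Psi> where \<Psi>: "local_iso T \<Psi>" "\<And>F. F \<in> face_lattice (g P) \<Longrightarrow> \<Psi> F = ?g' F"
    using local_iso_extending_germ[OF g(1)] by blast
  obtain \<Phi> where \<Phi>: "local_iso T \<Phi>" "\<And>F. F \<in> face_lattice P \<Longrightarrow> \<Phi> F = g F"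
    using local_iso_extending_germ[OF P] by blast
  have flP: "face_lattice P \<subseteq> ?C" "face_lattice (g P) \<subseteq> ?C'"
    using face_lattice_subset_corona P(1) g(1) by auto
  have g_iso: "order_iso (face_lattice P) (face_lattice (g P)) g"
    using local_isoD(2)[OF germ_local_iso[OF P] tile_ball_center[OF P(1)]] .
  have "order_iso (faces T) (faces T) \<Phi>"
  proof (rule local_iso_inverse_imp_order_iso[OF \<Phi>(1) \<Psi>(1) P(1) _ g(1)])
    show "\<Psi> (\<Phi> F) = F" if F: "F \<in> face_lattice P" for F
      using \<Phi>(2)[OF F] \<Psi>(2)[OF order_iso_mem[OF g_iso F]] order_iso_mem[OF g_iso F] flP inv F by auto
    show "\<Phi> (\<Psi> F) = F" if F: "F \<in> face_lattice (g P)" for F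
    proof -
      obtain G where G: "G \<in> face_lattice P" "g G = F" using order_iso_surj[OF g_iso F] by blast
      then have "\<Psi> F = G" using \<Psi>(2)[OF F] flP F inv[of G] by auto
      then show ?thesis using \<Phi>(2)[OF G(1)] G(2) by simp
    qed
  qed
  moreover have "\<Phi> F = g F" if "F \<in> ?C" for F
    using corona_rigid[OF P(1) local_iso_mono[OF \<Phi>(1) tile_ball_tiles[OF P(1)]] germ_local_iso[OF P] _ that]
      \<Phi>(2) by blast
  ultimately show ?thesis using that by blast
qed

lemma corona_iso_rel_eq_tile_orbit_rel: "corona_iso_rel T (Suc m) = tile_orbit_rel T"
proof
  show "corona_iso_rel T (Suc m) \<subseteq> tile_orbit_rel T"
  proof (rule subrelI)
    fix P P' assume "(P, P') \<in> corona_iso_rel T (Suc m)"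
    then obtain f where f: "P \<in> T" "P' \<in> T" "order_iso (corona T (Suc m) P) (corona T (Suc m) P') f" "f P = P'"
      by (auto simp: corona_iso_rel_def)
    let ?g = "restrict f (corona T (Suc m) P)"
    have "germ P ?g" using restrict_order_iso[OF f(3)] f center_in_corona[OF f(1)] by (simp add: germ_def)
    then obtain \<Phi> where "order_iso (faces T) (faces T) \<Phi>" "\<And>F. F \<in> corona T (Suc m) P \<Longrightarrow> \<Phi> F = ?g F"
      using germ_extends_globally[OF f(1)] by blast
    then show "(P, P') \<in> tile_orbit_rel T"
      using f center_in_corona[OF f(1)] by (auto simp: tile_orbit_rel_iff)
  qed
qed (rule tile_orbit_rel_subset)

lemma restrict_tile_stabilizer_bij:
  assumes "P \<in> T"
  shows "bij_betw (\<lambda>\<phi>. restrict \<phi> (corona T (Suc m) P)) (tile_stabilizer T P) (corona_aut T (Suc m) P)"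
proof -
  let ?C = "corona T (Suc m) P"
  have stab: "order_iso (faces T) (faces T) \<phi>" "\<phi> P = P" "\<phi> \<in> extensional (faces T)"
    if "\<phi> \<in> tile_stabilizer T P" for \<phi>
    using that by (auto simp: tile_stabilizer_def comb_aut_def)
  show ?thesis
  proof (rule bij_betw_imageI)
    show "inj_on (\<lambda>\<phi>. restrict \<phi> ?C) (tile_stabilizer T P)"
    proof (rule inj_onI)
      fix \<phi> \<psi> assume *: "\<phi> \<in> tile_stabilizer T P" "\<psi> \<in> tile_stabilizer T P" "restrict \<phi> ?C = restrict \<psi> ?C"
      have "\<phi> F = \<psi> F" if "F \<in> face_lattice P" for F
      proof -
        have "F \<in> ?C" using face_lattice_subset_corona[OF assms] that by blast
        then show ?thesis using fun_cong[OF *(3), of F] by simp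
      qed
      then have "\<phi> F = \<psi> F" if "F \<in> faces T" for F
        using faces_rigid[OF assms comb_aut_local_iso[OF stab(1)[OF *(1)]]
            comb_aut_local_iso[OF stab(1)[OF *(2)]] _ that] by blast
      then show "\<phi> = \<psi>" using stab(3)[OF *(1)] stab(3)[OF *(2)] by (intro extensionalityI)
    qed
    show "(\<lambda>\<phi>. restrict \<phi> ?C) ` tile_stabilizer T P = corona_aut T (Suc m) P"
    proof
      show "(\<lambda>\<phi>. restrict \<phi> ?C) ` tile_stabilizer T P \<subseteq> corona_aut T (Suc m) P"
      proof (rule image_subsetI)
        fix \<phi> assume \<phi>: "\<phi> \<in> tile_stabilizer T P"
        have "order_iso ?C ?C \<phi>"
          using comb_aut_restrict_corona(2)[OF stab(1)[OF \<phi>] assms, of "Suc m"] stab(2)[OF \<phi>] by simp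
        then show "restrict \<phi> ?C \<in> corona_aut T (Suc m) P"
          using restrict_order_iso stab(2)[OF \<phi>] center_in_corona[OF assms] by (simp add: corona_aut_def)
      qed
      show "corona_aut T (Suc m) P \<subseteq> (\<lambda>\<phi>. restrict \<phi> ?C) ` tile_stabilizer T P"
      proof
        fix \<alpha> assume \<alpha>: "\<alpha> \<in> corona_aut T (Suc m) P"
        then have "germ P \<alpha>" using assms by (auto simp: corona_aut_def germ_def)
        then obtain \<Phi> where \<Phi>: "order_iso (faces T) (faces T) \<Phi>" "\<And>F. F \<in> ?C \<Longrightarrow> \<Phi> F = \<alpha> F"
          using germ_extends_globally[OF assms] by blast
        let ?\<phi> = "restrict \<Phi> (faces T)"
        have "\<Phi> P = P" using \<Phi>(2)[OF center_in_corona[OF assms]] \<alpha> by (simp add: corona_aut_def)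
        then have "?\<phi> \<in> tile_stabilizer T P"
          using restrict_order_iso[OF \<Phi>(1)] tile_in_faces[OF assms]
          by (simp add: tile_stabilizer_def comb_aut_def)
        moreover have "\<alpha> = restrict ?\<phi> ?C"
        proof (rule extensionalityI[of _ ?C])
          show "\<alpha> F = restrict ?\<phi> ?C F" if "F \<in> ?C" for F
            using that \<Phi>(2)[OF that] corona_subset_faces[OF assms, of "Suc m"] by auto
        qed (use \<alpha> in \<open>auto simp: corona_aut_def\<close>)
        ultimately show "\<alpha> \<in> (\<lambda>\<phi>. restrict \<phi> ?C) ` tile_stabilizer T P" by blast
      qed
    qed
  qed
qed

end

text \<open>Sending each class of \<open>r\<close> to the class of \<open>s\<close> containing it is
  onto; equal finite cardinalities make it injective, so no class of \<open>s\<close> splits. It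
  turns equality of the numbers of corona classes into equality of the relations.\<close>

lemma equiv_eq_if_card_quotient_eq:
  assumes "equiv A r" "equiv A s" "r \<subseteq> s" "finite (A // r)" "card (A // r) = card (A // s)"
  shows "r = s"
proof
  show "s \<subseteq> r"
  proof (rule subrelI)
    fix x y assume xy: "(x, y) \<in> s"
    then have A: "x \<in> A" "y \<in> A" using equiv_type[OF assms(2)] by auto
    have img: "(\<lambda>X. s `` X) ` (A // r) = A // s" by (rule refines_equiv_image_eq[OF assms(3,1,2)])
    have inj: "inj_on (\<lambda>X. s `` X) (A // r)"
      by (rule eq_card_imp_inj_on[OF assms(4)]) (use img assms(5) in argo)
    have cls: "s `` (r `` {z}) = s `` {z}" if "z \<in> A" for z
      using refines_equiv_class_eq2[OF assms(3,1,2), of z] by simp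
    have "s `` (r `` {x}) = s `` (r `` {y})" using cls A equiv_class_eq[OF assms(2) xy] by simp
    then have "r `` {x} = r `` {y}" by (rule inj_onD[OF inj _ quotientI[OF A(1)] quotientI[OF A(2)]])
    then show "(x, y) \<in> r" using eq_equiv_class[OF _ assms(1) A(2)] by blast
  qed
qed (rule assms(3))

section \<open>The two conditions and the number of orbits\<close>

context polytopal_tiling
begin

text \<open>By (1) there is an isomorphism \<open>\<gamma>\<close> of the larger coronas, but it
  need not extend \<open>\<alpha>\<close>. The discrepancy, \<open>\<alpha>\<close> followed by the
  inverse of \<open>\<gamma>\<close>, is an automorphism of the smaller corona; (2) extends it to
  \<open>\<epsilon>\<close>, and \<open>\<epsilon>\<close> followed by \<open>\<gamma>\<close>
  extends \<open>\<alpha>\<close>.\<close>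

lemma cond12_imp_extendable:
  assumes "cond1 T (Suc m)" "cond2 T (Suc m)" "finite (corona_classes T m)"
  shows "extendable_coronas T m"
proof unfold_locales
  have "card (T // corona_iso_rel T (Suc m)) = card (T // corona_iso_rel T m)" "finite (T // corona_iso_rel T (Suc m))"
    using assms(1) by (auto simp: cond1_def N_coronas_def corona_classes_def)
  then have rel: "corona_iso_rel T (Suc m) = corona_iso_rel T m"
    using equiv_eq_if_card_quotient_eq[OF equiv_corona_iso_rel equiv_corona_iso_rel corona_iso_rel_antimono[of m "Suc m"]]
    by simp
  fix Q Q' \<alpha>
  assume Q: "Q \<in> T" "Q' \<in> T" and \<alpha>: "order_iso (corona T m Q) (corona T m Q') \<alpha>" "\<alpha> Q = Q'"
  then have "(Q, Q') \<in> corona_iso_rel T (Suc m)" unfolding rel by (auto simp: corona_iso_rel_def)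
  then obtain \<gamma> where \<gamma>: "order_iso (corona T (Suc m) Q) (corona T (Suc m) Q') \<gamma>" "\<gamma> Q = Q'"
    by (auto simp: corona_iso_rel_def)
  have \<gamma>m: "order_iso (corona T m Q) (corona T m Q') \<gamma>" using corona_iso_restrict[OF Q \<gamma>] by simp
  let ?i = "inv_into (corona T m Q) \<gamma>"
  let ?\<delta> = "restrict (\<lambda>F. ?i (\<alpha> F)) (corona T m Q)"
  have "?i Q' = Q" using order_iso_inv_into_eq[OF \<gamma>m center_in_corona[OF Q(1)]] \<gamma>(2) by simp
  then have "?\<delta> \<in> corona_aut T m Q"
    using restrict_order_iso[OF order_iso_comp[OF \<alpha>(1) order_iso_inv_into[OF \<gamma>m]]]
      center_in_corona[OF Q(1)] \<alpha>(2) by (simp add: corona_aut_def)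
  moreover have "(\<lambda>\<alpha>. restrict \<alpha> (corona T m Q)) ` corona_aut T (Suc m) Q = corona_aut T m Q"
    using assms(2) Q(1) by (auto simp: cond2_def bij_betw_def)
  ultimately obtain \<epsilon> where \<epsilon>: "\<epsilon> \<in> corona_aut T (Suc m) Q" "restrict \<epsilon> (corona T m Q) = ?\<delta>"
    by (metis (no_types, lifting) imageE)
  have "order_iso (corona T (Suc m) Q) (corona T (Suc m) Q') (\<lambda>F. \<gamma> (\<epsilon> F))"
    using \<epsilon>(1) by (intro order_iso_comp[OF _ \<gamma>(1)]) (simp add: corona_aut_def)
  moreover have "\<gamma> (\<epsilon> F) = \<alpha> F" if F: "F \<in> corona T m Q" for F
  proof -
    have "\<epsilon> F = ?i (\<alpha> F)" using fun_cong[OF \<epsilon>(2), of F] F by simp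
    then show ?thesis using order_iso_f_inv_into[OF \<gamma>m order_iso_mem[OF \<alpha>(1) F]] by simp
  qed
  ultimately show "\<exists>\<beta>. order_iso (corona T (Suc m) Q) (corona T (Suc m) Q') \<beta> \<and> (\<forall>F\<in>corona T m Q. \<beta> F = \<alpha> F)"
    by blast
qed

lemma N_coronas_mono: "finite (corona_classes T (Suc k)) \<Longrightarrow> N_coronas T k \<le> N_coronas T (Suc k)"
  unfolding N_coronas_def corona_classes_def
  by (rule finite_refines_card_le[OF _ corona_iso_rel_antimono equiv_corona_iso_rel equiv_corona_iso_rel]) auto

lemma multihedral_imp_cond12:
  assumes multi: "comb_multihedral T" and fin: "\<And>j. finite (corona_classes T j)"
  shows "\<exists>m. cond1 T (Suc m) \<and> cond2 T (Suc m)"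
proof -
  have finO: "finite (T // tile_orbit_rel T)" using multi by (simp add: comb_multihedral_def)
  define X where "X = (\<lambda>C. SOME x. x \<in> C) ` (T // tile_orbit_rel T)"
  have finX: "finite X" using finO by (simp add: X_def)
  have rep: "(SOME x. x \<in> tile_orbit_rel T `` {P}) \<in> tile_orbit_rel T `` {P}" if "P \<in> T" for P
    using equiv_class_self[OF equiv_tile_orbit_rel that] by (rule someI)
  have X_rep: "\<exists>R\<in>X. (P, R) \<in> tile_orbit_rel T" if "P \<in> T" for P
    using rep[OF that] quotientI[OF that, of "tile_orbit_rel T"] unfolding X_def by blast
  have XT: "X \<subseteq> T"
    using rep equiv_type[OF equiv_tile_orbit_rel] by (fastforce simp: X_def quotient_def)
  \<comment> \<open>\<open>c k + (B - N_coronas T k)\<close> is non-increasing in \<open>k\<close>, and where it is stationary both conditions hold.\<close>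
  define c where "c k = (\<Sum>R\<in>X. card (corona_aut T k R))" for k
  define B where "B = card (T // tile_orbit_rel T)"
  have card_le: "card (corona_aut T (Suc k) R) \<le> card (corona_aut T k R)" if "R \<in> T" for k R
    using inj_on_restrict_corona_aut[OF that, of k "Suc k"] restrict_corona_aut[OF that, of _ "Suc k" k]
      finite_corona_aut[OF that] by (intro card_inj_on_le[of "\<lambda>\<alpha>. restrict \<alpha> (corona T k R)"]) auto
  have c_le: "c (Suc k) \<le> c k" for k unfolding c_def using card_le XT by (intro sum_mono) blast
  \<comment> \<open>Orbits refine corona classes. The bound also keeps the natural number
    subtraction \<open>B - N_coronas T k\<close> exact, so a minimum of the potential forces both
    summands to be stationary.\<close>
  have N_le: "N_coronas T k \<le> B" for k
    unfolding N_coronas_def corona_classes_def B_def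
    by (rule finite_refines_card_le[OF finO tile_orbit_rel_subset equiv_tile_orbit_rel equiv_corona_iso_rel])
  obtain k where k: "\<And>j. c k + (B - N_coronas T k) \<le> c j + (B - N_coronas T j)"
    using ex_has_least_nat[of "\<lambda>_. True" undefined "\<lambda>k. c k + (B - N_coronas T k)"] by blast
  have "N_coronas T k \<le> N_coronas T (Suc k)" using N_coronas_mono fin by blast
  then have eqs: "N_coronas T k = N_coronas T (Suc k)" "c (Suc k) = c k"
    using k[of "Suc k"] c_le[of k] N_le[of "Suc k"] by linarith+
  \<comment> \<open>Equality of the sums gives equality of group orders only at the representatives
    in \<open>X\<close>; condition (2) concerns every tile, and group orders are constant on
    orbits.\<close>
  have cards: "card (corona_aut T (Suc k) P) = card (corona_aut T k P)" if P: "P \<in> T" for P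
  proof -
    obtain R where R: "R \<in> X" "(P, R) \<in> tile_orbit_rel T" using X_rep[OF P] by blast
    have rel: "(P, R) \<in> corona_iso_rel T j" "(R, P) \<in> corona_iso_rel T j" for j
      using tile_orbit_rel_subset R(2) equiv_corona_iso_rel[of j] by (auto simp: equiv_def dest: symD)
    have same: "card (corona_aut T j P) = card (corona_aut T j R)" for j
      using card_corona_aut_le[OF rel(1)] card_corona_aut_le[OF rel(2)] by (rule antisym)
    have "card (corona_aut T (Suc k) R) = card (corona_aut T k R)"
      by (rule sum_mono_inv[OF eqs(2)[unfolded c_def] _ R(1) finX]) (use card_le XT in blast)
    then show ?thesis by (simp add: same)
  qed
  have "cond2 T (Suc k)"
    unfolding cond2_def diff_Suc_1
  proof
    fix P assume P: "P \<in> T"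
    let ?r = "\<lambda>\<alpha>. restrict \<alpha> (corona T k P)"
    have inj: "inj_on ?r (corona_aut T (Suc k) P)" using inj_on_restrict_corona_aut[OF P] by simp
    have "?r ` corona_aut T (Suc k) P = corona_aut T k P"
    proof (rule card_subset_eq[OF finite_corona_aut[OF P]])
      show "?r ` corona_aut T (Suc k) P \<subseteq> corona_aut T k P" using restrict_corona_aut[OF P] by auto
      show "card (?r ` corona_aut T (Suc k) P) = card (corona_aut T k P)"
        using card_image[OF inj] cards[OF P] by simp
    qed
    then show "bij_betw ?r (corona_aut T (Suc k) P) (corona_aut T k P)" using inj by (simp add: bij_betw_def)
  qed
  moreover have "cond1 T (Suc k)" using fin eqs(1) by (simp add: cond1_def)
  ultimately show ?thesis by blast
qed

end

theorem theorem3p1: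
  fixes T :: "'a::euclidean_space set set"
  assumes "tiling T" and "locally_finite_tiling T" and "face_to_face T"
    and "\<forall>j. finite (corona_classes T j)"
  shows "(comb_multihedral T \<longleftrightarrow> (\<exists>k>0. cond1 T k \<and> cond2 T k))
    \<and> (\<forall>k>0. cond1 T k \<and> cond2 T k \<longrightarrow>
          (\<forall>P\<in>T. bij_betw (\<lambda>\<phi>. restrict \<phi> (corona T k P))
                           (tile_stabilizer T P) (corona_aut T k P))
          \<and> num_tile_orbits T = N_coronas T k)
    \<and> (\<forall>n>0. comb_tile_transitive T n \<longleftrightarrow>
          (\<exists>k>0. cond1 T k \<and> cond2 T k \<and> N_coronas T k = n))"
proof -
  interpret polytopal_tiling T using assms by unfold_locales
  have ext: "extendable_coronas T (k - 1) \<and> Suc (k - 1) = k" if "k > 0" "cond1 T k" "cond2 T k" for k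
    using cond12_imp_extendable[of "k - 1"] that assms(4) by simp
  have bij: "bij_betw (\<lambda>\<phi>. restrict \<phi> (corona T k P)) (tile_stabilizer T P) (corona_aut T k P)"
    if "k > 0" "cond1 T k" "cond2 T k" "P \<in> T" for k P
    using extendable_coronas.restrict_tile_stabilizer_bij[of T "k - 1" P] ext[OF that(1-3)] that(4) by simp
  have rel: "corona_iso_rel T k = tile_orbit_rel T" if "k > 0" "cond1 T k" "cond2 T k" for k
    using extendable_coronas.corona_iso_rel_eq_tile_orbit_rel[of T "k - 1"] ext[OF that] by simp
  have num: "num_tile_orbits T = N_coronas T k" if "k > 0" "cond1 T k" "cond2 T k" for k
    using rel[OF that] by (simp add: num_tile_orbits_def N_coronas_def corona_classes_def)
  have multi: "comb_multihedral T" if "k > 0" "cond1 T k" "cond2 T k" for k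
    using rel[OF that] assms(4) by (simp add: comb_multihedral_def corona_classes_def) metis
  have conds: "\<exists>k>0. cond1 T k \<and> cond2 T k" if "comb_multihedral T"
    using multihedral_imp_cond12[OF that] assms(4) by blast
  have "comb_tile_transitive T n \<longleftrightarrow> (\<exists>k>0. cond1 T k \<and> cond2 T k \<and> N_coronas T k = n)" for n
    unfolding comb_tile_transitive_def using conds multi num by metis
  then show ?thesis using conds multi num bij by blast
qed

end
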